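(* Let $n\ge 2$, $0<r_1<\ldots<r_n$, $\rho:=\{r_1,\ldots,r_n\}$ and $h:=\max_{1\le j\le n-1}(r_{j+1}-r_j)$. Let $F\in C^2(\mathbb{R}^2\setminus\{0\})\cap C(\mathbb{R}^2)$ be a real-valued function with polar form $f(r,\theta):=F(r\cos\theta,r\sin\theta)$ such that the polar Beppo Levi energy $\|f\|_{BL}^2$ is finite, and assume that $f(r_j,\cdot)\in W^2$ for each $j\in\{1,\ldots,n\}$. Let $S$ be either one of the following two Beppo Levi polysplines on annuli determined by $\rho$, with polar form $s$, satisfying the transfinite interpolation conditions $s(r_j,\theta)=f(r_j,\theta)$ for all $\theta\in[-\pi,\pi]$ and all $j\in\{1,\ldots,n\}$: the polyspline $S^A$, which is uniquely determined by the additional condition $S^A(0)=F(0)$, or the polyspline $S^B$, which is uniquely determined by the additional condition that $S^B$ is biharmonic at $0$. Then, for $m\in\{0,1\}$, $$\left(\int_{r_1}^{r_n}\int_{-\pi}^{\pi}\left|\frac{\partial^m}{\partial r^m}(f-s)(r,\theta)\right|^2 r\,d\theta\,dr\right)^{1/2}\le 2^{m-1}\sqrt{\frac{r_n}{r_1}}\;h^{2-m}\,\|f\|_{BL}.$$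
   Context: The polar Beppo Levi energy of a function with polar form $f$ is $$\|f\|_{BL}^2:=\int_0^\infty\!\int_{-\pi}^{\pi}\left\{|f_{rr}|^2+2\left|\frac{f_\theta}{r^2}-\frac{f_{\theta r}}{r}\right|^2+\left|\frac{f_{\theta\theta}}{r^2}+\frac{f_r}{r}\right|^2\right\}r\,d\theta\,dr,$$ i.e. the polar-coordinate version of $\iint_{\mathbb{R}^2}(|F_{xx}|^2+2|F_{xy}|^2+|F_{yy}|^2)\,dx\,dy$. $W^2$ is the Wiener-type algebra of continuous periodic functions $\mu:[-\pi,\pi]\to\mathbb{R}$ whose Fourier coefficients $\widehat\mu_k=\frac1{2\pi}\int_{-\pi}^{\pi}e^{-ik\theta}\mu(\theta)\,d\theta$ satisfy $\sum_{k\in\mathbb{Z}}|\widehat\mu_k|(1+|k|)^2<\infty$. A (biharmonic) Beppo Levi polyspline on annuli determined by $\rho=\{r_1,\ldots,r_n\}$ is a function $S:\mathbb{R}^2\to\mathbb{R}$, continuous on $\mathbb{R}^2$, with polar form $s(r,\theta)=S(r\cos\theta,r\sin\theta)$, such that: $S\in C^2(\mathbb{R}^2\setminus\{0\})$; $S$ is biharmonic, i.e. $(\partial_{xx}+\partial_{yy})^2S=0$, on each open annulus $0<r<r_1$, $r_j<r<r_{j+1}$ ($1\le j\le n-1$), and $r>r_n$; and $\|s\|_{BL}^2<\infty$. "$S$ is biharmonic at $0$" means that $S$ is (non-singular and) biharmonic in a full neighbourhood of the origin, i.e. on the disc $r<r_1$. For data $\mu_1,\ldots,\mu_n\in W^2$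 it is known that there is exactly one Beppo Levi polyspline $S^A$ on annuli determined by $\rho$ with $s^A(r_j,\cdot)=\mu_j$ for all $j$ and with an arbitrarily prescribed value $S^A(0)$, and exactly one Beppo Levi polyspline $S^B$ on annuli determined by $\rho$ with $s^B(r_j,\cdot)=\mu_j$ for all $j$ that is biharmonic at $0$. *)

theory Defs
  imports "HOL-Analysis.Analysis"
begin

definition partial_x :: "(real \<times> real \<Rightarrow> real) \<Rightarrow> real \<times> real \<Rightarrow> real" where
  "partial_x F p = deriv (\<lambda>t. F (t, snd p)) (fst p)"

definition partial_y :: "(real \<times> real \<Rightarrow> real) \<Rightarrow> real \<times> real \<Rightarrow> real" where
  "partial_y F p = deriv (\<lambda>t. F (fst p, t)) (snd p)"

text \<open>The class $C^k(U)$, meant for open $U$. Existence of the partial derivatives is demanded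
  explicitly, because \<^const>\<open>deriv\<close> is an unspecified number where there is no derivative.\<close>

primrec Ck_on :: "nat \<Rightarrow> (real \<times> real) set \<Rightarrow> (real \<times> real \<Rightarrow> real) \<Rightarrow> bool" where
  "Ck_on 0 U F \<longleftrightarrow> continuous_on U F"
| "Ck_on (Suc k) U F \<longleftrightarrow>
     continuous_on U F \<and>
     (\<forall>p\<in>U. (\<lambda>t. F (t, snd p)) field_differentiable (at (fst p)) \<and>
             (\<lambda>t. F (fst p, t)) field_differentiable (at (snd p))) \<and>
     Ck_on k U (partial_x F) \<and> Ck_on k U (partial_y F)"

definition laplacian :: "(real \<times> real \<Rightarrow> real) \<Rightarrow> real \<times> real \<Rightarrow> real" where
  "laplacian F p = partial_x (partial_x F) p + partial_y (partial_y F) p"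

definition biharmonic_on :: "(real \<times> real) set \<Rightarrow> (real \<times> real \<Rightarrow> real) \<Rightarrow> bool" where
  "biharmonic_on U F \<longleftrightarrow> Ck_on 4 U F \<and> (\<forall>p\<in>U. laplacian (laplacian F) p = 0)"

definition polar :: "(real \<times> real \<Rightarrow> real) \<Rightarrow> real \<Rightarrow> real \<Rightarrow> real" where
  "polar F r \<theta> = F (r * cos \<theta>, r * sin \<theta>)"

definition partial_r :: "(real \<Rightarrow> real \<Rightarrow> real) \<Rightarrow> real \<Rightarrow> real \<Rightarrow> real" where
  "partial_r f r \<theta> = deriv (\<lambda>t. f t \<theta>) r"

definition partial_theta :: "(real \<Rightarrow> real \<Rightarrow> real) \<Rightarrow> real \<Rightarrow> real \<Rightarrow> real" where
  "partial_theta f r \<theta> = deriv (\<lambda>t. f r t) \<theta>"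

text \<open>The squared polar Beppo Levi norm, with values in $[0,\infty]$.\<close>

definition BL_energy :: "(real \<Rightarrow> real \<Rightarrow> real) \<Rightarrow> ennreal" where
  "BL_energy f =
     (\<integral>\<^sup>+ r\<in>{0<..}. (\<integral>\<^sup>+ \<theta>\<in>{-pi..pi}. ennreal
        (((partial_r (partial_r f) r \<theta>)\<^sup>2
          + 2 * (partial_theta f r \<theta> / r\<^sup>2 - partial_r (partial_theta f) r \<theta> / r)\<^sup>2
          + (partial_theta (partial_theta f) r \<theta> / r\<^sup>2 + partial_r f r \<theta> / r)\<^sup>2) * r)
        \<partial>lborel) \<partial>lborel)"

text \<open>Since \<^const>\<open>enn2real\<close> sends $\infty$ to $0$, this is meaningful only for finite energy.\<close>

definition BL_norm :: "(real \<Rightarrow> real \<Rightarrow> real) \<Rightarrow> real" where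
  "BL_norm f = sqrt (enn2real (BL_energy f))"

definition fourier_coeff :: "(real \<Rightarrow> real) \<Rightarrow> int \<Rightarrow> complex" where
  "fourier_coeff \<mu> k =
     1 / (2 * complex_of_real pi) *
     (LBINT \<theta>:{-pi..pi}. exp (- \<i> * of_int k * complex_of_real \<theta>) * complex_of_real (\<mu> \<theta>))"

definition wiener2 :: "(real \<Rightarrow> real) set" where
  "wiener2 = {\<mu>. continuous_on {-pi..pi} \<mu> \<and> \<mu> (-pi) = \<mu> pi \<and>
     (\<lambda>k::int. cmod (fourier_coeff \<mu> k) * (1 + \<bar>real_of_int k\<bar>)\<^sup>2) summable_on UNIV}"

text \<open>The radii are $r_1 < \dots < r_n$; values of the sequence outside $1,\dots,n$ play no role.
  The norm on \<^typ>\<open>real \<times> real\<close> is the Euclidean one.\<close>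

definition BL_polyspline :: "nat \<Rightarrow> (nat \<Rightarrow> real) \<Rightarrow> (real \<times> real \<Rightarrow> real) \<Rightarrow> bool" where
  "BL_polyspline n r S \<longleftrightarrow>
     continuous_on UNIV S \<and>
     Ck_on 2 (UNIV - {0}) S \<and>
     biharmonic_on {p. 0 < norm p \<and> norm p < r 1} S \<and>
     (\<forall>j\<in>{1..n-1}. biharmonic_on {p. r j < norm p \<and> norm p < r (j + 1)} S) \<and>
     biharmonic_on {p. r n < norm p} S \<and>
     BL_energy (polar S) < \<infinity>"

end

theory Submission
  imports Defs
begin

text \<open>
  Expand $f$ and $s$ in the angle $\theta$. In each Fourier mode the Beppo Levi energy becomes a
  quadratic form in radial functions, the mode $v$ of the polyspline solves the Euler equation of this
  form between the circles, and the mode $u$ of $f - s$ vanishes at the radii. The Euler equation can be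
  written $M' = K$, where $M$ contains the third derivative of $v$ while $K$ only involves $v$ and $v'$;
  hence $M$ stays bounded at the circles, although nothing is assumed about third derivatives there,
  and integration by parts across the circles leaves only boundary terms at $0$ and $\infty$. Finite
  energy makes these small along suitable sequences of radii, so $u$ and $v$ are orthogonal and the energy
  of $u$ is at most that of the mode of $f$. Poincare inequalities between consecutive zeros of $u$ and
  Parseval's identity in $\theta$ then give the estimate.
\<close>

section \<open>Inequalities on an interval\<close>

text \<open>Each factor of the bound has its own source. Between two zeros, 2|u| is at most the
  integral of |u'| over the gap, which gives the squared constant 1/4. For u' Rolle provides one
  zero, with constant 1. Hence h^4/4 for m = 0 and h^2 for m = 1, the squares of 2^(m-1) h^(2-m).
  Replacing the weight r by r_n on the left and by r_1 in the energy gives r_n/r_1. The obstacle is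
  the behaviour at 0 and infinity. The energy controls the integral of r |u''|^2, and dr/r diverges
  at both ends, so u' may grow like the square root of a logarithm and the boundary term has no
  evident pointwise decay. It is therefore averaged over [a, a^2] (near 0 over [a^2, a]), where the
  logarithm of the radius is comparable to the logarithmic length of the interval and all powers of
  that length cancel. At the origin only the angular mean of the error can have a nonzero limit. The
  condition S(0) = F(0) removes the limit; biharmonicity at 0 instead excludes a logarithmic part in
  the mean of the Laplacian, so M vanishes there. Modes enter the energy through Bessel's inequality
  and the error through Parseval's identity.\<close>

lemma integral_deriv_real:
  fixes f f' :: "real \<Rightarrow> real"
  assumes "a \<le> b" "\<And>x. x \<in> {a..b} \<Longrightarrow> (f has_real_derivative f' x) (at x within {a..b})"
  shows "integral {a..b} f' = f b - f a"
  by (rule integral_unique, rule fundamental_theorem_of_calculus)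
     (use assms in \<open>auto simp: has_real_derivative_iff_has_vector_derivative\<close>)

lemma Cauchy_Schwarz_integral:
  fixes f g :: "real \<Rightarrow> real"
  assumes f: "continuous_on {a..b} f" and g: "continuous_on {a..b} g"
  shows "(integral {a..b} (\<lambda>x. f x * g x))\<^sup>2 \<le>
    integral {a..b} (\<lambda>x. (f x)\<^sup>2) * integral {a..b} (\<lambda>x. (g x)\<^sup>2)"
proof -
  define A where "A = integral {a..b} (\<lambda>x. (f x)\<^sup>2)"
  define B where "B = integral {a..b} (\<lambda>x. f x * g x)"
  define C where "C = integral {a..b} (\<lambda>x. (g x)\<^sup>2)"
  have iA: "(\<lambda>x. (f x)\<^sup>2) integrable_on {a..b}" and iB: "(\<lambda>x. f x * g x) integrable_on {a..b}"
    and iC: "(\<lambda>x. (g x)\<^sup>2) integrable_on {a..b}"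
    by (intro integrable_continuous_real continuous_intros f g)+
  have A0: "A \<ge> 0" "C \<ge> 0" unfolding A_def C_def by (intro integral_nonneg iA iC; simp)+
  have q: "A * s\<^sup>2 - 2 * B * s * t + C * t\<^sup>2 \<ge> 0" for s t
  proof -
    have "integral {a..b} (\<lambda>x. (s * f x - t * g x)\<^sup>2)
        = integral {a..b} (\<lambda>x. s\<^sup>2 * (f x)\<^sup>2 - (2 * s * t) * (f x * g x) + t\<^sup>2 * (g x)\<^sup>2)"
      by (rule arg_cong[where f="integral _"]) (auto simp: power2_eq_square algebra_simps)
    also have "\<dots> = s\<^sup>2 * A - (2 * s * t) * B + t\<^sup>2 * C"
      unfolding A_def B_def C_def
      by (subst integral_add integral_diff integral_mult_right;
          (intro integrable_add integrable_diff integrable_on_mult_right iA iB iC)?)+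
         simp
    finally have "s\<^sup>2 * A - (2 * s * t) * B + t\<^sup>2 * C = integral {a..b} (\<lambda>x. (s * f x - t * g x)\<^sup>2)" by simp
    also have "\<dots> \<ge> 0"
      by (intro integral_nonneg integrable_continuous_real continuous_intros f g) auto
    finally show ?thesis by (simp add: algebra_simps)
  qed
  have "B\<^sup>2 \<le> A * C"
  proof (cases "C = 0")
    case True
    have "B = 0"
    proof (rule ccontr)
      assume "B \<noteq> 0"
      \<comment> \<open>For C = 0 and s = 1 the form is affine in t, and this t gives it the value
        -1.\<close>
      with q[of 1 "(A + 1) / (2 * B)"] True show False by simp
    qed
    with True show ?thesis by simp
  next
    case False
    with A0 have "C > 0" by simp
    \<comment> \<open>The minimum over t at fixed s is at t = B s / C; with s = C the form becomes C
      (A C - B^2).\<close>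
    have "C * (A * C - B\<^sup>2) \<ge> 0" using q[of C B] by (simp add: power2_eq_square algebra_simps)
    with \<open>C > 0\<close> show ?thesis by (simp add: zero_le_mult_iff)
  qed
  then show ?thesis unfolding A_def B_def C_def .
qed

text \<open>Cauchy-Schwarz for the factors sqrt x * f and 1 / sqrt x. The integral of 1/x is the
  source of every logarithm in the growth estimates below.\<close>

lemma integral_squared_le_weighted:
  fixes f :: "real \<Rightarrow> real"
  assumes "0 < a" "a \<le> b" and f: "continuous_on {a..b} f"
  shows "(integral {a..b} f)\<^sup>2 \<le> integral {a..b} (\<lambda>x. x * (f x)\<^sup>2) * ln (b / a)"
proof -
  have c: "continuous_on {a..b} (\<lambda>x. sqrt x * f x)" "continuous_on {a..b} (\<lambda>x. 1 / sqrt x)"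
    using assms by (auto intro!: continuous_intros)
  have "integral {a..b} f = integral {a..b} (\<lambda>x. (sqrt x * f x) * (1 / sqrt x))"
    using assms by (intro integral_cong) auto
  moreover have "integral {a..b} (\<lambda>x. (sqrt x * f x)\<^sup>2) = integral {a..b} (\<lambda>x. x * (f x)\<^sup>2)"
    using assms by (intro integral_cong) (auto simp: power_mult_distrib)
  moreover have "integral {a..b} (\<lambda>x. (1 / sqrt x)\<^sup>2) = integral {a..b} (\<lambda>x. 1 / x)"
    using assms by (intro integral_cong) (auto simp: power_divide)
  moreover have "integral {a..b} (\<lambda>x. 1 / x) = ln (b / a)"
    using assms by (subst integral_deriv_real[where f=ln])
      (auto simp: ln_div intro!: derivative_eq_intros)
  ultimately show ?thesis using Cauchy_Schwarz_integral[OF c] by simp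
qed

lemma integral_squared_le:
  fixes f :: "real \<Rightarrow> real"
  assumes "a \<le> b" and f: "continuous_on {a..b} f"
  shows "(integral {a..b} f)\<^sup>2 \<le> (b - a) * integral {a..b} (\<lambda>x. (f x)\<^sup>2)"
  using Cauchy_Schwarz_integral[OF f, of "\<lambda>_. 1"] assms by (simp add: mult.commute)

lemma integral_mono_interval:
  fixes f :: "real \<Rightarrow> real"
  assumes "a \<le> c" "d \<le> b" "continuous_on {a..b} f" "\<And>x. x \<in> {a..b} \<Longrightarrow> 0 \<le> f x"
  shows "integral {c..d} f \<le> integral {a..b} f"
proof (rule integral_subset_le)
  show "{c..d} \<subseteq> {a..b}" using assms by auto
  then show "f integrable_on {c..d}" "f integrable_on {a..b}"
    using assms continuous_on_subset integrable_continuous_real by blast+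
qed (use assms in auto)

section \<open>Poincare inequalities between zeros\<close>

context
  fixes x y :: real and u u1 :: "real \<Rightarrow> real"
  assumes xy: "x < y"
    and du: "\<And>t. t \<in> {x..y} \<Longrightarrow> (u has_real_derivative u1 t) (at t within {x..y})"
    and c1: "continuous_on {x..y} u1"
begin

lemma poincare_one_zero:
  assumes z: "z \<in> {x..y}" "u z = 0"
  shows "integral {x..y} (\<lambda>t. (u t)\<^sup>2) \<le> (y - x)\<^sup>2 * integral {x..y} (\<lambda>t. (u1 t)\<^sup>2)"
proof -
  define I where "I = integral {x..y} (\<lambda>t. (u1 t)\<^sup>2)"
  have cu: "continuous_on {x..y} u"
    using du by (meson continuous_on_eq_continuous_within DERIV_continuous)
  have I0: "integral {c..d} (\<lambda>t. (u1 t)\<^sup>2) \<le> I" if "x \<le> c" "d \<le> y" for c d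
    unfolding I_def using that by (intro integral_mono_interval continuous_intros c1) auto
  have nn: "integral {c..d} (\<lambda>t. (u1 t)\<^sup>2) \<ge> 0" if "x \<le> c" "d \<le> y" for c d
    using that by (intro integral_nonneg integrable_continuous_real continuous_intros
      continuous_on_subset[OF c1]) auto
  have ineq: "(u d - u c)\<^sup>2 \<le> (y - x) * I" if cd: "x \<le> c" "c \<le> d" "d \<le> y" for c d
  proof -
    have "integral {c..d} u1 = u d - u c"
      using cd by (intro integral_deriv_real DERIV_subset[OF du]) auto
    then have "(u d - u c)\<^sup>2 \<le> (d - c) * integral {c..d} (\<lambda>t. (u1 t)\<^sup>2)"
      using integral_squared_le[of c d u1] cd continuous_on_subset[OF c1] by simp
    also have "\<dots> \<le> (y - x) * I"
      using cd I0[of c d] nn[of c d] by (intro mult_mono) auto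
    finally show ?thesis .
  qed
  have "(u t)\<^sup>2 \<le> (y - x) * I" if t: "t \<in> {x..y}" for t
    using ineq[of t z] ineq[of z t] t z by (cases "t \<le> z") auto
  then have "integral {x..y} (\<lambda>t. (u t)\<^sup>2) \<le> integral {x..y} (\<lambda>t. (y - x) * I)"
    by (intro integral_le integrable_continuous_real continuous_intros cu) auto
  also have "\<dots> = (y - x)\<^sup>2 * I" using xy by (simp add: power2_eq_square)
  finally show ?thesis unfolding I_def .
qed

text \<open>Reaching t from either endpoint bounds |u t| by the integral of |u'| over that side.
  Adding the two bounds gives 2|u t| \<le> J, and squaring yields the factor 4 that ends up as the
  1/2 in the case m = 0.\<close>

lemma poincare_two_zeros:
  assumes z: "u x = 0" "u y = 0"
  shows "4 * integral {x..y} (\<lambda>t. (u t)\<^sup>2) \<le> (y - x)\<^sup>2 * integral {x..y} (\<lambda>t. (u1 t)\<^sup>2)"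
proof -
  have cu: "continuous_on {x..y} u"
    using du by (meson continuous_on_eq_continuous_within DERIV_continuous)
  define J where "J = integral {x..y} (\<lambda>t. \<bar>u1 t\<bar>)"
  have ca: "continuous_on {x..y} (\<lambda>t. \<bar>u1 t\<bar>)" by (intro continuous_intros c1)
  have ineq: "\<bar>u d - u c\<bar> \<le> integral {c..d} (\<lambda>t. \<bar>u1 t\<bar>)" if cd: "x \<le> c" "c \<le> d" "d \<le> y" for c d
  proof -
    have "integral {c..d} u1 = u d - u c"
      using cd by (intro integral_deriv_real DERIV_subset[OF du]) auto
    then show ?thesis
      using continuous_on_imp_absolutely_integrable_on[OF continuous_on_subset[OF c1], of c d] cd by simp
  qed
  have "4 * (u t)\<^sup>2 \<le> J\<^sup>2" if t: "t \<in> {x..y}" for t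
  proof -
    have "2 * \<bar>u t\<bar> \<le> integral {x..t} (\<lambda>t. \<bar>u1 t\<bar>) + integral {t..y} (\<lambda>t. \<bar>u1 t\<bar>)"
      using ineq[of x t] ineq[of t y] t z by simp
    also have "\<dots> = J" unfolding J_def
      using t ca by (intro Henstock_Kurzweil_Integration.integral_combine integrable_continuous_real) auto
    finally have "(2 * \<bar>u t\<bar>)\<^sup>2 \<le> J\<^sup>2" by (intro power_mono) auto
    then show ?thesis by (simp add: power_mult_distrib)
  qed
  then have "integral {x..y} (\<lambda>t. 4 * (u t)\<^sup>2) \<le> integral {x..y} (\<lambda>t. J\<^sup>2)"
    by (intro integral_le integrable_continuous_real continuous_intros cu) auto
  also have "\<dots> = (y - x) * J\<^sup>2" using xy by simp
  also have "\<dots> \<le> (y - x) * ((y - x) * integral {x..y} (\<lambda>t. (u1 t)\<^sup>2))"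
    using integral_squared_le[OF _ ca] xy unfolding J_def by (intro mult_left_mono) auto
  finally show ?thesis by (simp add: power2_eq_square)
qed

end

text \<open>Induction over the gaps. In each gap u' is treated with one zero and u with two, and
  composing both estimates gives the power h^4. Gap lengths are replaced by h so that the integrals
  over the gaps can be summed.\<close>

lemma poincare_chain:
  fixes u u1 u2 :: "real \<Rightarrow> real" and r :: "nat \<Rightarrow> real"
  assumes r: "\<And>j. j \<in> {1..<n} \<Longrightarrow> r j < r (Suc j) \<and> r (Suc j) - r j \<le> h"
    and n: "1 \<le> n"
    and du: "\<And>t. t \<in> {r 1..r n} \<Longrightarrow> (u has_real_derivative u1 t) (at t)"
    and du1: "\<And>t. t \<in> {r 1..r n} \<Longrightarrow> (u1 has_real_derivative u2 t) (at t)"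
    and c2: "continuous_on {r 1..r n} u2"
    and z: "\<And>j. j \<in> {1..n} \<Longrightarrow> u (r j) = 0"
  shows "integral {r 1..r n} (\<lambda>t. (u1 t)\<^sup>2) \<le> h\<^sup>2 * integral {r 1..r n} (\<lambda>t. (u2 t)\<^sup>2) \<and>
     4 * integral {r 1..r n} (\<lambda>t. (u t)\<^sup>2) \<le> h ^ 4 * integral {r 1..r n} (\<lambda>t. (u2 t)\<^sup>2)"
  using n r du du1 c2 z
proof (induction n rule: dec_induct)
  case base
  then show ?case by simp
next
  case (step n)
  have incr: "r 1 \<le> r k" if "1 \<le> k" "k \<le> Suc n" for k
    using that
  proof (induction k rule: dec_induct)
    case (step j)
    then show ?case using \<open>\<And>j. j \<in> {1..<Suc n} \<Longrightarrow> _\<close>[of j] by force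
  qed simp
  define x y where "x = r n" and "y = r (Suc n)"
  have xy: "x < y" "y - x \<le> h" "r 1 \<le> x" unfolding x_def y_def using step incr[of n] by auto
  have sub: "{x..y} \<subseteq> {r 1..r (Suc n)}" "{r 1..x} \<subseteq> {r 1..r (Suc n)}" using xy by (auto simp: y_def)
  have zxy: "u x = 0" "u y = 0" using step by (auto simp: x_def y_def)
  have d: "(u has_real_derivative u1 t) (at t within A)" "(u1 has_real_derivative u2 t) (at t within A)"
    if "t \<in> {r 1..r (Suc n)}" for t A
    using step.prems(2,3) that by (auto intro: has_field_derivative_at_within)
  have c: "continuous_on {r 1..r (Suc n)} u" "continuous_on {r 1..r (Suc n)} u1"
    using d[of _ "{r 1..r (Suc n)}"] by (meson continuous_on_eq_continuous_within DERIV_continuous)+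
  note c' = c step.prems(4)
  have IH: "integral {r 1..x} (\<lambda>t. (u1 t)\<^sup>2) \<le> h\<^sup>2 * integral {r 1..x} (\<lambda>t. (u2 t)\<^sup>2) \<and>
     4 * integral {r 1..x} (\<lambda>t. (u t)\<^sup>2) \<le> h ^ 4 * integral {r 1..x} (\<lambda>t. (u2 t)\<^sup>2)"
    unfolding x_def
    by (rule step.IH) (use sub step.prems in \<open>auto simp: x_def intro: continuous_on_subset\<close>)
  \<comment> \<open>Rolle: u vanishes at both ends of the gap, so u' vanishes somewhere
    inside.\<close>
  obtain w0 where "x < w0" "w0 < y" "u y - u x = (y - x) * u1 w0"
    using MVT2[OF xy(1), of u u1] step.prems(2) sub by (auto simp: subset_iff)
  then obtain w where w: "w \<in> {x..y}" "u1 w = 0"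
    using zxy xy that[of w0] by simp
  have hp: "(y - x)\<^sup>2 \<le> h\<^sup>2" using xy by (intro power_mono) auto
  have nn: "integral {x..y} (\<lambda>t. (u2 t)\<^sup>2) \<ge> 0"
    by (intro integral_nonneg integrable_continuous_real continuous_intros continuous_on_subset[OF c'(3)] sub) auto
  have P1: "integral {x..y} (\<lambda>t. (u1 t)\<^sup>2) \<le> h\<^sup>2 * integral {x..y} (\<lambda>t. (u2 t)\<^sup>2)"
  proof -
    have "integral {x..y} (\<lambda>t. (u1 t)\<^sup>2) \<le> (y - x)\<^sup>2 * integral {x..y} (\<lambda>t. (u2 t)\<^sup>2)"
      by (rule poincare_one_zero[where z=w]) (use d sub c' xy w in \<open>auto intro: continuous_on_subset\<close>)
    also have "\<dots> \<le> h\<^sup>2 * integral {x..y} (\<lambda>t. (u2 t)\<^sup>2)" by (rule mult_right_mono[OF hp nn])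
    finally show ?thesis .
  qed
  have P0: "4 * integral {x..y} (\<lambda>t. (u t)\<^sup>2) \<le> h ^ 4 * integral {x..y} (\<lambda>t. (u2 t)\<^sup>2)"
  proof -
    have nn1: "integral {x..y} (\<lambda>t. (u1 t)\<^sup>2) \<ge> 0"
      by (intro integral_nonneg integrable_continuous_real continuous_intros continuous_on_subset[OF c'(2)] sub) auto
    have "4 * integral {x..y} (\<lambda>t. (u t)\<^sup>2) \<le> (y - x)\<^sup>2 * integral {x..y} (\<lambda>t. (u1 t)\<^sup>2)"
      by (rule poincare_two_zeros) (use d sub c' xy zxy in \<open>auto intro: continuous_on_subset\<close>)
    also have "\<dots> \<le> h\<^sup>2 * (h\<^sup>2 * integral {x..y} (\<lambda>t. (u2 t)\<^sup>2))"
      by (intro mult_mono hp P1 nn1) auto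
    finally show ?thesis by (simp add: power2_eq_square power4_eq_xxxx mult.assoc)
  qed
  have split: "integral {r 1..r (Suc n)} (\<lambda>t. (f t)\<^sup>2) = integral {r 1..x} (\<lambda>t. (f t)\<^sup>2) + integral {x..y} (\<lambda>t. (f t)\<^sup>2)"
    if "continuous_on {r 1..r (Suc n)} f" for f :: "real \<Rightarrow> real"
  proof -
    have "(\<lambda>t. (f t)\<^sup>2) integrable_on {r 1..r (Suc n)}"
      using that by (intro integrable_continuous_real continuous_intros)
    then show ?thesis
      using Henstock_Kurzweil_Integration.integral_combine[of "r 1" x "r (Suc n)" "\<lambda>t. (f t)\<^sup>2"] xy
      unfolding y_def by simp
  qed
  show ?case using IH P1 P0 by (simp add: split c' distrib_left del: One_nat_def)
qed

section \<open>The Hartley orthonormal basis\<close>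

text \<open>A real orthonormal basis with $e_k' = k\,e_{-k}$, so that differentiation needs no case
  distinction between sines and cosines.\<close>

definition hartley :: "int \<Rightarrow> real \<Rightarrow> real" where
  "hartley k \<theta> = (cos (of_int k * \<theta>) + sin (of_int k * \<theta>)) / sqrt (2 * pi)"

lemma continuous_on_hartley [continuous_intros]:
  fixes f :: "'a::t2_space \<Rightarrow> real"
  shows "continuous_on A f \<Longrightarrow> continuous_on A (\<lambda>x. hartley k (f x))"
  unfolding hartley_def by (intro continuous_intros) auto

lemma has_real_derivative_hartley:
  "(hartley k has_real_derivative of_int k * hartley (- k) \<theta>) (at \<theta> within A)"
  unfolding hartley_def
  by (auto intro!: derivative_eq_intros simp: field_simps)

lemma sin_of_int_pi [simp]: "sin (of_int k * pi) = 0"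
  using sin_zero_iff_int2 by blast

lemma hartley_periodic: "hartley k (- pi) = hartley k pi"
  by (simp add: hartley_def)

lemma hartley_product:
  "hartley k \<theta> * hartley l \<theta> =
    (cos (of_int (k - l) * \<theta>) + sin (of_int (k + l) * \<theta>)) / (2 * pi)"
  unfolding hartley_def
  by (simp add: field_simps cos_diff sin_add)

lemma integral_cos_int: "integral {-pi..pi} (\<lambda>\<theta>. cos (of_int k * \<theta>)) = (if k = 0 then 2 * pi else 0)"
proof (cases "k = 0")
  case False
  have "integral {-pi..pi} (\<lambda>\<theta>. cos (of_int k * \<theta>)) =
      sin (of_int k * pi) / of_int k - sin (of_int k * (- pi)) / of_int k"
    using False by (intro integral_deriv_real) (auto intro!: derivative_eq_intros)
  with False show ?thesis by simp
qed simp

lemma integral_sin_int: "integral {-pi..pi} (\<lambda>\<theta>. sin (of_int k * \<theta>)) = 0"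
proof (cases "k = 0")
  case False
  have "integral {-pi..pi} (\<lambda>\<theta>. sin (of_int k * \<theta>)) =
      - cos (of_int k * pi) / of_int k - - cos (of_int k * (- pi)) / of_int k"
    using False by (intro integral_deriv_real) (auto intro!: derivative_eq_intros)
  with False show ?thesis by simp
qed simp

lemma hartley_orthonormal:
  "integral {-pi..pi} (\<lambda>\<theta>. hartley k \<theta> * hartley l \<theta>) = (if k = l then 1 else 0)"
proof -
  have "integral {-pi..pi} (\<lambda>\<theta>. hartley k \<theta> * hartley l \<theta>) =
     integral {-pi..pi} (\<lambda>\<theta>. (1 / (2 * pi)) * (cos (of_int (k - l) * \<theta>) + sin (of_int (k + l) * \<theta>)))"
    by (simp only: hartley_product) simp
  also have "\<dots> = (1 / (2 * pi)) * (integral {-pi..pi} (\<lambda>\<theta>. cos (of_int (k - l) * \<theta>)) +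
      integral {-pi..pi} (\<lambda>\<theta>. sin (of_int (k + l) * \<theta>)))"
    by (subst integral_mult_right, subst integral_add)
       (auto intro!: integrable_continuous_real continuous_intros)
  also have "\<dots> = (if k = l then 1 else 0)"
    unfolding integral_cos_int integral_sin_int by simp
  finally show ?thesis .
qed

definition hcoeff :: "int \<Rightarrow> (real \<Rightarrow> real) \<Rightarrow> real" where
  "hcoeff k \<phi> = integral {-pi..pi} (\<lambda>\<theta>. \<phi> \<theta> * hartley k \<theta>)"

lemma hcoeff_add:
  assumes "continuous_on {-pi..pi} f" "continuous_on {-pi..pi} g"
  shows "hcoeff k (\<lambda>\<theta>. f \<theta> + g \<theta>) = hcoeff k f + hcoeff k g"
  unfolding hcoeff_def distrib_right
  by (intro integral_add integrable_continuous_real continuous_intros assms)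

lemma hcoeff_diff:
  assumes "continuous_on {-pi..pi} f" "continuous_on {-pi..pi} g"
  shows "hcoeff k (\<lambda>\<theta>. f \<theta> - g \<theta>) = hcoeff k f - hcoeff k g"
  unfolding hcoeff_def left_diff_distrib
  by (intro integral_diff integrable_continuous_real continuous_intros assms)

lemma hcoeff_cmult: "hcoeff k (\<lambda>\<theta>. c * f \<theta>) = c * hcoeff k f"
  unfolding hcoeff_def by (simp add: mult.assoc)

lemma hcoeff_hartley: "hcoeff k (hartley l) = (if k = l then 1 else 0)"
  unfolding hcoeff_def hartley_orthonormal by auto

lemma hcoeff_sum:
  assumes "finite J" "\<And>l. l \<in> J \<Longrightarrow> continuous_on {-pi..pi} (f l)"
  shows "hcoeff k (\<lambda>\<theta>. \<Sum>l\<in>J. f l \<theta>) = (\<Sum>l\<in>J. hcoeff k (f l))"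
  using assms
proof (induction J rule: finite_induct)
  case empty then show ?case by (simp add: hcoeff_def)
next
  case (insert x J)
  then show ?case by (simp add: hcoeff_add continuous_on_sum)
qed

lemma hcoeff_trig:
  assumes "finite J"
  shows "hcoeff k (\<lambda>\<theta>. \<Sum>l\<in>J. c l * hartley l \<theta>) = (if k \<in> J then c k else 0)"
proof -
  have "hcoeff k (\<lambda>\<theta>. \<Sum>l\<in>J. c l * hartley l \<theta>) = (\<Sum>l\<in>J. c l * (if k = l then 1 else 0))"
    using assms by (subst hcoeff_sum) (auto intro!: continuous_intros simp: hcoeff_cmult hcoeff_hartley)
  also have "\<dots> = (\<Sum>l\<in>J. if k = l then c l else 0)" by (rule sum.cong) auto
  also have "\<dots> = (if k \<in> J then c k else 0)" using assms by (simp add: sum.delta)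
  finally show ?thesis .
qed

lemma hcoeff_const: "hcoeff k (\<lambda>_. c) = (if k = 0 then c * sqrt (2 * pi) else 0)"
proof -
  have "(\<lambda>_. c) = (\<lambda>\<theta>. (c * sqrt (2 * pi)) * hartley 0 \<theta>)" by (auto simp: hartley_def)
  then show ?thesis by (simp add: hcoeff_cmult hcoeff_hartley)
qed

text \<open>Completing the square in each coefficient. Taking \<open>c k = hcoeff k f\<close> gives
  Bessel's inequality; taking the coefficients of an approximating polynomial bounds the Parseval
  defect by its squared L2 error.\<close>

lemma trig_approx_identity:
  assumes f: "continuous_on {-pi..pi} f" and J: "finite J"
  shows "integral {-pi..pi} (\<lambda>\<theta>. (f \<theta> - (\<Sum>k\<in>J. c k * hartley k \<theta>))\<^sup>2) =
    integral {-pi..pi} (\<lambda>\<theta>. (f \<theta>)\<^sup>2) - (\<Sum>k\<in>J. (hcoeff k f)\<^sup>2) + (\<Sum>k\<in>J. (hcoeff k f - c k)\<^sup>2)"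
proof -
  define p where "p = (\<lambda>\<theta>. \<Sum>k\<in>J. c k * hartley k \<theta>)"
  have p: "continuous_on {-pi..pi} p" unfolding p_def by (intro continuous_intros)
  have ip: "integral {-pi..pi} (\<lambda>\<theta>. g \<theta> * p \<theta>) = (\<Sum>k\<in>J. c k * hcoeff k g)"
    if g: "continuous_on {-pi..pi} g" for g
  proof -
    have "integral {-pi..pi} (\<lambda>\<theta>. g \<theta> * p \<theta>) =
        integral {-pi..pi} (\<lambda>\<theta>. \<Sum>k\<in>J. c k * (g \<theta> * hartley k \<theta>))"
      unfolding p_def sum_distrib_left by (simp add: mult_ac)
    also have "\<dots> = (\<Sum>k\<in>J. c k * hcoeff k g)"
      unfolding hcoeff_def
      by (subst integral_sum) (use J g in \<open>auto intro!: integrable_continuous_real continuous_intros\<close>)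
    finally show ?thesis .
  qed
  have pp: "integral {-pi..pi} (\<lambda>\<theta>. (p \<theta>)\<^sup>2) = (\<Sum>k\<in>J. (c k)\<^sup>2)"
    unfolding power2_eq_square ip[OF p] unfolding p_def hcoeff_trig[OF J] by simp
  have "integral {-pi..pi} (\<lambda>\<theta>. (f \<theta> - p \<theta>)\<^sup>2) =
     integral {-pi..pi} (\<lambda>\<theta>. (f \<theta>)\<^sup>2 - 2 * (f \<theta> * p \<theta>) + (p \<theta>)\<^sup>2)"
    by (simp add: power2_eq_square algebra_simps)
  also have "\<dots> = integral {-pi..pi} (\<lambda>\<theta>. (f \<theta>)\<^sup>2) - 2 * (\<Sum>k\<in>J. c k * hcoeff k f) + (\<Sum>k\<in>J. (c k)\<^sup>2)"
    by (subst integral_add integral_diff integral_mult_right;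
        (intro integrable_continuous_real continuous_intros f p)?)+
       (simp add: ip[OF f] pp)
  also have "\<dots> = integral {-pi..pi} (\<lambda>\<theta>. (f \<theta>)\<^sup>2) - (\<Sum>k\<in>J. (hcoeff k f)\<^sup>2) + (\<Sum>k\<in>J. (hcoeff k f - c k)\<^sup>2)"
    by (simp add: power2_diff sum.distrib sum_subtractf sum_distrib_left mult_ac)
  finally show ?thesis unfolding p_def .
qed

lemma bessel_hartley:
  assumes f: "continuous_on {-pi..pi} f" and J: "finite J"
  shows "(\<Sum>k\<in>J. (hcoeff k f)\<^sup>2) \<le> integral {-pi..pi} (\<lambda>\<theta>. (f \<theta>)\<^sup>2)"
proof -
  have "0 \<le> integral {-pi..pi} (\<lambda>\<theta>. (f \<theta> - (\<Sum>k\<in>J. hcoeff k f * hartley k \<theta>))\<^sup>2)"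
    by (intro integral_nonneg integrable_continuous_real continuous_intros f) auto
  then show ?thesis using trig_approx_identity[OF f J, of "\<lambda>k. hcoeff k f"] by simp
qed

section \<open>Trigonometric polynomials and completeness of the basis\<close>

text \<open>Described by generators, so that closure under products reduces by two inductions to the
  product formula for basis functions.\<close>

inductive trig_poly :: "(real \<Rightarrow> real) \<Rightarrow> bool" where
  base: "trig_poly (hartley k)"
| add: "trig_poly p \<Longrightarrow> trig_poly q \<Longrightarrow> trig_poly (\<lambda>\<theta>. p \<theta> + q \<theta>)"
| scale: "trig_poly p \<Longrightarrow> trig_poly (\<lambda>\<theta>. c * p \<theta>)"

lemma trig_poly_const: "trig_poly (\<lambda>_. c)"
  using trig_poly.scale[OF trig_poly.base[of 0], of "c * sqrt (2 * pi)"] by (simp add: hartley_def)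

lemma trig_poly_cos: "trig_poly (\<lambda>\<theta>. cos (of_int k * \<theta>))"
proof -
  have "(\<lambda>\<theta>. cos (of_int k * \<theta>)) = (\<lambda>\<theta>. (sqrt (2 * pi) / 2) * (hartley k \<theta> + hartley (- k) \<theta>))"
    by (auto simp: hartley_def field_simps)
  then show ?thesis by (simp only: trig_poly.intros)
qed

lemma trig_poly_sin: "trig_poly (\<lambda>\<theta>. sin (of_int k * \<theta>))"
proof -
  have "(\<lambda>\<theta>. sin (of_int k * \<theta>)) =
      (\<lambda>\<theta>. (sqrt (2 * pi) / 2) * (hartley k \<theta> + (- 1) * hartley (- k) \<theta>))"
    by (auto simp: hartley_def field_simps)
  then show ?thesis by (simp only: trig_poly.intros)
qed

lemma trig_poly_mult:
  assumes "trig_poly p" "trig_poly q"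
  shows "trig_poly (\<lambda>\<theta>. p \<theta> * q \<theta>)"
  using assms(1)
proof induction
  case (base k)
  show ?case using assms(2)
  proof induction
    case (base l)
    have "(\<lambda>\<theta>. hartley k \<theta> * hartley l \<theta>) =
      (\<lambda>\<theta>. (1 / (2 * pi)) * (cos (of_int (k - l) * \<theta>) + sin (of_int (k + l) * \<theta>)))"
      by (simp only: hartley_product) simp
    then show ?case
      using trig_poly.scale[OF trig_poly.add[OF trig_poly_cos[of "k - l"] trig_poly_sin[of "k + l"]], of "1 / (2 * pi)"]
      by simp
  next
    case (add p q) then show ?case by (simp add: distrib_left trig_poly.add)
  next
    case (scale p c) then show ?case using trig_poly.scale[of _ c] by (simp add: mult.left_commute)
  qed
next
  case (add p q) then show ?case by (simp add: distrib_right trig_poly.add)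
next
  case (scale p c) then show ?case using trig_poly.scale[of _ c] by (simp add: mult.assoc)
qed

text \<open>A real linear functional of \<open>cis \<theta>\<close> is a combination of cosine and
  sine, and polynomials arise from such functionals by sums and products. This turns a
  Stone-Weierstrass approximant on the circle into a trigonometric polynomial.\<close>

lemma trig_poly_polynomial:
  assumes "real_polynomial_function (p :: complex \<Rightarrow> real)"
  shows "trig_poly (\<lambda>\<theta>. p (cis \<theta>))"
  using assms
proof induction
  case (linear f)
  then interpret bounded_linear f .
  have "f (cis \<theta>) = cos \<theta> * f 1 + sin \<theta> * f \<i>" for \<theta>
  proof -
    have "cis \<theta> = cos \<theta> *\<^sub>R 1 + sin \<theta> *\<^sub>R \<i>" by (simp add: complex_eq_iff)
    then show ?thesis by (simp add: add scaleR)
  qed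
  then show ?case
    using trig_poly.add[OF trig_poly.scale[OF trig_poly_cos[of 1], of "f 1"] trig_poly.scale[OF trig_poly_sin[of 1], of "f \<i>"]]
    by (simp add: mult.commute)
qed (auto intro: trig_poly_const trig_poly.add trig_poly_mult)

text \<open>One coefficient family serves all large n, so that two expansions can be added at a
  common n and the approximant stays fixed while n grows in Parseval's identity.\<close>

lemma trig_poly_expand:
  assumes "trig_poly p"
  shows "\<exists>(N::nat) c. \<forall>n\<ge>N. p = (\<lambda>\<theta>. \<Sum>k\<in>{- int n..int n}. c k * hartley k \<theta>)"
  using assms
proof induction
  case (base k)
  have "hartley k = (\<lambda>\<theta>. \<Sum>l\<in>{- int n..int n}. (if l = k then 1 else 0) * hartley l \<theta>)" if "n \<ge> nat \<bar>k\<bar>" for n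
  proof
    fix \<theta>
    have "(\<Sum>l\<in>{- int n..int n}. (if l = k then 1 else 0) * hartley l \<theta>) =
       (\<Sum>l\<in>{- int n..int n}. if l = k then hartley l \<theta> else 0)" by (rule sum.cong) auto
    also have "\<dots> = hartley k \<theta>" using that by (auto simp: sum.delta)
    finally show "hartley k \<theta> = (\<Sum>l\<in>{- int n..int n}. (if l = k then 1 else 0) * hartley l \<theta>)" by simp
  qed
  then show ?case by (intro exI allI impI)
next
  case (add p q)
  from add.IH obtain N c M d where
    *: "\<forall>n\<ge>N. p = (\<lambda>\<theta>. \<Sum>k\<in>{- int n..int n}. c k * hartley k \<theta>)"
       "\<forall>n\<ge>M. q = (\<lambda>\<theta>. \<Sum>k\<in>{- int n..int n}. d k * hartley k \<theta>)"
    by (elim exE)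
  show ?case
  proof (intro exI allI impI)
    fix n assume n: "n \<ge> max N M"
    show "(\<lambda>\<theta>. p \<theta> + q \<theta>) = (\<lambda>\<theta>. \<Sum>k\<in>{- int n..int n}. (c k + d k) * hartley k \<theta>)"
    proof -
      have "p = (\<lambda>\<theta>. \<Sum>k\<in>{- int n..int n}. c k * hartley k \<theta>)"
        "q = (\<lambda>\<theta>. \<Sum>k\<in>{- int n..int n}. d k * hartley k \<theta>)"
        using n *(1)[rule_format, of n] *(2)[rule_format, of n] by simp_all
      then show ?thesis by (simp only: distrib_right sum.distrib)
    qed
  qed
next
  case (scale p a)
  from scale.IH obtain N c where
    *: "\<forall>n\<ge>N. p = (\<lambda>\<theta>. \<Sum>k\<in>{- int n..int n}. c k * hartley k \<theta>)"
    by (elim exE)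
  show ?case
  proof (intro exI allI impI)
    fix n assume n: "n \<ge> N"
    show "(\<lambda>\<theta>. a * p \<theta>) = (\<lambda>\<theta>. \<Sum>k\<in>{- int n..int n}. (a * c k) * hartley k \<theta>)"
    proof -
      have "p = (\<lambda>\<theta>. \<Sum>k\<in>{- int n..int n}. c k * hartley k \<theta>)"
        using n *[rule_format, of n] by simp
      then show ?thesis by (simp only: sum_distrib_left mult.assoc)
    qed
  qed
qed

text \<open>\<open>Arg\<close> jumps on the negative real axis and \<open>Arg2pi\<close> on the
  positive one. By periodicity f takes the same value on both, so at each point of the circle the
  branch that is continuous there can be used.\<close>

lemma continuous_on_circle_lift:
  fixes f :: "real \<Rightarrow> real"
  assumes f: "continuous_on UNIV f" and per: "\<And>\<theta>. f (\<theta> + 2 * pi) = f \<theta>"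
  shows "continuous_on (sphere 0 1) (\<lambda>z. f (Arg z))"
proof -
  have eq: "f (Arg z) = f (Arg2pi z)" if "z \<noteq> 0" for z
  proof (cases "Arg2pi z \<le> pi")
    case True
    then have "Arg z = Arg2pi z" using that Arg2pi_lt_2pi[of z] Arg2pi_ge_0[of z]
      by (intro Arg_unique[of "cmod z"]) (use Arg2pi_eq[of z] in auto)
    then show ?thesis by simp
  next
    case False
    then have "Arg z = Arg2pi z - 2 * pi" using that Arg2pi_lt_2pi[of z] Arg2pi_ge_0[of z]
      by (intro Arg_unique[of "cmod z"]) (use Arg2pi_eq[of z] in \<open>auto simp: exp_diff right_diff_distrib mult_ac\<close>)
    then show ?thesis using per[of "Arg z"] by simp
  qed
  have "isCont (\<lambda>z. f (Arg z)) z" if "z \<noteq> 0" for z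
  proof (cases "z \<in> \<real>\<^sub>\<le>\<^sub>0")
    case False
    then show ?thesis
      using continuous_at_Arg[of z] f
      by (intro isCont_o2[where f=Arg and g=f]) (auto simp: continuous_on_eq_continuous_at)
  next
    case True
    then have "z \<notin> \<real>\<^sub>\<ge>\<^sub>0" using that by (auto simp: complex_nonneg_Reals_iff complex_nonpos_Reals_iff complex_eq_iff)
    then have "isCont (\<lambda>z. f (Arg2pi z)) z"
      using continuous_at_Arg2pi[of z] f
      by (intro isCont_o2[where f=Arg2pi and g=f]) (auto simp: continuous_on_eq_continuous_at)
    moreover have "\<forall>\<^sub>F w in nhds z. f (Arg w) = f (Arg2pi w)"
      using that t1_space_nhds[of z 0] eq by (auto elim!: eventually_mono)
    ultimately show ?thesis using isCont_cong[of "\<lambda>z. f (Arg z)" "\<lambda>z. f (Arg2pi z)" z] by simp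
  qed
  then show ?thesis
    by (intro continuous_at_imp_continuous_on ballI) (metis mem_sphere_0 norm_zero zero_neq_one)
qed

text \<open>A uniform approximation by a trigonometric polynomial is also an L2 approximation on the
  bounded interval, and the defect in Bessel's inequality is at most its squared L2 error.\<close>

lemma parseval_hartley:
  fixes f :: "real \<Rightarrow> real"
  assumes f: "continuous_on UNIV f" and per: "\<And>\<theta>. f (\<theta> + 2 * pi) = f \<theta>"
  shows "(\<lambda>n. \<Sum>k\<in>{- int n..int n}. (hcoeff k f)\<^sup>2) \<longlonglongrightarrow> integral {-pi..pi} (\<lambda>\<theta>. (f \<theta>)\<^sup>2)"
proof (rule LIMSEQ_I)
  have fc: "continuous_on {-pi..pi} f" using f continuous_on_subset by blast
  fix e :: real assume e: "e > 0"
  \<comment> \<open>A uniform error d costs 2 pi d^2 = e/2 in the squared L2 norm.\<close>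
  define d where "d = sqrt (e / (4 * pi))"
  have d: "d > 0" "2 * pi * d\<^sup>2 < e" using e by (auto simp: d_def)
  obtain g :: "complex \<Rightarrow> real" where g: "real_polynomial_function g"
    "\<And>z. z \<in> sphere 0 1 \<Longrightarrow> \<bar>f (Arg z) - g z\<bar> < d"
    using Stone_Weierstrass_real_polynomial_function[OF _ continuous_on_circle_lift[OF f per] d(1)] by auto
  define p where "p = (\<lambda>\<theta>. g (cis \<theta>))"
  have p: "\<bar>f \<theta> - p \<theta>\<bar> \<le> d" if "\<theta> \<in> {-pi..pi}" for \<theta>
  proof -
    have *: "\<bar>f \<theta> - p \<theta>\<bar> < d" if "- pi < \<theta>" "\<theta> \<le> pi" for \<theta>
      using g(2)[of "cis \<theta>"] that by (simp add: p_def Arg_cis)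
    show ?thesis
    \<comment> \<open>\<open>Arg\<close> takes values in (-pi, pi], so the left endpoint is compared
      through its partner pi.\<close>
    proof (cases "\<theta> = - pi")
      case True
      then have "f \<theta> = f pi" "p \<theta> = p pi" using per[of "-pi"] by (auto simp: p_def cis.ctr)
      then show ?thesis using *[of pi] by auto
    qed (use *[of \<theta>] that in auto)
  qed
  from trig_poly_expand[OF trig_poly_polynomial[OF g(1)]]
  obtain N c where N: "\<And>n. n \<ge> N \<Longrightarrow> p = (\<lambda>\<theta>. \<Sum>k\<in>{- int n..int n}. c k * hartley k \<theta>)"
    unfolding p_def by meson
  have pc: "continuous_on {-pi..pi} p" by (subst N[OF order_refl]) (intro continuous_intros)
  show "\<exists>N. \<forall>n\<ge>N. norm ((\<Sum>k\<in>{- int n..int n}. (hcoeff k f)\<^sup>2) - integral {-pi..pi} (\<lambda>\<theta>. (f \<theta>)\<^sup>2)) < e"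
  proof (intro exI allI impI)
    fix n assume n: "n \<ge> N"
    have "integral {-pi..pi} (\<lambda>\<theta>. (f \<theta>)\<^sup>2) - (\<Sum>k\<in>{- int n..int n}. (hcoeff k f)\<^sup>2)
        \<le> integral {-pi..pi} (\<lambda>\<theta>. (f \<theta> - p \<theta>)\<^sup>2)"
      by (subst N[OF n]) (simp add: trig_approx_identity[OF fc] sum_nonneg)
    also have "\<dots> \<le> integral {-pi..pi} (\<lambda>\<theta>. d\<^sup>2)"
    proof (intro integral_le integrable_continuous_real continuous_intros fc pc)
      fix \<theta> assume "\<theta> \<in> {-pi..pi}"
      from power_mono[OF p[OF this], of 2] show "(f \<theta> - p \<theta>)\<^sup>2 \<le> d\<^sup>2" by simp
    qed
    also have "\<dots> = 2 * pi * d\<^sup>2" by simp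
    also have "\<dots> < e" by (rule d)
    finally show "norm ((\<Sum>k\<in>{- int n..int n}. (hcoeff k f)\<^sup>2) - integral {-pi..pi} (\<lambda>\<theta>. (f \<theta>)\<^sup>2)) < e"
      using bessel_hartley[OF fc, of "{- int n..int n}"] by auto
  qed
qed

section \<open>Radial modes\<close>

text \<open>Share of the frequency k, with \<kappa> = k^2, in the angular integral of the Beppo Levi
  density. \<open>v1\<close> and \<open>v2\<close> stand for the first two derivatives of
  \<open>v\<close> and are separate arguments, so that algebra and continuity can be treated without
  mentioning differentiation.\<close>

definition mode_energy where
  "mode_energy \<kappa> v v1 v2 r =
     r * ((v2 r)\<^sup>2 + 2 * \<kappa> * (v r / r\<^sup>2 - v1 r / r)\<^sup>2 + (v1 r / r - \<kappa> * v r / r\<^sup>2)\<^sup>2)"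
  for \<kappa> r :: real and v v1 v2 :: "real \<Rightarrow> real"

text \<open>The symmetric bilinear form whose diagonal is \<open>mode_energy\<close>.\<close>

definition mode_form where
  "mode_form \<kappa> v v1 v2 u u1 u2 r =
     r * (v2 r * u2 r + 2 * \<kappa> * (v r / r\<^sup>2 - v1 r / r) * (u r / r\<^sup>2 - u1 r / r)
       + (v1 r / r - \<kappa> * v r / r\<^sup>2) * (u1 r / r - \<kappa> * u r / r\<^sup>2))"
  for \<kappa> r :: real and v v1 v2 u u1 u2 :: "real \<Rightarrow> real"

lemma mode_energy_nonneg: "0 \<le> r \<Longrightarrow> 0 \<le> \<kappa> \<Longrightarrow> 0 \<le> mode_energy \<kappa> v v1 v2 r"
  unfolding mode_energy_def by (intro mult_nonneg_nonneg add_nonneg_nonneg) auto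

lemma mode_energy_add:
  "mode_energy \<kappa> (\<lambda>r. u r + v r) (\<lambda>r. u1 r + v1 r) (\<lambda>r. u2 r + v2 r) r =
    mode_energy \<kappa> u u1 u2 r + mode_energy \<kappa> v v1 v2 r + 2 * mode_form \<kappa> v v1 v2 u u1 u2 r"
proof -
  have "(u r + v r) / r\<^sup>2 - (u1 r + v1 r) / r = (u r / r\<^sup>2 - u1 r / r) + (v r / r\<^sup>2 - v1 r / r)"
    and "(u1 r + v1 r) / r - \<kappa> * (u r + v r) / r\<^sup>2 =
      (u1 r / r - \<kappa> * u r / r\<^sup>2) + (v1 r / r - \<kappa> * v r / r\<^sup>2)"
    by (simp_all add: add_divide_distrib distrib_left)
  moreover have "r * ((x + x')\<^sup>2 + 2 * \<kappa> * (y + y')\<^sup>2 + (z + z')\<^sup>2) =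
      r * (x\<^sup>2 + 2 * \<kappa> * y\<^sup>2 + z\<^sup>2) + r * (x'\<^sup>2 + 2 * \<kappa> * y'\<^sup>2 + z'\<^sup>2) +
      2 * (r * (x' * x + 2 * \<kappa> * y' * y + z' * z))" for x x' y y' z z' :: real
    by (simp add: power2_eq_square algebra_simps)
  ultimately show ?thesis unfolding mode_energy_def mode_form_def by simp
qed

lemma continuous_on_mode_energy:
  assumes "continuous_on A v" "continuous_on A v1" "continuous_on A v2" "A \<subseteq> {0<..}"
  shows "continuous_on A (mode_energy \<kappa> v v1 v2)"
  unfolding mode_energy_def using assms(4) by (intro continuous_intros assms) auto

text \<open>Here $(r v'')'$ is the only occurrence of a third derivative. It is removed from the boundary term
  by averaging with the weight $\psi(r)/r$, $\psi(r) = \ln(r/a)\ln(b/r)$, which vanishes at both ends; the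
  assumed logarithmic growth of $u$ is exactly what this weight absorbs.\<close>

lemma tail_estimate:
  fixes v v1 v2 M u u1 :: "real \<Rightarrow> real"
  assumes ab: "0 < a" "a < b" and T: "T = ln (b / a)" "T \<ge> 1" and \<kappa>: "\<kappa> \<ge> 0" and C: "C \<ge> 0"
    and cv: "continuous_on {a..b} v" "continuous_on {a..b} v1" "continuous_on {a..b} v2"
    and dz: "\<And>r. r \<in> {a..b} \<Longrightarrow> ((\<lambda>r. r * v2 r) has_real_derivative
        v1 r / r - \<kappa> * v r / r\<^sup>2 - 2 * \<kappa> * (v r / r - v1 r) / r - M r) (at r within {a..b})"
    and du: "\<And>r. r \<in> {a..b} \<Longrightarrow> (u has_real_derivative u1 r) (at r within {a..b})"
    and cu: "continuous_on {a..b} u" "continuous_on {a..b} u1"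
    and bu: "\<And>r. r \<in> {a..b} \<Longrightarrow> \<bar>u r\<bar> \<le> C * r * sqrt T"
    and bu1: "\<And>r. r \<in> {a..b} \<Longrightarrow> \<bar>u1 r\<bar> \<le> C * sqrt T"
  shows "\<exists>r\<in>{a..b}. \<bar>r * v2 r * u1 r + M r * u r\<bar> \<le>
           6 * C * sqrt ((48 + 6 * \<kappa>) * integral {a..b} (mode_energy \<kappa> v v1 v2))"
proof -
  define E where "E = integral {a..b} (mode_energy \<kappa> v v1 v2)"
  define P where "P = (\<lambda>r. v1 r / r - \<kappa> * v r / r\<^sup>2)"
  define Q where "Q = (\<lambda>r. v r / r\<^sup>2 - v1 r / r)"
  define \<psi> where "\<psi> = (\<lambda>r. (ln r - ln a) * (ln b - ln r))"
  define \<psi>' where "\<psi>' = (\<lambda>r. (ln b + ln a - 2 * ln r) / r)"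
  \<comment> \<open>Differentiating \<open>X\<close> and adding \<open>\<psi> r / r\<close> times
    the boundary term cancels M and leaves \<open>R\<close>, which contains only quantities
    controlled by the energy and by the growth of u.\<close>
  define R where "R = (\<lambda>r. \<psi> r * u r / r * (P r - 2 * \<kappa> * Q r)
        + v2 r * (\<psi>' r * u r + 2 * \<psi> r * u1 r - \<psi> r * u r / r))"
  define X where "X = (\<lambda>r. r * v2 r * (\<psi> r * u r / r))"
  \<comment> \<open>With s = ln r - ln a, the weight integrates to T s^2/2 - s^3/3; over the whole
    interval this is T^3/6. Hence \<open>L\<close> is the weighted mean of the boundary
    term.\<close>
  define W where "W = (\<lambda>r. T * (ln r - ln a)\<^sup>2 / 2 - (ln r - ln a) ^ 3 / 3)"
  define L where "L = integral {a..b} R / (T ^ 3 / 6)"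
  have pos: "r > 0" if "r \<in> {a..b}" for r using that ab by auto
  have Tab: "T = ln b - ln a" using T ab by (simp add: ln_div)
  have cPQ: "continuous_on {a..b} P" "continuous_on {a..b} Q"
    unfolding P_def Q_def by (intro continuous_intros cv; use pos in force)+
  have c\<psi>: "continuous_on {a..b} \<psi>" "continuous_on {a..b} \<psi>'"
    unfolding \<psi>_def \<psi>'_def by (intro continuous_intros; use pos in force)+
  have cR: "continuous_on {a..b} R"
    unfolding R_def by (intro continuous_intros cPQ c\<psi> cu cv; use pos in force)
  have dX: "(X has_real_derivative R r - \<psi> r / r * (r * v2 r * u1 r + M r * u r)) (at r within {a..b})"
    if r: "r \<in> {a..b}" for r
  proof -
    have d\<psi>: "(\<psi> has_real_derivative \<psi>' r) (at r within {a..b})"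
      unfolding \<psi>_def \<psi>'_def using pos[OF r]
      by (auto intro!: derivative_eq_intros simp: field_simps)
    have d2: "((\<lambda>r. \<psi> r * u r / r) has_real_derivative
        (\<psi>' r * u r + \<psi> r * u1 r - \<psi> r * u r / r) / r) (at r within {a..b})"
      by (rule derivative_eq_intros d\<psi> du[OF r] refl)+
         (use pos[OF r] in \<open>auto simp: field_simps\<close>)
    have "v1 r / r - \<kappa> * v r / r\<^sup>2 - 2 * \<kappa> * (v r / r - v1 r) / r - M r = P r - 2 * \<kappa> * Q r - M r"
      by (simp add: P_def Q_def diff_divide_distrib power2_eq_square right_diff_distrib)
    with dz[OF r] have dz': "((\<lambda>r. r * v2 r) has_real_derivative P r - 2 * \<kappa> * Q r - M r) (at r within {a..b})"
      by simp
    show ?thesis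
      unfolding X_def
      by (rule DERIV_cong[OF DERIV_mult[OF dz' d2]])
         (use pos[OF r] in \<open>simp add: R_def field_simps\<close>)
  qed
  have dW: "(W has_real_derivative \<psi> r / r) (at r within {a..b})" if r: "r \<in> {a..b}" for r
    unfolding W_def \<psi>_def Tab using pos[OF r]
    by (auto intro!: derivative_eq_intros simp: field_simps power2_eq_square)
  have dI: "((\<lambda>r. integral {a..r} R) has_real_derivative R r) (at r within {a..b})" if "r \<in> {a..b}" for r
    by (rule integral_has_real_derivative[OF cR that])
  \<comment> \<open>The derivative of \<open>F\<close> is the weight times the boundary term minus
    its mean \<open>L\<close>, and \<open>F\<close> agrees at both ends. By Rolle the boundary term
    equals \<open>L\<close> at an interior radius, where the weight is positive.\<close>
  define F where "F = (\<lambda>r. integral {a..r} R - X r - L * W r)"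
  have dF: "(F has_real_derivative \<psi> r / r * (r * v2 r * u1 r + M r * u r - L)) (at r within {a..b})"
    if r: "r \<in> {a..b}" for r
    unfolding F_def
    by (rule derivative_eq_intros dI[OF r] dX[OF r] dW[OF r] refl)+ (simp add: algebra_simps)
  have "F b = F a"
  proof -
    have W: "W b = T ^ 3 / 6" "W a = 0" by (auto simp: W_def Tab[symmetric] power2_eq_square power3_eq_cube)
    have X: "X a = 0" "X b = 0" by (auto simp: X_def \<psi>_def)
    have "L * W b = integral {a..b} R" unfolding L_def W using T(2) by simp
    then show ?thesis by (simp add: F_def X W(2))
  qed
  moreover have "\<exists>x\<in>{a<..<b}. F b - F a = (\<psi> x / x * (x * v2 x * u1 x + M x * u x - L)) * (b - a)"
    using mvt_simple[OF ab(2), of F "\<lambda>x. (*) (\<psi> x / x * (x * v2 x * u1 x + M x * u x - L))"] dF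
    by (auto simp: has_field_derivative_def)
  ultimately obtain x where x: "x \<in> {a<..<b}" "\<psi> x / x * (x * v2 x * u1 x + M x * u x - L) = 0"
    using ab by auto
  have "\<psi> x > 0" unfolding \<psi>_def using x ab by auto
  with x ab have xL: "x * v2 x * u1 x + M x * u x = L" by auto
  define y where "y = (\<lambda>r. \<bar>P r\<bar> + 2 * \<kappa> * \<bar>Q r\<bar> + 4 * \<bar>v2 r\<bar>)"
  have cy: "continuous_on {a..b} y" unfolding y_def by (intro continuous_intros cPQ cv)
  define A where "A = T\<^sup>2 * C * sqrt T"
  have A0: "A \<ge> 0" unfolding A_def using C T by auto
  have bR: "\<bar>R r\<bar> \<le> A * y r" if r: "r \<in> {a..b}" for r
  proof -
    note rp = pos[OF r]
    have l: "0 \<le> ln r - ln a" "ln r - ln a \<le> T" "0 \<le> ln b - ln r" "ln b - ln r \<le> T"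
      using r ab by (auto simp: Tab)
    have p: "\<bar>\<psi> r\<bar> \<le> T\<^sup>2" unfolding \<psi>_def abs_mult power2_eq_square using l by (intro mult_mono) auto
    have "\<bar>ln b + ln a - 2 * ln r\<bar> \<le> T" using l by (auto simp: abs_if)
    also have "T \<le> T\<^sup>2" using T by (simp add: power2_eq_square)
    finally have p': "\<bar>\<psi>' r\<bar> \<le> T\<^sup>2 / r" unfolding \<psi>'_def using rp by (simp add: divide_right_mono)
    have ur: "\<bar>u r\<bar> / r \<le> C * sqrt T" using bu[OF r] rp by (simp add: field_simps)
    have t1: "\<bar>\<psi> r * u r / r\<bar> \<le> A"
      using mult_mono[OF p ur] T rp by (simp add: A_def abs_mult mult.assoc)
    have t2: "\<bar>\<psi>' r * u r\<bar> \<le> A"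
    proof -
      have "\<bar>\<psi>' r * u r\<bar> \<le> (T\<^sup>2 / r) * (C * r * sqrt T)"
        unfolding abs_mult using p' bu[OF r] T rp by (intro mult_mono) auto
      also have "\<dots> = A" using rp by (simp add: A_def field_simps)
      finally show ?thesis .
    qed
    have t3: "\<bar>\<psi> r * u1 r\<bar> \<le> A"
      using mult_mono[OF p bu1[OF r]] T by (simp add: A_def abs_mult mult.assoc)
    have "\<bar>\<psi>' r * u r + 2 * \<psi> r * u1 r - \<psi> r * u r / r\<bar> \<le> 4 * A"
      using t1 t2 t3 by linarith
    then have "\<bar>v2 r * (\<psi>' r * u r + 2 * \<psi> r * u1 r - \<psi> r * u r / r)\<bar> \<le> \<bar>v2 r\<bar> * (4 * A)"
      unfolding abs_mult by (intro mult_left_mono) auto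
    moreover have "\<bar>\<psi> r * u r / r * (P r - 2 * \<kappa> * Q r)\<bar> \<le> A * (\<bar>P r\<bar> + 2 * \<kappa> * \<bar>Q r\<bar>)"
    proof -
      have "\<bar>2 * \<kappa> * Q r\<bar> = 2 * \<kappa> * \<bar>Q r\<bar>" using \<kappa> by (simp add: abs_mult)
      then have "\<bar>P r - 2 * \<kappa> * Q r\<bar> \<le> \<bar>P r\<bar> + 2 * \<kappa> * \<bar>Q r\<bar>" by linarith
      with t1 A0 show ?thesis unfolding abs_mult[of "\<psi> r * u r / r"] by (intro mult_mono) auto
    qed
    ultimately show ?thesis unfolding R_def y_def by (simp add: algebra_simps)
  qed
  \<comment> \<open>The three summands of \<open>y\<close> cost a factor 3. Then 48 = 3 * 4^2 covers
    the \<open>v2\<close> term, and 12 \<kappa>^2 = 6 \<kappa> * 2 \<kappa> covers the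
    \<open>Q\<close> term, whose weight in the energy is 2 \<kappa>.\<close>
  have yE: "integral {a..b} (\<lambda>r. r * (y r)\<^sup>2) \<le> (48 + 6 * \<kappa>) * E"
  proof -
    have "integral {a..b} (\<lambda>r. r * (y r)\<^sup>2) \<le> integral {a..b} (\<lambda>r. (48 + 6 * \<kappa>) * mode_energy \<kappa> v v1 v2 r)"
    proof (intro integral_le integrable_continuous_real continuous_intros cy continuous_on_mode_energy cv)
      show "{a..b} \<subseteq> {0<..}" using ab by auto
      fix r assume r: "r \<in> {a..b}"
      have three: "(\<alpha> + \<beta> + \<gamma>)\<^sup>2 \<le> 3 * (\<alpha>\<^sup>2 + \<beta>\<^sup>2 + \<gamma>\<^sup>2)" for \<alpha> \<beta> \<gamma> :: real
      proof -
        have "3 * (\<alpha>\<^sup>2 + \<beta>\<^sup>2 + \<gamma>\<^sup>2) - (\<alpha> + \<beta> + \<gamma>)\<^sup>2 = (\<alpha> - \<beta>)\<^sup>2 + (\<beta> - \<gamma>)\<^sup>2 + (\<alpha> - \<gamma>)\<^sup>2"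
          by (simp add: power2_eq_square algebra_simps)
        then show ?thesis by (smt (verit) zero_le_power2)
      qed
      have "(y r)\<^sup>2 \<le> 3 * ((P r)\<^sup>2 + 4 * \<kappa> * \<kappa> * (Q r)\<^sup>2 + 16 * (v2 r)\<^sup>2)"
        using three[of "\<bar>P r\<bar>" "2 * \<kappa> * \<bar>Q r\<bar>" "4 * \<bar>v2 r\<bar>"]
        by (simp add: y_def power_mult_distrib power2_eq_square[of \<kappa>])
      also have "\<dots> \<le> (48 + 6 * \<kappa>) * ((v2 r)\<^sup>2 + 2 * \<kappa> * (Q r)\<^sup>2 + (P r)\<^sup>2)"
      proof -
        have "(48 + 6 * \<kappa>) * ((v2 r)\<^sup>2 + 2 * \<kappa> * (Q r)\<^sup>2 + (P r)\<^sup>2) - 3 * ((P r)\<^sup>2 + 4 * \<kappa> * \<kappa> * (Q r)\<^sup>2 + 16 * (v2 r)\<^sup>2)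
          = 6 * \<kappa> * (v2 r)\<^sup>2 + 96 * \<kappa> * (Q r)\<^sup>2 + (45 + 6 * \<kappa>) * (P r)\<^sup>2"
          by (simp add: algebra_simps)
        also have "\<dots> \<ge> 0" using \<kappa> by (intro add_nonneg_nonneg mult_nonneg_nonneg) auto
        finally show ?thesis by simp
      qed
      finally have "r * (y r)\<^sup>2 \<le> r * ((48 + 6 * \<kappa>) * ((v2 r)\<^sup>2 + 2 * \<kappa> * (Q r)\<^sup>2 + (P r)\<^sup>2))"
        using pos[OF r] by (intro mult_left_mono) auto
      then show "r * (y r)\<^sup>2 \<le> (48 + 6 * \<kappa>) * mode_energy \<kappa> v v1 v2 r"
        by (simp add: mode_energy_def P_def Q_def mult.left_commute)
    qed
    then show ?thesis by (simp add: E_def)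
  qed
  have "\<bar>integral {a..b} R\<bar> \<le> integral {a..b} (\<lambda>r. A * y r)"
  proof -
    have "norm (integral {a..b} R) \<le> integral {a..b} (\<lambda>r. A * y r)"
      by (intro integral_norm_bound_integral integrable_continuous_real continuous_intros cR cy) (use bR in auto)
    then show ?thesis by simp
  qed
  also have "\<dots> = A * integral {a..b} y" by simp
  also have "\<dots> \<le> A * (sqrt ((48 + 6 * \<kappa>) * E) * sqrt T)"
  proof (intro mult_left_mono A0)
    have "(integral {a..b} y)\<^sup>2 \<le> integral {a..b} (\<lambda>x. x * (y x)\<^sup>2) * ln (b / a)"
      using integral_squared_le_weighted[OF ab(1) _ cy] ab by simp
    also have "\<dots> \<le> ((48 + 6 * \<kappa>) * E) * T"
      unfolding T(1)[symmetric] using yE T by (intro mult_right_mono) auto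
    finally have "integral {a..b} y \<le> sqrt (((48 + 6 * \<kappa>) * E) * T)" by (rule real_le_rsqrt)
    then show "integral {a..b} y \<le> sqrt ((48 + 6 * \<kappa>) * E) * sqrt T" by (simp add: real_sqrt_mult)
  qed
  \<comment> \<open>T^2 comes from \<open>\<psi>\<close>, one factor sqrt T from the growth of u and
    another from Cauchy-Schwarz. Together they match the T^3/6 in the denominator of
    \<open>L\<close>, so the final bound is independent of T.\<close>
  also have "\<dots> = C * sqrt ((48 + 6 * \<kappa>) * E) * T ^ 3"
  proof -
    have "sqrt T * sqrt T = T" using T by simp
    then have "A * (s * sqrt T) = C * s * T ^ 3" for s
      by (simp add: A_def power2_eq_square power3_eq_cube)
    then show ?thesis .
  qed
  finally have "\<bar>L\<bar> \<le> 6 * (C * sqrt ((48 + 6 * \<kappa>) * E))"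
    unfolding L_def using T by (simp add: field_simps abs_mult)
  with xL x show ?thesis unfolding E_def by (intro bexI[of _ x]) auto
qed

text \<open>Cauchy criterion at both ends of the half-line. An interval nearly attaining the
  supremum of all integrals leaves at most e for any interval lying to one side of it.\<close>

lemma bounded_energy_tails:
  fixes f :: "real \<Rightarrow> real"
  assumes c: "continuous_on {0<..} f" and nn: "\<And>r. r > 0 \<Longrightarrow> f r \<ge> 0"
    and B: "\<And>a b. 0 < a \<Longrightarrow> a \<le> b \<Longrightarrow> integral {a..b} f \<le> B" and e: "e > 0"
  shows "\<exists>a0 b0. 0 < a0 \<and> a0 \<le> b0 \<and>
     (\<forall>a b. 0 < a \<longrightarrow> a \<le> b \<longrightarrow> (b \<le> a0 \<or> b0 \<le> a) \<longrightarrow> integral {a..b} f \<le> e)"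
proof -
  define I where "I = (\<lambda>(a,b). integral {a..b} f) ` {(a,b). 0 < a \<and> a \<le> b}"
  have ne: "I \<noteq> {}" and bd: "bdd_above I"
    unfolding I_def using B by (auto intro!: bdd_aboveI[of _ B] exI[of _ 1])
  obtain z where z: "z \<in> I" "Sup I - e < z"
    using less_cSup_iff[OF ne bd, of "Sup I - e"] e by auto
  from z(1) obtain a0 b0 where ab0: "0 < a0" "a0 \<le> b0" "z = integral {a0..b0} f" by (auto simp: I_def)
  have "integral {a..b} f \<le> e" if ab: "0 < a" "a \<le> b" "b \<le> a0 \<or> b0 \<le> a" for a b
  proof -
    \<comment> \<open>The hull of both intervals; the stretch between them contributes a nonnegative
      amount.\<close>
    define l u where "l = min a a0" and "u = max b b0"
    have lu: "0 < l" "l \<le> u" using ab ab0 by (auto simp: l_def u_def)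
    have int: "f integrable_on {s..t}" if "l \<le> s" for s t
      using that lu by (intro integrable_continuous_real continuous_on_subset[OF c]) auto
    have sub: "integral {s..t} f \<ge> 0" if "l \<le> s" for s t
      using that lu int by (intro integral_nonneg nn) auto
    have comb: "integral {s..t} f + integral {t..w} f = integral {s..w} f" if "l \<le> s" "s \<le> t" "t \<le> w" for s t w
      using that int[of s w] by (intro Henstock_Kurzweil_Integration.integral_combine) auto
    have "integral {a..b} f + z \<le> integral {l..u} f"
      using ab(3)
    proof
      assume "b \<le> a0"
      then have "l = a" "u = b0" using ab ab0 by (auto simp: l_def u_def)
      then show ?thesis
        using comb[of a b b0] comb[of b a0 b0] ab ab0 \<open>b \<le> a0\<close> sub[of b a0] by auto
    next
      assume "b0 \<le> a"
      then have "l = a0" "u = b" using ab ab0 by (auto simp: l_def u_def)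
      then show ?thesis
        using comb[of a0 b0 b] comb[of b0 a b] ab ab0 \<open>b0 \<le> a\<close> sub[of b0 a] by auto
    qed
    also have "integral {l..u} f \<le> Sup I"
      using lu by (intro cSup_upper bd) (auto simp: I_def)
    finally show ?thesis using z by simp
  qed
  with ab0 show ?thesis by blast
qed

section \<open>The interpolation error of a single mode\<close>

text \<open>$v$ and $u$ are the modes of the polyspline and of the interpolation error, $C$ is the set of radii and
  $\kappa = k^2$. Between the radii $M$ is the coefficient of $u$ in the boundary term of the energy form; it
  involves the third derivative of $v$. If the error has a nonzero limit $l$ at the origin, then its constant
  part must be annihilated by $M$, which is where biharmonicity at $0$ enters.\<close>

locale spline_mode =
  fixes \<kappa> :: real and C :: "real set" and v v1 v2 M u u1 u2 :: "real \<Rightarrow> real" and Bv Bw l :: real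
  assumes \<kappa>: "0 \<le> \<kappa>" and finC: "finite C" and posC: "C \<subseteq> {0<..}"
    and dv: "\<And>r. r > 0 \<Longrightarrow> (v has_real_derivative v1 r) (at r)"
    and dv1: "\<And>r. r > 0 \<Longrightarrow> (v1 has_real_derivative v2 r) (at r)"
    and cv2: "continuous_on {0<..} v2"
    and du: "\<And>r. r > 0 \<Longrightarrow> (u has_real_derivative u1 r) (at r)"
    and du1: "\<And>r. r > 0 \<Longrightarrow> (u1 has_real_derivative u2 r) (at r)"
    and cu2: "continuous_on {0<..} u2"
    and dz: "\<And>r. r > 0 \<Longrightarrow> r \<notin> C \<Longrightarrow> ((\<lambda>r. r * v2 r) has_real_derivative
        v1 r / r - \<kappa> * v r / r\<^sup>2 - 2 * \<kappa> * (v r / r - v1 r) / r - M r) (at r)"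
    and dM: "\<And>r. r > 0 \<Longrightarrow> r \<notin> C \<Longrightarrow> (M has_real_derivative
        2 * \<kappa> * (v r / r - v1 r) / r\<^sup>2 - \<kappa> * (v1 r / r - \<kappa> * v r / r\<^sup>2) / r) (at r)"
    and uC: "\<And>c. c \<in> C \<Longrightarrow> u c = 0"
    and Ev: "\<And>a b. 0 < a \<Longrightarrow> a \<le> b \<Longrightarrow> integral {a..b} (mode_energy \<kappa> v v1 v2) \<le> Bv"
    and Ew: "\<And>a b. 0 < a \<Longrightarrow> a \<le> b \<Longrightarrow> integral {a..b}
        (mode_energy \<kappa> (\<lambda>r. u r + v r) (\<lambda>r. u1 r + v1 r) (\<lambda>r. u2 r + v2 r)) \<le> Bw"
    and u0: "(u \<longlongrightarrow> l) (at_right 0)"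
    and l0: "l = 0 \<or> (\<exists>\<delta>>0. \<forall>r. 0 < r \<and> r < \<delta> \<longrightarrow> M r = 0)"
begin

lemma continuous_modes:
  assumes "A \<subseteq> {0<..}"
  shows "continuous_on A v" "continuous_on A v1" "continuous_on A v2"
    "continuous_on A u" "continuous_on A u1" "continuous_on A u2"
proof -
  show "continuous_on A v" "continuous_on A v1" "continuous_on A u" "continuous_on A u1"
    using assms by (auto intro!: continuous_at_imp_continuous_on DERIV_isCont dv dv1 du du1)
  show "continuous_on A v2" "continuous_on A u2" using assms cv2 cu2 continuous_on_subset by blast+
qed

lemma derivatives_within:
  assumes "r > 0"
  shows "(u has_real_derivative u1 r) (at r within A)" "(u1 has_real_derivative u2 r) (at r within A)"
    "r \<notin> C \<Longrightarrow> ((\<lambda>r. r * v2 r) has_real_derivative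
        v1 r / r - \<kappa> * v r / r\<^sup>2 - 2 * \<kappa> * (v r / r - v1 r) / r - M r) (at r within A)"
  using du[OF assms] du1[OF assms] dz[OF assms] has_field_derivative_at_within by blast+

text \<open>The boundary term of the integrated form. At the radii themselves nothing is known about
  M, so the product with u = 0 is replaced by the value 0, which is its limit.\<close>

definition \<Phi> :: "real \<Rightarrow> real" where
  "\<Phi> r = r * v2 r * u1 r + (if r \<in> C then 0 else M r * u r)"

text \<open>In the product rule the term -M u' from \<open>dz\<close> cancels M u', and what remains
  is the form.\<close>

lemma \<Phi>_deriv:
  assumes r: "r > 0" "r \<notin> C"
  shows "(\<Phi> has_real_derivative mode_form \<kappa> v v1 v2 u u1 u2 r) (at r)"
proof -
  have "((\<lambda>r. (r * v2 r) * u1 r + M r * u r) has_real_derivative mode_form \<kappa> v v1 v2 u u1 u2 r) (at r)"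
    by (rule derivative_eq_intros dz dM du du1 r refl)+
       (use r in \<open>simp add: mode_form_def field_simps power2_eq_square\<close>)
  moreover have "open (- C)" using finC by (simp add: finite_imp_closed open_Compl)
  ultimately show ?thesis
    by (rule has_field_derivative_transform_within_open) (use r in \<open>auto simp: \<Phi>_def\<close>)
qed

text \<open>The formula for M' is continuous across c, hence bounded near c, and M is Lipschitz on
  each side separately.\<close>

lemma M_bounded_near:
  assumes c: "c > 0"
  shows "\<exists>d>0. \<exists>B. d < c \<and> (\<forall>r. r \<noteq> c \<and> \<bar>r - c\<bar> < d \<longrightarrow> r \<notin> C \<and> \<bar>M r\<bar> \<le> B)"
proof -
  obtain d0 where d0: "d0 > 0" "\<And>x. x \<in> C \<Longrightarrow> x \<noteq> c \<Longrightarrow> d0 \<le> dist c x"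
    using finite_set_avoid[OF finC, of c] by auto
  define d where "d = min d0 (c / 2)"
  have d: "d > 0" "d < c" "\<And>r. r \<noteq> c \<Longrightarrow> \<bar>r - c\<bar> < d \<Longrightarrow> r \<notin> C"
    using d0 c by (force simp: d_def dist_real_def)+
  define K where "K = (\<lambda>r. 2 * \<kappa> * (v r / r - v1 r) / r\<^sup>2 - \<kappa> * (v1 r / r - \<kappa> * v r / r\<^sup>2) / r)"
  have "continuous_on {c - d..c + d} K"
    unfolding K_def using d by (intro continuous_intros continuous_modes) auto
  then have "bounded (K ` {c - d..c + d})"
    by (intro compact_imp_bounded compact_continuous_image) auto
  then obtain B where "\<forall>z\<in>K ` {c - d..c + d}. norm z \<le> B"
    unfolding bounded_iff by blast
  then have B: "\<bar>K r\<bar> \<le> B" if "r \<in> {c - d..c + d}" for r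
    using that by simp
  \<comment> \<open>The mean value bound applies only to intervals that avoid c, since M may jump
    there.\<close>
  have side: "\<bar>M x - M y\<bar> \<le> B * \<bar>x - y\<bar>"
    if S: "S = {c<..<c + d} \<or> S = {c - d<..<c}" and xS: "x \<in> S" and yS: "y \<in> S" for S x y
  proof -
    have "convex S" using S by auto
    moreover have "(M has_real_derivative K z) (at z within S)" if "z \<in> S" for z
    proof -
      have "z > 0" "z \<notin> C" using S that d(1,2) d(3)[of z] by auto
      from dM[OF this] show ?thesis unfolding K_def by (rule has_field_derivative_at_within)
    qed
    moreover have "norm (K z) \<le> B" if "z \<in> S" for z using S that B[of z] by auto
    ultimately show ?thesis using field_differentiable_bound[of S M K B x y] xS yS by simp
  qed
  have B0: "B \<ge> 0" using B[of c] d by auto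
  have "\<bar>M r\<bar> \<le> \<bar>M (c + d/2)\<bar> + \<bar>M (c - d/2)\<bar> + B * d" if r: "r \<noteq> c" "\<bar>r - c\<bar> < d" for r
  proof (cases "r > c")
    case True
    then have "\<bar>M r - M (c + d/2)\<bar> \<le> B * \<bar>r - (c + d/2)\<bar>"
      using r d by (intro side[where S="{c<..<c + d}"]) auto
    also have "\<dots> \<le> B * d" using True r B0 by (intro mult_left_mono) auto
    finally show ?thesis by linarith
  next
    case False
    then have "\<bar>M r - M (c - d/2)\<bar> \<le> B * \<bar>r - (c - d/2)\<bar>"
      using r d by (intro side[where S="{c - d<..<c}"]) auto
    also have "\<dots> \<le> B * d" using False r B0 by (intro mult_left_mono) auto
    finally show ?thesis by linarith
  qed
  with d show ?thesis by blast
qed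

text \<open>At a radius the term M u is a bounded factor times one tending to 0, so a possible jump
  of M does not show in the product.\<close>

lemma \<Phi>_continuous: "continuous_on {0<..} \<Phi>"
proof (rule continuous_at_imp_continuous_on, rule ballI)
  fix r :: real assume "r \<in> {0<..}"
  then have r: "r > 0" by simp
  show "isCont \<Phi> r"
  proof (cases "r \<in> C")
    case False then show ?thesis using \<Phi>_deriv[OF r] DERIV_isCont by blast
  next
    case True
    obtain d B where d: "d > 0" "\<And>x. x \<noteq> r \<Longrightarrow> \<bar>x - r\<bar> < d \<Longrightarrow> \<bar>M x\<bar> \<le> B"
      using M_bounded_near[OF r] by blast
    have "(u \<longlongrightarrow> 0) (at r)" using DERIV_isCont[OF du[OF r]] uC[OF True] by (simp add: isCont_def)
    then have lim0: "((\<lambda>x. B * \<bar>u x\<bar>) \<longlongrightarrow> 0) (at r)" by (auto intro: tendsto_mult_right_zero tendsto_rabs_zero)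
    have "((\<lambda>x. if x \<in> C then 0 else M x * u x) \<longlongrightarrow> 0) (at r)"
    proof (rule Lim_null_comparison[OF _ lim0])
      have B: "B \<ge> 0" using d(2)[of "r + d/2"] d(1) by auto
      show "\<forall>\<^sub>F x in at r. norm (if x \<in> C then 0 else M x * u x) \<le> B * \<bar>u x\<bar>"
        unfolding eventually_at using d B
        by (intro exI[of _ d]) (auto simp: dist_real_def abs_mult intro!: mult_right_mono)
    qed
    moreover have "((\<lambda>x. x * v2 x * u1 x) \<longlongrightarrow> r * v2 r * u1 r) (at r)"
    proof -
      have "isCont v2 r" "isCont u1 r"
        using cv2 r DERIV_isCont[OF du1[OF r]] by (auto simp: continuous_on_eq_continuous_at)
      then show ?thesis by (auto simp: isCont_def intro!: tendsto_intros)
    qed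
    ultimately have "((\<lambda>x. x * v2 x * u1 x + (if x \<in> C then 0 else M x * u x)) \<longlongrightarrow> r * v2 r * u1 r + 0) (at r)"
      by (intro tendsto_add)
    then show ?thesis unfolding isCont_def \<Phi>_def using True by simp
  qed
qed

text \<open>Continuity of the boundary term allows the fundamental theorem with finitely many
  exceptional points, so the circles leave no contribution.\<close>

lemma form_integral:
  assumes "0 < a" "a \<le> b"
  shows "integral {a..b} (mode_form \<kappa> v v1 v2 u u1 u2) = \<Phi> b - \<Phi> a"
proof (rule integral_unique, rule fundamental_theorem_of_calculus_interior_strong[OF finC assms(2)])
  show "(\<Phi> has_vector_derivative mode_form \<kappa> v v1 v2 u u1 u2 x) (at x)" if "x \<in> {a<..<b} - C" for x
    using that assms \<Phi>_deriv[of x] by (simp add: has_real_derivative_iff_has_vector_derivative)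
  show "continuous_on {a..b} \<Phi>" using assms by (intro continuous_on_subset[OF \<Phi>_continuous]) auto
qed

section \<open>Growth of the error mode and decay of the boundary term\<close>

definition Bu :: real where "Bu = 2 * Bw + 2 * Bv"

lemma cont_energy:
  assumes "A \<subseteq> {0<..}"
  shows "continuous_on A (mode_energy \<kappa> v v1 v2)" "continuous_on A (mode_energy \<kappa> u u1 u2)"
    "continuous_on A (mode_energy \<kappa> (\<lambda>r. u r + v r) (\<lambda>r. u1 r + v1 r) (\<lambda>r. u2 r + v2 r))"
  using assms by (intro continuous_on_mode_energy continuous_intros continuous_modes; blast)+

lemma cont_form:
  assumes "A \<subseteq> {0<..}" shows "continuous_on A (mode_form \<kappa> v v1 v2 u u1 u2)"
  unfolding mode_form_def using assms by (intro continuous_intros continuous_modes) auto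

text \<open>A crude a priori bound from the parallelogram inequality. It only controls the growth of
  u; the sharp bound \<open>Bw\<close> follows later from orthogonality.\<close>

lemma Eu:
  assumes "0 < a" "a \<le> b"
  shows "integral {a..b} (mode_energy \<kappa> u u1 u2) \<le> Bu"
proof -
  let ?w = "mode_energy \<kappa> (\<lambda>r. u r + v r) (\<lambda>r. u1 r + v1 r) (\<lambda>r. u2 r + v2 r)"
  let ?v = "mode_energy \<kappa> v v1 v2"
  have sub: "{a..b} \<subseteq> {0<..}" using assms by auto
  have "mode_energy \<kappa> u u1 u2 r \<le> 2 * ?w r + 2 * ?v r" if r: "r \<in> {a..b}" for r
  proof -
    \<comment> \<open>With w = u + v this is the energy of w + v, the nonnegative term dropped from
      the parallelogram identity for w - v = u.\<close>
    have "mode_energy \<kappa> (\<lambda>r. u r + 2 * v r) (\<lambda>r. u1 r + 2 * v1 r) (\<lambda>r. u2 r + 2 * v2 r) r \<ge> 0"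
      using r assms \<kappa> by (intro mode_energy_nonneg) auto
    moreover have "mode_energy \<kappa> (\<lambda>r. u r + 2 * v r) (\<lambda>r. u1 r + 2 * v1 r) (\<lambda>r. u2 r + 2 * v2 r) r =
       mode_energy \<kappa> u u1 u2 r + 4 * ?v r + 4 * mode_form \<kappa> v v1 v2 u u1 u2 r"
    proof -
      have "mode_energy \<kappa> (\<lambda>r. 2 * v r) (\<lambda>r. 2 * v1 r) (\<lambda>r. 2 * v2 r) r = 4 * ?v r"
        "mode_form \<kappa> (\<lambda>r. 2 * v r) (\<lambda>r. 2 * v1 r) (\<lambda>r. 2 * v2 r) u u1 u2 r = 2 * mode_form \<kappa> v v1 v2 u u1 u2 r"
        by (simp_all add: mode_energy_def mode_form_def power2_eq_square algebra_simps diff_divide_distrib)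
      then show ?thesis
        using mode_energy_add[of \<kappa> u "\<lambda>r. 2 * v r" u1 "\<lambda>r. 2 * v1 r" u2 "\<lambda>r. 2 * v2 r" r] by simp
    qed
    ultimately show ?thesis using mode_energy_add[of \<kappa> u v u1 v1 u2 v2 r] by linarith
  qed
  then have "integral {a..b} (mode_energy \<kappa> u u1 u2) \<le> integral {a..b} (\<lambda>r. 2 * ?w r + 2 * ?v r)"
    by (intro integral_le integrable_continuous_real continuous_intros cont_energy sub) auto
  also have "\<dots> = 2 * integral {a..b} ?w + 2 * integral {a..b} ?v"
    by (subst integral_add; (intro integrable_continuous_real continuous_intros cont_energy sub)?) simp
  also have "\<dots> \<le> Bu" unfolding Bu_def using Ew[OF assms] Ev[OF assms] by simp
  finally show ?thesis .
qed

lemma Bu0: "Bu \<ge> 0"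
proof -
  have "0 \<le> integral {1..1} (mode_energy \<kappa> u u1 u2)" by simp
  also have "\<dots> \<le> Bu" by (rule Eu) auto
  finally show ?thesis .
qed

text \<open>The energy dominates r |u''|^2, and the weighted Cauchy-Schwarz inequality turns this
  into a modulus of continuity on the logarithmic scale.\<close>

lemma u1_growth:
  assumes "0 < s" "s \<le> t"
  shows "\<bar>u1 t - u1 s\<bar> \<le> sqrt Bu * sqrt (ln (t / s))"
proof -
  have sub: "{s..t} \<subseteq> {0<..}" using assms by auto
  have "integral {s..t} u2 = u1 t - u1 s"
    using assms by (intro integral_deriv_real derivatives_within) auto
  then have "(u1 t - u1 s)\<^sup>2 \<le> integral {s..t} (\<lambda>x. x * (u2 x)\<^sup>2) * ln (t / s)"
    using integral_squared_le_weighted[OF assms continuous_modes(6)[OF sub]] by simp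
  also have "\<dots> \<le> Bu * ln (t / s)"
  proof (rule mult_right_mono)
    have "integral {s..t} (\<lambda>x. x * (u2 x)\<^sup>2) \<le> integral {s..t} (mode_energy \<kappa> u u1 u2)"
      using assms \<kappa>
      by (intro integral_le integrable_continuous_real continuous_intros cont_energy continuous_modes sub)
         (auto simp: mode_energy_def intro!: mult_left_mono)
    also have "\<dots> \<le> Bu" by (rule Eu[OF assms])
    finally show "integral {s..t} (\<lambda>x. x * (u2 x)\<^sup>2) \<le> Bu" .
  qed (use assms in auto)
  finally have "sqrt ((u1 t - u1 s)\<^sup>2) \<le> sqrt (Bu * ln (t / s))" by (rule real_sqrt_le_mono)
  then show ?thesis by (simp add: real_sqrt_mult)
qed

lemma v_tails:
  assumes "e > 0"
  shows "\<exists>a0 b0. 0 < a0 \<and> a0 \<le> b0 \<and> (\<forall>a b. 0 < a \<longrightarrow> a \<le> b \<longrightarrow> (b \<le> a0 \<or> b0 \<le> a) \<longrightarrow>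
     integral {a..b} (mode_energy \<kappa> v v1 v2) \<le> e)"
proof (rule bounded_energy_tails[OF cont_energy(1)[OF order_refl] _ Ev assms])
  show "0 \<le> mode_energy \<kappa> v v1 v2 r" if "r > 0" for r
    using that \<kappa> by (intro mode_energy_nonneg) auto
qed

text \<open>On [a, a^2] the logarithmic length T = ln a is at least half of ln r, so the
  sqrt-logarithmic growth of u' is a multiple of sqrt T with a constant independent of a. The small
  factor is the energy of v beyond a.\<close>

lemma \<Phi>_at_infinity:
  assumes e: "e > 0"
  shows "\<exists>b\<ge>R. \<bar>\<Phi> b\<bar> \<le> e"
proof -
  define G where "G = \<bar>u 1\<bar> + \<bar>u1 1\<bar> + sqrt (2 * Bu)"
  have G: "G \<ge> 0" using Bu0 by (simp add: G_def)
  \<comment> \<open>Solves the bound of \<open>tail_estimate\<close> for the energy; G + 1 keeps the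
    quotient meaningful when G = 0.\<close>
  define \<eta> where "\<eta> = (e / (6 * (G + 1)))\<^sup>2 / (48 + 6 * \<kappa>)"
  have \<eta>: "\<eta> > 0" "6 * G * sqrt ((48 + 6 * \<kappa>) * \<eta>) \<le> e"
  proof -
    show "\<eta> > 0" using e G \<kappa> by (auto simp: \<eta>_def intro!: divide_pos_pos)
    have "sqrt ((48 + 6 * \<kappa>) * \<eta>) = e / (6 * (G + 1))"
      using \<kappa> e G by (simp add: \<eta>_def)
    moreover have "6 * G * (e / (6 * (G + 1))) \<le> e" using e G by (simp add: field_simps)
    ultimately show "6 * G * sqrt ((48 + 6 * \<kappa>) * \<eta>) \<le> e" by simp
  qed
  obtain b0 where b0: "b0 > 0" "\<And>a b. b0 \<le> a \<Longrightarrow> a \<le> b \<Longrightarrow> integral {a..b} (mode_energy \<kappa> v v1 v2) \<le> \<eta>"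
    using v_tails[OF \<eta>(1)] by (metis order_less_le_trans)
  define c0 where "c0 = Max (insert 0 C) + 1"
  have c0: "c < c0" if "c \<in> C" for c
  proof -
    have "c \<le> Max (insert 0 C)" using finC that by (intro Max_ge) auto
    then show ?thesis by (simp add: c0_def)
  qed
  \<comment> \<open>Large enough to pass R, to make the energy tail small, to avoid all radii in C,
    and to have T \<ge> 1.\<close>
  define a where "a = max (max R b0) (max c0 (exp 1))"
  have a: "R \<le> a" "b0 \<le> a" "c0 \<le> a" "exp 1 \<le> a" by (auto simp: a_def)
  have a1: "a > 1" using a(4) exp_gt_one[of "1::real"] by linarith
  define T where "T = ln a"
  have T: "T \<ge> 1" "T = ln (a\<^sup>2 / a)" unfolding T_def using a(4) a1
    by (auto simp: ln_ge_iff power2_eq_square)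
  have sT: "sqrt T \<ge> 1" using T by simp
  have pos: "x > 0" "x \<notin> C" if "x \<in> {a..a\<^sup>2}" for x
    using that a1 a(3) c0[of x] by auto
  have sub: "{a..a\<^sup>2} \<subseteq> {0<..}" using pos by auto
  have b1: "\<bar>u1 s\<bar> \<le> (\<bar>u1 1\<bar> + sqrt (2 * Bu)) * sqrt T" if s: "1 \<le> s" "s \<le> a\<^sup>2" for s
  proof -
    have "ln s \<le> ln (a\<^sup>2)" using s by (subst ln_le_cancel_iff) auto
    then have l: "ln s \<le> 2 * T" using a1 by (simp add: T_def ln_realpow)
    have "\<bar>u1 s - u1 1\<bar> \<le> sqrt Bu * sqrt (ln s)" using u1_growth[of 1 s] s by simp
    also have "\<dots> \<le> sqrt Bu * sqrt (2 * T)" using l Bu0 by (intro mult_left_mono) auto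
    finally have "\<bar>u1 s\<bar> \<le> \<bar>u1 1\<bar> * 1 + sqrt (2 * Bu) * sqrt T" by (simp add: real_sqrt_mult mult_ac)
    also have "\<dots> \<le> \<bar>u1 1\<bar> * sqrt T + sqrt (2 * Bu) * sqrt T"
      using sT by (intro add_right_mono mult_left_mono) auto
    finally show ?thesis by (simp add: distrib_right)
  qed
  have b0': "\<bar>u s\<bar> \<le> G * s * sqrt T" if s: "1 \<le> s" "s \<le> a\<^sup>2" for s
  proof -
    have "norm (u s - u 1) \<le> ((\<bar>u1 1\<bar> + sqrt (2 * Bu)) * sqrt T) * norm (s - 1)"
      by (rule field_differentiable_bound[where S="{1..s}"])
         (use s b1 in \<open>auto intro: derivatives_within\<close>)
    also have "\<dots> \<le> ((\<bar>u1 1\<bar> + sqrt (2 * Bu)) * sqrt T) * s"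
      using s Bu0 T by (intro mult_left_mono mult_nonneg_nonneg) auto
    finally have "\<bar>u s\<bar> \<le> \<bar>u 1\<bar> * 1 + (\<bar>u1 1\<bar> + sqrt (2 * Bu)) * s * sqrt T" by (simp add: mult_ac)
    also have "\<bar>u 1\<bar> * 1 \<le> \<bar>u 1\<bar> * (s * sqrt T)"
      using mult_mono[OF s(1) sT] s by (intro mult_left_mono) auto
    finally show ?thesis by (simp add: G_def algebra_simps)
  qed
  have "a < a\<^sup>2" using a1 by (simp add: power2_eq_square)
  have "\<exists>r\<in>{a..a\<^sup>2}. \<bar>r * v2 r * u1 r + M r * u r\<bar> \<le>
           6 * G * sqrt ((48 + 6 * \<kappa>) * integral {a..a\<^sup>2} (mode_energy \<kappa> v v1 v2))"
  proof (rule tail_estimate[OF _ \<open>a < a\<^sup>2\<close> T(2) T(1) \<kappa> G])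
    show "\<bar>u1 r\<bar> \<le> G * sqrt T" if "r \<in> {a..a\<^sup>2}" for r
      using b1[of r] that a1 T by (simp add: G_def distrib_right add.assoc)
        (smt (verit) mult_nonneg_nonneg real_sqrt_ge_zero abs_ge_zero)
  qed (use a1 pos b0' continuous_modes[OF sub] in \<open>auto intro!: derivatives_within\<close>)
  then obtain r where r: "r \<in> {a..a\<^sup>2}" "\<bar>r * v2 r * u1 r + M r * u r\<bar> \<le>
           6 * G * sqrt ((48 + 6 * \<kappa>) * integral {a..a\<^sup>2} (mode_energy \<kappa> v v1 v2))" by auto
  note r(2)
  also have "\<dots> \<le> 6 * G * sqrt ((48 + 6 * \<kappa>) * \<eta>)"
    using b0(2)[OF a(2), of "a\<^sup>2"] \<open>a < a\<^sup>2\<close> G \<kappa> by (intro mult_left_mono real_sqrt_le_mono) auto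
  also note \<eta>(2)
  finally have "\<bar>\<Phi> r\<bar> \<le> e" using pos[OF r(1)] by (simp add: \<Phi>_def)
  with r a show ?thesis by (intro exI[of _ r]) auto
qed

text \<open>The counterpart on [a^2, a]. Here u itself need not be small compared with r, but u - l
  is, and subtracting l leaves u' unchanged while altering the boundary term by M l, which vanishes
  near 0.\<close>

lemma \<Phi>_at_zero:
  assumes e: "e > 0" and R: "R > 0"
  shows "\<exists>b>0. b \<le> R \<and> \<bar>\<Phi> b\<bar> \<le> e"
proof -
  define A where "A = \<bar>u1 1\<bar> + sqrt (2 * Bu)"
  define G where "G = A + 2 * sqrt Bu"
  have A: "A \<ge> 0" using Bu0 by (simp add: A_def)
  have G: "G \<ge> 0" using Bu0 A by (simp add: G_def)
  define \<eta> where "\<eta> = (e / (6 * (G + 1)))\<^sup>2 / (48 + 6 * \<kappa>)"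
  have \<eta>: "\<eta> > 0" "6 * G * sqrt ((48 + 6 * \<kappa>) * \<eta>) \<le> e"
  proof -
    show "\<eta> > 0" using e G \<kappa> by (auto simp: \<eta>_def intro!: divide_pos_pos)
    have "sqrt ((48 + 6 * \<kappa>) * \<eta>) = e / (6 * (G + 1))"
      using \<kappa> e G by (simp add: \<eta>_def)
    moreover have "6 * G * (e / (6 * (G + 1))) \<le> e" using e G by (simp add: field_simps)
    ultimately show "6 * G * sqrt ((48 + 6 * \<kappa>) * \<eta>) \<le> e" by simp
  qed
  obtain a0 where a0: "a0 > 0" "\<And>a b. 0 < a \<Longrightarrow> a \<le> b \<Longrightarrow> b \<le> a0 \<Longrightarrow> integral {a..b} (mode_energy \<kappa> v v1 v2) \<le> \<eta>"
    using v_tails[OF \<eta>(1)] by metis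
  obtain c0 where c0: "c0 > 0" "\<And>c. c \<in> C \<Longrightarrow> c0 \<le> c"
  proof -
    obtain d where "d > 0" "\<And>x. x \<in> C \<Longrightarrow> x \<noteq> 0 \<Longrightarrow> d \<le> dist 0 x"
      using finite_set_avoid[OF finC, of 0] by auto
    moreover have "c > 0" if "c \<in> C" for c using posC that by auto
    ultimately show thesis using that[of d] by (force simp: dist_real_def)
  qed
  \<comment> \<open>Both alternatives of \<open>l0\<close> in one statement; if l = 0, any positive
    number such as 1 serves.\<close>
  obtain \<delta> where \<delta>: "\<delta> > 0" "\<And>r. 0 < r \<Longrightarrow> r < \<delta> \<Longrightarrow> M r * l = 0"
    using l0 that[of 1] that by auto
  define a where "a = min (min R a0) (min (c0 / 2) (min (\<delta> / 2) (exp (- 1))))"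
  have a: "a \<le> R" "a \<le> a0" "a < c0" "a < \<delta>" "a \<le> exp (- 1)"
  proof -
    have "a \<le> c0 / 2" "a \<le> \<delta> / 2" by (auto simp: a_def)
    then show "a < c0" "a < \<delta>" using c0 \<delta> by linarith+
  qed (auto simp: a_def)
  have apos: "a > 0" using R a0 c0 \<delta> by (auto simp: a_def)
  have a1: "a < 1" using a(5) exp_less_one_iff[of "-1::real"] by linarith
  define T where "T = - ln a"
  define q where "q = a\<^sup>2"
  have "ln a \<le> -1" using a(5) apos by (metis ln_exp ln_le_cancel_iff exp_gt_zero)
  then have T: "T \<ge> 1" "T = ln (a / q)" unfolding T_def using apos
    by (auto simp: q_def ln_div power2_eq_square ln_mult)
  have sT: "sqrt T \<ge> 1" using T by simp
  have a2: "0 < q" "q < a" using apos a1 by (auto simp: q_def power2_eq_square)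
  have pos: "x > 0" "x \<notin> C" "x \<le> a" if "x \<in> {q..a}" for x
    using that less_le_trans[OF a2(1), of x] a(3) c0(2)[of x] by auto
  have sub: "{q..a} \<subseteq> {0<..}" by (intro subsetI, unfold greaterThan_iff) (rule pos(1))
  have b1: "\<bar>u1 s\<bar> \<le> A * sqrt T" if s: "s \<in> {q..a}" for s
  proof -
    have "ln q \<le> ln s" using s pos[OF s] a2 by (subst ln_le_cancel_iff) auto
    moreover have "ln q = - 2 * T" using apos by (simp add: q_def T_def ln_realpow)
    ultimately have l: "ln (1 / s) \<le> 2 * T" using pos[OF s] by (simp add: ln_div)
    have "\<bar>u1 1 - u1 s\<bar> \<le> sqrt Bu * sqrt (ln (1 / s))" using u1_growth[of s 1] pos[OF s] a1 by simp
    also have "\<dots> \<le> sqrt Bu * sqrt (2 * T)" using l Bu0 by (intro mult_left_mono) auto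
    finally have "\<bar>u1 s\<bar> \<le> \<bar>u1 1\<bar> * 1 + sqrt (2 * Bu) * sqrt T" by (simp add: real_sqrt_mult mult_ac)
    also have "\<dots> \<le> \<bar>u1 1\<bar> * sqrt T + sqrt (2 * Bu) * sqrt T"
      using sT by (intro add_right_mono mult_left_mono) auto
    finally show ?thesis by (simp add: A_def distrib_right)
  qed
  have b0: "\<bar>u r - l\<bar> \<le> G * r * sqrt T" if r: "r \<in> {q..a}" for r
  proof -
    have rp: "r > 0" using pos[OF r] by simp
    \<comment> \<open>Antiderivative of the bound on |u'| over (0, r]. The bound sqrt T is available
      only on [q, a]; below r the growth estimate is started at r, and its logarithm is majorized so
      that the integral down to 0 is explicit and equals 2 r sqrt Bu.\<close>
    define H where "H = (\<lambda>\<tau>. A * sqrt T * \<tau> + 2 * sqrt Bu * sqrt r * sqrt \<tau>)"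
    have dH: "(H has_real_derivative A * sqrt T + sqrt Bu * (sqrt r / sqrt \<tau>)) (at \<tau>)" if "\<tau> > 0" for \<tau>
      unfolding H_def using that by (auto intro!: derivative_eq_intros simp: field_simps)
    have u1b: "\<bar>u1 \<tau>\<bar> \<le> A * sqrt T + sqrt Bu * (sqrt r / sqrt \<tau>)" if \<tau>: "0 < \<tau>" "\<tau> \<le> r" for \<tau>
    proof -
      \<comment> \<open>A wasteful bound for the logarithm, but its square root is still integrable
        at 0.\<close>
      have "ln (r / \<tau>) \<le> r / \<tau>" using ln_bound[of "r / \<tau>"] \<tau> by simp
      then have "sqrt Bu * sqrt (ln (r / \<tau>)) \<le> sqrt Bu * sqrt (r / \<tau>)" using Bu0 by (intro mult_left_mono) auto
      with u1_growth[of \<tau> r] b1[OF r] \<tau> show ?thesis by (simp add: real_sqrt_divide)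
    qed
    have Hs: "\<bar>u r - u s\<bar> \<le> H r" if s: "0 < s" "s < r" for s
    proof -
      have Hn: "H s \<ge> 0" using A Bu0 T s rp by (simp add: H_def)
      have "H s - u s \<le> H r - u r"
      proof (rule DERIV_nonneg_imp_nondecreasing[where f="\<lambda>\<tau>. H \<tau> - u \<tau>"])
        fix \<tau> assume \<tau>: "s \<le> \<tau>" "\<tau> \<le> r"
        then show "\<exists>y. ((\<lambda>\<tau>. H \<tau> - u \<tau>) has_real_derivative y) (at \<tau>) \<and> 0 \<le> y"
          using DERIV_diff[OF dH[of \<tau>] du[of \<tau>]] u1b[of \<tau>] s by (intro exI conjI) auto
      qed (use s in auto)
      moreover have "H s + u s \<le> H r + u r"
      proof (rule DERIV_nonneg_imp_nondecreasing[where f="\<lambda>\<tau>. H \<tau> + u \<tau>"])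
        fix \<tau> assume \<tau>: "s \<le> \<tau>" "\<tau> \<le> r"
        then show "\<exists>y. ((\<lambda>\<tau>. H \<tau> + u \<tau>) has_real_derivative y) (at \<tau>) \<and> 0 \<le> y"
          using DERIV_add[OF dH[of \<tau>] du[of \<tau>]] u1b[of \<tau>] s by (intro exI conjI) auto
      qed (use s in auto)
      ultimately show ?thesis using Hn by auto
    qed
    have "((\<lambda>s. \<bar>u r - u s\<bar>) \<longlongrightarrow> \<bar>u r - l\<bar>) (at_right 0)" by (intro tendsto_intros u0)
    then have "\<bar>u r - l\<bar> \<le> H r"
      by (rule tendsto_upperbound) (use Hs rp in \<open>auto simp: eventually_at_right_field intro!: exI[of _ r]\<close>)
    also have "\<dots> = A * r * sqrt T + 2 * sqrt Bu * r * 1"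
      using rp by (simp add: H_def mult_ac)
    also have "\<dots> \<le> A * r * sqrt T + 2 * sqrt Bu * r * sqrt T"
      using sT Bu0 rp by (intro add_left_mono mult_left_mono) auto
    finally show ?thesis by (simp add: G_def algebra_simps)
  qed
  have "\<exists>r\<in>{q..a}. \<bar>r * v2 r * u1 r + M r * (u r - l)\<bar> \<le>
           6 * G * sqrt ((48 + 6 * \<kappa>) * integral {q..a} (mode_energy \<kappa> v v1 v2))"
  proof (rule tail_estimate[OF a2 T(2) T(1) \<kappa> G continuous_modes(1-3)[OF sub]])
    show "\<bar>u1 r\<bar> \<le> G * sqrt T" if "r \<in> {q..a}" for r
    proof -
      have "A * sqrt T \<le> G * sqrt T" using Bu0 T by (intro mult_right_mono) (auto simp: G_def)
      with b1[OF that] show ?thesis by simp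
    qed
    show "((\<lambda>r. u r - l) has_real_derivative u1 r) (at r within {q..a})" if "r \<in> {q..a}" for r
      using DERIV_diff[OF derivatives_within(1) DERIV_const, of r] pos[OF that] by simp
    show "continuous_on {q..a} (\<lambda>r. u r - l)" by (intro continuous_intros continuous_modes(4)[OF sub])
    show "continuous_on {q..a} u1" by (rule continuous_modes(5)[OF sub])
  qed (rule derivatives_within(3)[OF pos(1,2)] b0; assumption)+
  then obtain r where r: "r \<in> {q..a}" "\<bar>r * v2 r * u1 r + M r * (u r - l)\<bar> \<le>
           6 * G * sqrt ((48 + 6 * \<kappa>) * integral {q..a} (mode_energy \<kappa> v v1 v2))" by auto
  note r(2)
  also have "\<dots> \<le> 6 * G * sqrt ((48 + 6 * \<kappa>) * \<eta>)"
    using a0(2)[of "q" a] a a2 G \<kappa> by (intro mult_left_mono real_sqrt_le_mono) auto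
  also note \<eta>(2)
  finally have "\<bar>r * v2 r * u1 r + M r * (u r - l)\<bar> \<le> e" .
  moreover have "M r * l = 0" using \<delta>(2)[of r] pos[OF r(1)] a by auto
  ultimately have "\<bar>\<Phi> r\<bar> \<le> e" using pos[OF r(1)] by (simp add: \<Phi>_def right_diff_distrib)
  with pos[OF r(1)] a show ?thesis by (intro exI[of _ r]) auto
qed

text \<open>The energy of u + v is that of u plus that of v plus twice the form. Dropping the energy
  of v leaves only the boundary terms, and two of size e/4, doubled, account for e.\<close>

theorem energy_le:
  assumes xy: "0 < x" "x \<le> y"
  shows "integral {x..y} (mode_energy \<kappa> u u1 u2) \<le> Bw"
proof (rule field_le_epsilon)
  fix e :: real assume "e > 0"
  then have e: "e / 4 > 0" by simp
  obtain a where a: "0 < a" "a \<le> x" "\<bar>\<Phi> a\<bar> \<le> e / 4" using \<Phi>_at_zero[OF e xy(1)] by auto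
  obtain b where b: "y \<le> b" "\<bar>\<Phi> b\<bar> \<le> e / 4" using \<Phi>_at_infinity[OF e, of y] by auto
  have ab: "a \<le> b" using a b xy by simp
  have sub: "{a..b} \<subseteq> {0<..}" using a by auto
  let ?w = "mode_energy \<kappa> (\<lambda>r. u r + v r) (\<lambda>r. u1 r + v1 r) (\<lambda>r. u2 r + v2 r)"
  let ?f = "mode_form \<kappa> v v1 v2 u u1 u2"
  have "integral {x..y} (mode_energy \<kappa> u u1 u2) \<le> integral {a..b} (mode_energy \<kappa> u u1 u2)"
    using a b sub \<kappa> by (intro integral_mono_interval cont_energy mode_energy_nonneg) auto
  also have "\<dots> \<le> integral {a..b} (\<lambda>r. ?w r - 2 * ?f r)"
  proof (intro integral_le integrable_continuous_real continuous_intros cont_energy cont_form sub)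
    fix r assume "r \<in> {a..b}"
    then have "0 \<le> mode_energy \<kappa> v v1 v2 r" using a \<kappa> by (intro mode_energy_nonneg) auto
    then show "mode_energy \<kappa> u u1 u2 r \<le> ?w r - 2 * ?f r"
      using mode_energy_add[of \<kappa> u v u1 v1 u2 v2 r] by simp
  qed
  also have "\<dots> = integral {a..b} ?w - 2 * (\<Phi> b - \<Phi> a)"
    by (subst integral_diff; (intro integrable_continuous_real continuous_intros cont_energy cont_form sub)?)
       (simp add: form_integral[OF a(1) ab])
  also have "\<dots> \<le> Bw + e"
  proof -
    have "- (e / 4) \<le> \<Phi> b" "\<Phi> a \<le> e / 4" using a b by (auto simp: abs_le_iff)
    then have "- 2 * (\<Phi> b - \<Phi> a) \<le> e" by (simp add: field_simps)
    with Ew[OF a(1) ab] show ?thesis by simp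
  qed
  finally show "integral {x..y} (mode_energy \<kappa> u u1 u2) \<le> Bw + e" .
qed

end

section \<open>Polar derivatives and Fourier modes\<close>

lemma Ck_on_SucD: "Ck_on (Suc k) U F \<Longrightarrow> Ck_on k U F"
proof (induction k arbitrary: F)
  case (Suc k)
  note * = Suc.prems[unfolded Ck_on.simps(2)[of "Suc k"]]
  then have "Ck_on k U (partial_x F)" "Ck_on k U (partial_y F)" by (blast intro: Suc.IH)+
  with * show ?case unfolding Ck_on.simps(2)[of k] by blast
qed simp

lemma Ck_on_mono: "Ck_on k U F \<Longrightarrow> j \<le> k \<Longrightarrow> Ck_on j U F"
proof (induction k)
  case (Suc k) then show ?case using Ck_on_SucD[of k U F] by (cases "j = Suc k") auto
qed simp

lemma Ck_on_continuous: "Ck_on k U F \<Longrightarrow> continuous_on U F"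
  by (cases k) auto

lemma open_slices:
  fixes p :: "real \<times> real"
  assumes "open U" "p \<in> U"
  shows "\<forall>\<^sub>F t in nhds (fst p). (t, snd p) \<in> U" "\<forall>\<^sub>F t in nhds (snd p). (fst p, t) \<in> U"
proof -
  have o: "open ((\<lambda>t. (t, snd p)) -` U)" "open ((\<lambda>t. (fst p, t)) -` U)"
    by (rule open_vimage[OF assms(1)]; intro continuous_intros)+
  have "fst p \<in> (\<lambda>t. (t, snd p)) -` U" "snd p \<in> (\<lambda>t. (fst p, t)) -` U" using assms(2) by simp_all
  from eventually_nhds_in_open[OF o(1) this(1)] eventually_nhds_in_open[OF o(2) this(2)]
  show "\<forall>\<^sub>F t in nhds (fst p). (t, snd p) \<in> U" "\<forall>\<^sub>F t in nhds (snd p). (fst p, t) \<in> U" by simp_all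
qed

lemma partial_cong:
  assumes U: "open U" "p \<in> U" and eq: "\<And>q. q \<in> U \<Longrightarrow> F q = G q"
  shows "partial_x F p = partial_x G p" "partial_y F p = partial_y G p"
  unfolding partial_x_def partial_y_def
  by (rule deriv_cong_ev; use open_slices[OF U] in \<open>auto elim!: eventually_mono simp: eq\<close>)+

lemma field_differentiable_cong_ev:
  assumes "\<forall>\<^sub>F t in nhds x. f t = g t" "f field_differentiable (at x)"
  shows "g field_differentiable (at x)"
  using assms DERIV_cong_ev[OF refl assms(1) refl] unfolding field_differentiable_def by blast

lemma Ck_on_cong:
  assumes "open U" "\<And>q. q \<in> U \<Longrightarrow> F q = G q" "Ck_on k U F"
  shows "Ck_on k U G"
  using assms(2,3)
proof (induction k arbitrary: F G)
  case 0 then show ?case by (simp cong: continuous_on_cong)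
next
  case (Suc k)
  have ev: "\<forall>\<^sub>F t in nhds (fst p). F (t, snd p) = G (t, snd p)" "\<forall>\<^sub>F t in nhds (snd p). F (fst p, t) = G (fst p, t)"
    if "p \<in> U" for p
    using open_slices[OF assms(1) that] Suc.prems(1) by (auto elim!: eventually_mono)
  have "continuous_on U G" using Suc.prems by (simp cong: continuous_on_cong)
  moreover have "(\<lambda>t. G (t, snd p)) field_differentiable (at (fst p))"
    "(\<lambda>t. G (fst p, t)) field_differentiable (at (snd p))" if "p \<in> U" for p
    using field_differentiable_cong_ev[OF ev(1)[OF that]] field_differentiable_cong_ev[OF ev(2)[OF that]]
      Suc.prems(2) that by auto
  moreover have "Ck_on k U (partial_x G)" "Ck_on k U (partial_y G)"
    using Suc.prems partial_cong[OF assms(1) _ Suc.prems(1)]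
    by (auto intro: Suc.IH[of "partial_x F"] Suc.IH[of "partial_y F"])
  ultimately show ?case by simp
qed

lemma Ck_on_add:
  assumes "open U" "Ck_on k U F" "Ck_on k U G"
  shows "Ck_on k U (\<lambda>p. F p + G p)"
  using assms(2,3)
proof (induction k arbitrary: F G)
  case 0 then show ?case by (simp add: continuous_on_add)
next
  case (Suc k)
  have x: "partial_x (\<lambda>p. F p + G p) p = partial_x F p + partial_x G p"
    and y: "partial_y (\<lambda>p. F p + G p) p = partial_y F p + partial_y G p" if "p \<in> U" for p
    using Suc.prems that unfolding partial_x_def partial_y_def by (auto intro!: deriv_add)
  have "Ck_on k U (\<lambda>p. partial_x F p + partial_x G p)" "Ck_on k U (\<lambda>p. partial_y F p + partial_y G p)"
    using Suc by auto
  then have "Ck_on k U (partial_x (\<lambda>p. F p + G p))" "Ck_on k U (partial_y (\<lambda>p. F p + G p))"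
    by (auto intro: Ck_on_cong[OF assms(1), rotated] simp: x y)
  then show ?case using Suc.prems by (auto intro!: continuous_intros field_differentiable_add)
qed

text \<open>Partial derivatives depend only on values near the point, so regularity on the separate
  annuli can be glued together.\<close>

lemma Ck_on_local:
  assumes "\<And>p. p \<in> U \<Longrightarrow> \<exists>V. open V \<and> p \<in> V \<and> Ck_on k V F"
  shows "Ck_on k U F"
  using assms
proof (induction k arbitrary: F)
  case 0
  show ?case unfolding Ck_on.simps
  proof (rule continuous_at_imp_continuous_on, rule ballI)
    fix p assume "p \<in> U"
    from 0[OF this] obtain V where "open V" "p \<in> V" "continuous_on V F" by auto
    then show "isCont F p" by (simp add: continuous_on_eq_continuous_at)
  qed
next
  case (Suc k)
  have "continuous_on U F"
  proof (rule continuous_at_imp_continuous_on, rule ballI)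
    fix p assume "p \<in> U"
    from Suc.prems[OF this] obtain V where "open V" "p \<in> V" "continuous_on V F" by auto
    then show "isCont F p" by (simp add: continuous_on_eq_continuous_at)
  qed
  moreover have "(\<lambda>t. F (t, snd p)) field_differentiable (at (fst p)) \<and>
      (\<lambda>t. F (fst p, t)) field_differentiable (at (snd p))" if "p \<in> U" for p
    using Suc.prems[OF that] by auto
  moreover have "Ck_on k U (partial_x F)" "Ck_on k U (partial_y F)"
  proof -
    show "Ck_on k U (partial_x F)"
    proof (rule Suc.IH)
      fix p assume "p \<in> U"
      from Suc.prems[OF this] show "\<exists>V. open V \<and> p \<in> V \<and> Ck_on k V (partial_x F)" by auto
    qed
    show "Ck_on k U (partial_y F)"
    proof (rule Suc.IH)
      fix p assume "p \<in> U"
      from Suc.prems[OF this] show "\<exists>V. open V \<and> p \<in> V \<and> Ck_on k V (partial_y F)" by auto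
    qed
  qed
  ultimately show ?case by simp
qed

lemma Ck_on_laplacian:
  assumes "open U" "Ck_on (Suc (Suc k)) U F"
  shows "Ck_on k U (laplacian F)"
proof -
  have "Ck_on k U (partial_x (partial_x F))" "Ck_on k U (partial_y (partial_y F))"
    using assms(2) by auto
  from Ck_on_add[OF assms(1) this] show ?thesis
    by (rule Ck_on_cong[OF assms(1), rotated]) (simp add: laplacian_def)
qed

text \<open>Total differentiability from continuous partial derivatives; this is what makes the
  chain rule for polar coordinates available.\<close>

lemma C1_has_derivative:
  assumes U: "open U" "p \<in> U" and F: "Ck_on (Suc 0) U F"
  shows "(F has_derivative (\<lambda>(s, t). partial_x F p * s + partial_y F p * t)) (at p)"
proof -
  obtain x y where p: "p = (x, y)" by force
  obtain A B where AB: "open A" "open B" "p \<in> A \<times> B" "A \<times> B \<subseteq> U"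
    using open_prod_elim[OF U] by metis
  \<comment> \<open>The criterion for partial derivatives asks for a convex set in the second
    variable, hence a ball.\<close>
  then obtain e where e: "e > 0" "ball y e \<subseteq> B" using p by (auto simp: open_contains_ball)
  let ?Y = "ball y e"
  have sub: "A \<times> ?Y \<subseteq> U" using e AB by auto
  have op: "open (A \<times> ?Y)" and mem: "(x, y) \<in> A \<times> ?Y" using AB e p by (auto intro: open_Times)
  have "((\<lambda>(x, y). F (x, y)) has_derivative (\<lambda>(s, t). partial_x F p * s + blinfun_apply (blinfun_mult_right (partial_y F (x, y))) t))
      (at (x, y) within A \<times> ?Y)"
  proof (rule has_derivative_partialsI[where fy="\<lambda>x y. blinfun_mult_right (partial_y F (x, y))"])
    have "((\<lambda>t. F (t, y)) has_real_derivative partial_x F p) (at x)"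
      using F U(2) p by (auto simp: partial_x_def DERIV_deriv_iff_field_differentiable)
    then show "((\<lambda>x. F (x, y)) has_derivative (*) (partial_x F p)) (at x within A)"
      unfolding has_field_derivative_def by (rule has_derivative_at_withinI)
    show "((\<lambda>y. F (x', y)) has_derivative blinfun_apply (blinfun_mult_right (partial_y F (x', y')))) (at y' within ?Y)"
      if "x' \<in> A" "y' \<in> ?Y" for x' y'
    proof -
      have "(x', y') \<in> U" using that sub by auto
      then have "((\<lambda>t. F (x', t)) has_real_derivative partial_y F (x', y')) (at y')"
        using F by (force simp: partial_y_def DERIV_deriv_iff_field_differentiable)
      then show ?thesis
        unfolding has_field_derivative_def blinfun_mult_right.rep_eq by (rule has_derivative_at_withinI)
    qed
    have "continuous_on (A \<times> ?Y) (partial_y F)" using F sub by (auto intro: continuous_on_subset)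
    then have "continuous_on (A \<times> ?Y) (\<lambda>z. blinfun_mult_right (partial_y F z))"
      by (intro continuous_intros bounded_linear.continuous_on[OF bounded_linear_blinfun_mult_right])
    then show "continuous (at (x, y) within A \<times> ?Y) (\<lambda>(x, y). blinfun_mult_right (partial_y F (x, y)))"
      using mem unfolding continuous_on_eq_continuous_within split_beta prod.collapse by blast
  qed (use e in auto)
  then show ?thesis using at_within_open[OF mem op] p by (simp add: split_beta)
qed

section \<open>Polar derivatives by the chain rule\<close>

text \<open>This and the next four are explicit chain-rule expressions in the Cartesian partials, so
  joint continuity can be read off directly. They are identified with the iterated
  \<open>deriv\<close> of the energy only for r > 0.\<close>

definition polar_r :: "(real \<times> real \<Rightarrow> real) \<Rightarrow> real \<Rightarrow> real \<Rightarrow> real" where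
  "polar_r F r \<theta> = cos \<theta> * polar (partial_x F) r \<theta> + sin \<theta> * polar (partial_y F) r \<theta>"

definition polar_t :: "(real \<times> real \<Rightarrow> real) \<Rightarrow> real \<Rightarrow> real \<Rightarrow> real" where
  "polar_t F r \<theta> = r * (cos \<theta> * polar (partial_y F) r \<theta> - sin \<theta> * polar (partial_x F) r \<theta>)"

definition polar_rr :: "(real \<times> real \<Rightarrow> real) \<Rightarrow> real \<Rightarrow> real \<Rightarrow> real" where
  "polar_rr F r \<theta> = cos \<theta> * polar_r (partial_x F) r \<theta> + sin \<theta> * polar_r (partial_y F) r \<theta>"

definition polar_tr :: "(real \<times> real \<Rightarrow> real) \<Rightarrow> real \<Rightarrow> real \<Rightarrow> real" where
  "polar_tr F r \<theta> = (cos \<theta> * polar (partial_y F) r \<theta> - sin \<theta> * polar (partial_x F) r \<theta>) +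
     r * (cos \<theta> * polar_r (partial_y F) r \<theta> - sin \<theta> * polar_r (partial_x F) r \<theta>)"

definition polar_tt :: "(real \<times> real \<Rightarrow> real) \<Rightarrow> real \<Rightarrow> real \<Rightarrow> real" where
  "polar_tt F r \<theta> = r * (cos \<theta> * polar_t (partial_y F) r \<theta> - sin \<theta> * polar (partial_y F) r \<theta>
     - sin \<theta> * polar_t (partial_x F) r \<theta> - cos \<theta> * polar (partial_x F) r \<theta>)"

lemma norm_polar_point: "r \<ge> 0 \<Longrightarrow> norm (r * cos \<theta>, r * sin \<theta>) = r"
proof -
  assume r: "r \<ge> 0"
  have "(r * cos \<theta>)\<^sup>2 + (r * sin \<theta>)\<^sup>2 = r\<^sup>2 * ((cos \<theta>)\<^sup>2 + (sin \<theta>)\<^sup>2)"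
    by (simp add: power_mult_distrib distrib_left del: sin_cos_squared_add2)
  then show ?thesis using r by (simp add: norm_Pair)
qed

context
  fixes U :: "(real \<times> real) set" and F :: "real \<times> real \<Rightarrow> real" and r \<theta> :: real
  assumes U: "open U" and F: "Ck_on (Suc 0) U F" and p: "(r * cos \<theta>, r * sin \<theta>) \<in> U"
begin

lemma polar_has_r_derivative: "((\<lambda>t. polar F t \<theta>) has_real_derivative polar_r F r \<theta>) (at r)"
proof -
  have d: "((\<lambda>t. (t * cos \<theta>, t * sin \<theta>)) has_derivative (\<lambda>t. (t * cos \<theta>, t * sin \<theta>))) (at r)"
    by (auto intro!: derivative_eq_intros)
  have "((\<lambda>t. F (t * cos \<theta>, t * sin \<theta>)) has_derivative
      (\<lambda>t. partial_x F (r * cos \<theta>, r * sin \<theta>) * (t * cos \<theta>) + partial_y F (r * cos \<theta>, r * sin \<theta>) * (t * sin \<theta>))) (at r)"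
    using has_derivative_compose[OF d C1_has_derivative[OF U p F]] by simp
  then show ?thesis unfolding has_field_derivative_def polar_def polar_r_def
    by (rule has_derivative_eq_rhs) (auto simp: algebra_simps)
qed

lemma polar_has_t_derivative: "((\<lambda>t. polar F r t) has_real_derivative polar_t F r \<theta>) (at \<theta>)"
proof -
  have d: "((\<lambda>t. (r * cos t, r * sin t)) has_derivative (\<lambda>t. (- (r * sin \<theta> * t), r * cos \<theta> * t))) (at \<theta>)"
    by (auto intro!: derivative_eq_intros simp: algebra_simps)
  have "((\<lambda>t. F (r * cos t, r * sin t)) has_derivative
      (\<lambda>t. partial_x F (r * cos \<theta>, r * sin \<theta>) * (- (r * sin \<theta> * t)) + partial_y F (r * cos \<theta>, r * sin \<theta>) * (r * cos \<theta> * t))) (at \<theta>)"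
    using has_derivative_compose[OF d C1_has_derivative[OF U p F]] by simp
  then show ?thesis unfolding has_field_derivative_def polar_def polar_t_def
    by (rule has_derivative_eq_rhs) (auto simp: algebra_simps)
qed

end

lemma polar_periodic: "polar F r (- pi) = polar F r pi" "polar F r (\<theta> + 2 * pi) = polar F r \<theta>"
  by (simp_all add: polar_def)

section \<open>Fourier coefficients as functions of the radius\<close>

lemma continuous_on_slice:
  fixes f :: "real \<Rightarrow> real \<Rightarrow> real"
  assumes "continuous_on (A \<times> UNIV) (\<lambda>(r, \<theta>). f r \<theta>)" "r \<in> A"
  shows "continuous_on B (f r)"
proof -
  have "continuous_on B (\<lambda>\<theta>. (r, \<theta>))" by (intro continuous_intros)
  from continuous_on_compose2[OF assms(1) this] assms(2) show ?thesis by auto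
qed

lemma hcoeff_continuous:
  fixes f :: "real \<Rightarrow> real \<Rightarrow> real"
  assumes "continuous_on (A \<times> UNIV) (\<lambda>(r, \<theta>). f r \<theta>)"
  shows "continuous_on A (\<lambda>r. hcoeff k (f r))"
proof -
  have "continuous_on (A \<times> cbox (-pi) pi) (\<lambda>(r, \<theta>). f r \<theta>)"
    using assms by (rule continuous_on_subset) auto
  then have "continuous_on (A \<times> cbox (-pi) pi) (\<lambda>(r, \<theta>). f r \<theta> * hartley k \<theta>)"
    unfolding split_beta by (intro continuous_intros)
  from integral_continuous_on_param[OF this] show ?thesis
    by (simp add: hcoeff_def)
qed

lemma hcoeff_has_derivative:
  fixes f :: "real \<Rightarrow> real \<Rightarrow> real"
  assumes A: "open A" "r0 \<in> A"
    and d: "\<And>r \<theta>. r \<in> A \<Longrightarrow> ((\<lambda>r. f r \<theta>) has_real_derivative f' r \<theta>) (at r)"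
    and c: "continuous_on (A \<times> UNIV) (\<lambda>(r, \<theta>). f r \<theta>)"
    and c': "continuous_on (A \<times> UNIV) (\<lambda>(r, \<theta>). f' r \<theta>)"
  shows "((\<lambda>r. hcoeff k (f r)) has_real_derivative hcoeff k (f' r0)) (at r0)"
proof -
  obtain e where e: "e > 0" "ball r0 e \<subseteq> A" using A by (auto simp: open_contains_ball)
  have "((\<lambda>r. integral (cbox (-pi) pi) (\<lambda>\<theta>. f r \<theta> * hartley k \<theta>)) has_real_derivative
      integral (cbox (-pi) pi) (\<lambda>\<theta>. f' r0 \<theta> * hartley k \<theta>)) (at r0 within ball r0 e)"
  proof (rule leibniz_rule_field_derivative)
    show "((\<lambda>r. f r \<theta> * hartley k \<theta>) has_real_derivative f' r \<theta> * hartley k \<theta>) (at r within ball r0 e)"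
      if "r \<in> ball r0 e" for r \<theta>
    proof -
      have "r \<in> A" using that e by auto
      then have "((\<lambda>r. f r \<theta> * hartley k \<theta>) has_real_derivative f' r \<theta> * hartley k \<theta>) (at r)"
        by (intro DERIV_cmult_right d)
      then show ?thesis by (rule has_field_derivative_at_within)
    qed
    show "(\<lambda>\<theta>. f r \<theta> * hartley k \<theta>) integrable_on cbox (-pi) pi" if "r \<in> ball r0 e" for r
    proof -
      have "r \<in> A" using that e by auto
      from continuous_on_slice[OF c this] show ?thesis by (intro integrable_continuous continuous_intros)
    qed
    have "continuous_on (ball r0 e \<times> cbox (-pi) pi) (\<lambda>(r, \<theta>). f' r \<theta>)"
      using c' by (rule continuous_on_subset) (use e in auto)
    then show "continuous_on (ball r0 e \<times> cbox (-pi) pi) (\<lambda>(r, \<theta>). f' r \<theta> * hartley k \<theta>)"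
      unfolding split_beta by (intro continuous_intros)
  qed (use e in auto)
  then show ?thesis using e at_within_open[of r0 "ball r0 e"] by (simp add: hcoeff_def)
qed

text \<open>Differentiation in the angle exchanges the frequencies k and -k, because that is how it
  acts on the basis. Two differentiations restore the index and give -k^2.\<close>

lemma hcoeff_by_parts:
  assumes d: "\<And>\<theta>. (f has_real_derivative f' \<theta>) (at \<theta>)" and c: "continuous_on UNIV f'"
    and per: "f (- pi) = f pi"
  shows "hcoeff k f' = - of_int k * hcoeff (- k) f"
proof -
  have cf: "continuous_on A f" for A using d by (auto intro!: continuous_at_imp_continuous_on DERIV_isCont)
  have c': "continuous_on {-pi..pi} f'" using c continuous_on_subset by blast
  have "integral {-pi..pi} (\<lambda>\<theta>. f' \<theta> * hartley k \<theta> + f \<theta> * (of_int k * hartley (- k) \<theta>)) =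
      f pi * hartley k pi - f (- pi) * hartley k (- pi)"
  proof (rule integral_deriv_real)
    fix \<theta>
    show "((\<lambda>\<theta>. f \<theta> * hartley k \<theta>) has_real_derivative f' \<theta> * hartley k \<theta> + f \<theta> * (of_int k * hartley (- k) \<theta>))
        (at \<theta> within {-pi..pi})"
      using DERIV_mult[OF has_field_derivative_at_within[OF d[of \<theta>]] has_real_derivative_hartley[of k \<theta>], where s="{-pi..pi}"]
      by (simp add: mult_ac add.commute)
  qed simp
  also have "\<dots> = 0" by (simp add: per hartley_periodic)
  also have "integral {-pi..pi} (\<lambda>\<theta>. f' \<theta> * hartley k \<theta> + f \<theta> * (of_int k * hartley (- k) \<theta>)) =
      hcoeff k f' + of_int k * hcoeff (- k) f"
  proof -
    have "(\<lambda>\<theta>. f \<theta> * (of_int k * hartley (- k) \<theta>)) = (\<lambda>\<theta>. of_int k * (f \<theta> * hartley (- k) \<theta>))"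
      by (simp add: mult_ac)
    then show ?thesis unfolding hcoeff_def
      by (subst integral_add) (auto intro!: integrable_continuous_real continuous_intros cf c')
  qed
  finally show ?thesis by simp
qed

definition "polar_mode F k r = hcoeff k (polar F r)"
definition "polar_mode_r F k r = hcoeff k (polar_r F r)"
definition "polar_mode_rr F k r = hcoeff k (polar_rr F r)"

text \<open>The set of radii is a parameter because the same mode calculus serves the punctured
  plane, the complement of the circles and a punctured disc, and serves both a polyspline and its
  Laplacian.\<close>

locale C2_annular =
  fixes A :: "real set" and F :: "real \<times> real \<Rightarrow> real"
  assumes A: "open A" "A \<subseteq> {0<..}" and F: "Ck_on 2 {p. norm p \<in> A} F"
begin

abbreviation "U \<equiv> {p :: real \<times> real. norm p \<in> A}"

lemma openU: "open U"
  using open_vimage[OF A(1), of norm] by (simp add: vimage_def continuous_on_norm_id)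

lemma point: "r \<in> A \<Longrightarrow> (r * cos \<theta>, r * sin \<theta>) \<in> U"
  using A norm_polar_point[of r \<theta>] by (auto simp: less_imp_le subset_iff)

lemma C1: "Ck_on (Suc 0) U F" "Ck_on (Suc 0) U (partial_x F)" "Ck_on (Suc 0) U (partial_y F)"
  using F by (auto simp: numeral_2_eq_2)

lemma joint_continuous:
  assumes "continuous_on U G"
  shows "continuous_on (A \<times> UNIV) (\<lambda>z. polar G (fst z) (snd z))"
  unfolding polar_def
  by (rule continuous_on_compose2[OF assms]) (use point in \<open>auto intro!: continuous_intros\<close>)

lemma joint_continuous_partials:
  assumes "Ck_on (Suc 0) U G"
  shows "continuous_on (A \<times> UNIV) (\<lambda>z. polar_r G (fst z) (snd z))"
    "continuous_on (A \<times> UNIV) (\<lambda>z. polar_t G (fst z) (snd z))"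
proof -
  have "continuous_on U (partial_x G)" "continuous_on U (partial_y G)" using assms by simp_all
  note * = this[THEN joint_continuous]
  show "continuous_on (A \<times> UNIV) (\<lambda>z. polar_r G (fst z) (snd z))"
    "continuous_on (A \<times> UNIV) (\<lambda>z. polar_t G (fst z) (snd z))"
    unfolding polar_r_def polar_t_def by (intro continuous_intros *)+
qed

lemma cont_all:
  "continuous_on (A \<times> UNIV) (\<lambda>(r, \<theta>). polar F r \<theta>)"
  "continuous_on (A \<times> UNIV) (\<lambda>(r, \<theta>). polar_r F r \<theta>)"
  "continuous_on (A \<times> UNIV) (\<lambda>(r, \<theta>). polar_t F r \<theta>)"
  "continuous_on (A \<times> UNIV) (\<lambda>(r, \<theta>). polar_rr F r \<theta>)"
  "continuous_on (A \<times> UNIV) (\<lambda>(r, \<theta>). polar_tr F r \<theta>)"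
  "continuous_on (A \<times> UNIV) (\<lambda>(r, \<theta>). polar_tt F r \<theta>)"
proof -
  note * = C1[THEN Ck_on_continuous, THEN joint_continuous] C1[THEN joint_continuous_partials(1)]
    C1[THEN joint_continuous_partials(2)]
  show "continuous_on (A \<times> UNIV) (\<lambda>(r, \<theta>). polar F r \<theta>)"
    "continuous_on (A \<times> UNIV) (\<lambda>(r, \<theta>). polar_r F r \<theta>)"
    "continuous_on (A \<times> UNIV) (\<lambda>(r, \<theta>). polar_t F r \<theta>)"
    unfolding split_beta by (rule *)+
  show "continuous_on (A \<times> UNIV) (\<lambda>(r, \<theta>). polar_rr F r \<theta>)"
    "continuous_on (A \<times> UNIV) (\<lambda>(r, \<theta>). polar_tr F r \<theta>)"
    "continuous_on (A \<times> UNIV) (\<lambda>(r, \<theta>). polar_tt F r \<theta>)"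
    unfolding split_beta polar_rr_def polar_tr_def polar_tt_def by (intro continuous_intros *)+
qed

lemmas slice = cont_all[THEN continuous_on_slice]

lemma derivs:
  assumes r: "r \<in> A"
  shows "((\<lambda>t. polar F t \<theta>) has_real_derivative polar_r F r \<theta>) (at r)"
    "((\<lambda>t. polar F r t) has_real_derivative polar_t F r \<theta>) (at \<theta>)"
    "((\<lambda>t. polar_r F t \<theta>) has_real_derivative polar_rr F r \<theta>) (at r)"
    "((\<lambda>t. polar_t F t \<theta>) has_real_derivative polar_tr F r \<theta>) (at r)"
    "((\<lambda>t. polar_t F r t) has_real_derivative polar_tt F r \<theta>) (at \<theta>)"
proof -
  note dr = polar_has_r_derivative[OF openU _ point[OF r]]
  note dt = polar_has_t_derivative[OF openU _ point[OF r]]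
  show "((\<lambda>t. polar F t \<theta>) has_real_derivative polar_r F r \<theta>) (at r)"
    "((\<lambda>t. polar F r t) has_real_derivative polar_t F r \<theta>) (at \<theta>)"
    by (rule dr dt C1)+
  show "((\<lambda>t. polar_r F t \<theta>) has_real_derivative polar_rr F r \<theta>) (at r)"
    unfolding polar_r_def[of F] polar_rr_def
    by (rule derivative_eq_intros dr[OF C1(2)] dr[OF C1(3)] refl)+ simp
  show "((\<lambda>t. polar_t F t \<theta>) has_real_derivative polar_tr F r \<theta>) (at r)"
    unfolding polar_t_def[of F] polar_tr_def
    by (rule derivative_eq_intros dr[OF C1(2)] dr[OF C1(3)] refl)+ (simp add: algebra_simps)
  show "((\<lambda>t. polar_t F r t) has_real_derivative polar_tt F r \<theta>) (at \<theta>)"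
    unfolding polar_t_def[of F] polar_tt_def
    by (rule derivative_eq_intros dt[OF C1(2)] dt[OF C1(3)] refl)+ (simp add: algebra_simps)
qed

abbreviation "md \<equiv> polar_mode F"
abbreviation "md1 \<equiv> polar_mode_r F"
abbreviation "md2 \<equiv> polar_mode_rr F"

lemma md_deriv:
  assumes "r \<in> A"
  shows "(md k has_real_derivative md1 k r) (at r)" "(md1 k has_real_derivative md2 k r) (at r)"
  unfolding polar_mode_def polar_mode_r_def polar_mode_rr_def
  by (rule hcoeff_has_derivative[OF A(1) assms]; use derivs cont_all in blast)+

lemma md_continuous: "continuous_on A (md k)" "continuous_on A (md1 k)" "continuous_on A (md2 k)"
  unfolding polar_mode_def polar_mode_r_def polar_mode_rr_def by (rule hcoeff_continuous cont_all)+

lemma hcoeff_polar_t: "r \<in> A \<Longrightarrow> hcoeff k (polar_t F r) = - of_int k * md (- k) r"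
  unfolding polar_mode_def by (rule hcoeff_by_parts derivs slice polar_periodic; assumption?)+

lemma hcoeff_polar_tt: "r \<in> A \<Longrightarrow> hcoeff k (polar_tt F r) = - (of_int k)\<^sup>2 * md k r"
proof -
  assume r: "r \<in> A"
  have "polar_t F r (- pi) = polar_t F r pi" by (simp add: polar_t_def polar_periodic)
  then have "hcoeff k (polar_tt F r) = - of_int k * hcoeff (- k) (polar_t F r)"
    using r by (intro hcoeff_by_parts derivs slice)
  then show ?thesis using r by (simp add: hcoeff_polar_t power2_eq_square)
qed

text \<open>The coefficient of f_\<theta> is differentiated in r twice over, once under the integral
  and once after integration by parts; uniqueness of the derivative equates the results.\<close>

lemma hcoeff_polar_tr: "r \<in> A \<Longrightarrow> hcoeff k (polar_tr F r) = - of_int k * md1 (- k) r"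
proof -
  assume r: "r \<in> A"
  have "((\<lambda>r. hcoeff k (polar_t F r)) has_real_derivative hcoeff k (polar_tr F r)) (at r)"
    by (rule hcoeff_has_derivative[OF A(1) r]; use derivs cont_all in blast)
  moreover have "((\<lambda>r. hcoeff k (polar_t F r)) has_real_derivative - of_int k * md1 (- k) r) (at r)"
    by (rule has_field_derivative_transform_within_open[OF DERIV_cmult[OF md_deriv(1)[OF r]] A(1) r])
       (simp add: hcoeff_polar_t)
  ultimately show ?thesis by (rule DERIV_unique)
qed

lemma polar_laplacian:
  assumes "r \<in> A"
  shows "polar (laplacian F) r \<theta> = polar_rr F r \<theta> + polar_r F r \<theta> / r + polar_tt F r \<theta> / r\<^sup>2"
proof -
  have r: "r \<noteq> 0" using A assms by auto
  let ?c = "cos \<theta>" and ?s = "sin \<theta>"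
  define a b c d x y where "a = polar (partial_x (partial_x F)) r \<theta>" and "b = polar (partial_y (partial_x F)) r \<theta>"
    and "c = polar (partial_x (partial_y F)) r \<theta>" and "d = polar (partial_y (partial_y F)) r \<theta>"
    and "x = polar (partial_x F) r \<theta>" and "y = polar (partial_y F) r \<theta>"
  have e1: "polar_tt F r \<theta> / r\<^sup>2 = ?c * (?c * d - ?s * c) - ?s * (?c * b - ?s * a) - (?s * y + ?c * x) / r"
    using r unfolding polar_tt_def polar_t_def a_def[symmetric] b_def[symmetric] c_def[symmetric]
      d_def[symmetric] x_def[symmetric] y_def[symmetric]
    by (simp add: field_simps power2_eq_square)
  have e2: "polar_rr F r \<theta> = ?c * (?c * a + ?s * b) + ?s * (?c * c + ?s * d)"
    unfolding polar_rr_def polar_r_def a_def b_def c_def d_def by simp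
  have e3: "polar_r F r \<theta> / r = (?s * y + ?c * x) / r"
    unfolding polar_r_def x_def y_def by (simp add: add.commute)
  \<comment> \<open>The mixed partials b and c appear with opposite signs in \<open>e1\<close> and
    \<open>e2\<close>, and the first-order terms of \<open>e1\<close> cancel against
    \<open>e3\<close>.\<close>
  have "polar_rr F r \<theta> + polar_r F r \<theta> / r + polar_tt F r \<theta> / r\<^sup>2
      = (?c\<^sup>2 + ?s\<^sup>2) * a + (?c\<^sup>2 + ?s\<^sup>2) * d"
    unfolding e1 e2 e3
    by (simp add: algebra_simps power2_eq_square del: sin_cos_squared_add sin_cos_squared_add2 sin_cos_squared_add3)
  also have "\<dots> = a + d" by simp
  also have "\<dots> = polar (laplacian F) r \<theta>" by (simp add: a_def d_def polar_def laplacian_def)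
  finally show ?thesis by simp
qed

text \<open>Reduces biharmonicity to ordinary differential equations: applied to S it gives the mode
  of the Laplacian, applied to the Laplacian it gives the equation of that mode.\<close>

lemma hcoeff_laplacian:
  assumes r: "r \<in> A"
  shows "hcoeff k (polar (laplacian F) r) = md2 k r + md1 k r / r - (of_int k)\<^sup>2 * md k r / r\<^sup>2"
proof -
  have "polar (laplacian F) r = (\<lambda>\<theta>. polar_rr F r \<theta> + (1 / r) * polar_r F r \<theta> + (1 / r\<^sup>2) * polar_tt F r \<theta>)"
    using polar_laplacian[OF r] by auto
  then have "hcoeff k (polar (laplacian F) r) =
     hcoeff k (polar_rr F r) + (1 / r) * hcoeff k (polar_r F r) + (1 / r\<^sup>2) * hcoeff k (polar_tt F r)"
    using r by (simp only: hcoeff_add hcoeff_cmult continuous_intros slice)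
  then show ?thesis using r by (simp add: hcoeff_polar_tt polar_mode_r_def polar_mode_rr_def)
qed

end

section \<open>Splitting the energy into modes\<close>

lemma nn_integral_continuous_Icc:
  fixes f :: "real \<Rightarrow> real"
  assumes "continuous_on {a..b} f" "\<And>x. x \<in> {a..b} \<Longrightarrow> 0 \<le> f x"
  shows "(\<integral>\<^sup>+x\<in>{a..b}. ennreal (f x) \<partial>lborel) = ennreal (integral {a..b} f)"
proof -
  have "(f has_integral integral {a..b} f) {a..b}"
    using assms(1) by (intro integrable_integral integrable_continuous_real)
  from nn_integral_has_integral_lebesgue[OF assms(2) this]
  have "(\<integral>\<^sup>+x. ennreal (indicator {a..b} x * f x) \<partial>lborel) = ennreal (integral {a..b} f)" by simp
  moreover have "ennreal (indicator {a..b} x * f x) = ennreal (f x) * indicator {a..b} x" for x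
    by (simp add: indicator_def)
  ultimately show ?thesis by simp
qed

definition modal_energy :: "(real \<times> real \<Rightarrow> real) \<Rightarrow> int \<Rightarrow> ennreal" where
  "modal_energy F k = (\<integral>\<^sup>+r\<in>{0<..}. ennreal
     (mode_energy ((of_int k)\<^sup>2) (polar_mode F k) (polar_mode_r F k) (polar_mode_rr F k) r) \<partial>lborel)"

locale C2_punctured =
  fixes F :: "real \<times> real \<Rightarrow> real"
  assumes F: "Ck_on 2 (UNIV - {0}) F"

sublocale C2_punctured \<subseteq> C2_annular "{0<..}" F
proof
  have "{p :: real \<times> real. norm p \<in> {0<..}} = UNIV - {0}" by auto
  then show "Ck_on 2 {p. norm p \<in> {0<..}} F" using F by simp
qed auto

context C2_punctured
begin

lemma partials:
  assumes r: "r > 0"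
  shows "partial_r (polar F) r \<theta> = polar_r F r \<theta>"
    "partial_r (partial_r (polar F)) r \<theta> = polar_rr F r \<theta>"
    "partial_theta (polar F) r \<theta> = polar_t F r \<theta>"
    "partial_r (partial_theta (polar F)) r \<theta> = polar_tr F r \<theta>"
    "partial_theta (partial_theta (polar F)) r \<theta> = polar_tt F r \<theta>"
proof -
  have pr: "partial_r (polar F) r \<theta> = polar_r F r \<theta>" if "r > 0" for r \<theta>
    unfolding partial_r_def by (rule DERIV_imp_deriv) (use derivs(1) that in auto)
  have pt: "partial_theta (polar F) r \<theta> = polar_t F r \<theta>" if "r > 0" for r \<theta>
    unfolding partial_theta_def by (rule DERIV_imp_deriv) (use derivs(2) that in auto)
  show "partial_r (polar F) r \<theta> = polar_r F r \<theta>" by (rule pr[OF r])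
  show "partial_theta (polar F) r \<theta> = polar_t F r \<theta>" by (rule pt[OF r])
  \<comment> \<open>Second derivatives depend on the first ones in a whole neighbourhood, so the
    chain-rule formula is substituted eventually near r.\<close>
  have ev: "\<forall>\<^sub>F t in nhds r. t > 0" using eventually_nhds_in_open[of "{0<..}" r] r by simp
  have "deriv (\<lambda>t. partial_r (polar F) t \<theta>) r = deriv (\<lambda>t. polar_r F t \<theta>) r"
    by (rule deriv_cong_ev[OF eventually_mono[OF ev] refl]) (rule pr)
  also have "\<dots> = polar_rr F r \<theta>" by (rule DERIV_imp_deriv) (use derivs(3) r in auto)
  finally show "partial_r (partial_r (polar F)) r \<theta> = polar_rr F r \<theta>" by (simp add: partial_r_def)
  have "deriv (\<lambda>t. partial_theta (polar F) t \<theta>) r = deriv (\<lambda>t. polar_t F t \<theta>) r"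
    by (rule deriv_cong_ev[OF eventually_mono[OF ev] refl]) (rule pt)
  also have "\<dots> = polar_tr F r \<theta>" by (rule DERIV_imp_deriv) (use derivs(4) r in auto)
  finally show "partial_r (partial_theta (polar F)) r \<theta> = polar_tr F r \<theta>"
    by (simp add: partial_r_def)
  have "deriv (\<lambda>t. partial_theta (polar F) r t) \<theta> = deriv (\<lambda>t. polar_t F r t) \<theta>"
    using pt[OF r] by simp
  also have "\<dots> = polar_tt F r \<theta>" by (rule DERIV_imp_deriv) (use derivs(5) r in auto)
  finally show "partial_theta (partial_theta (polar F)) r \<theta> = polar_tt F r \<theta>"
    by (simp add: partial_theta_def)
qed

definition density :: "real \<Rightarrow> real \<Rightarrow> real" where
  "density r \<theta> = ((polar_rr F r \<theta>)\<^sup>2 + 2 * (polar_t F r \<theta> / r\<^sup>2 - polar_tr F r \<theta> / r)\<^sup>2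
      + (polar_tt F r \<theta> / r\<^sup>2 + polar_r F r \<theta> / r)\<^sup>2) * r"

lemma BL_energy_eq:
  "BL_energy (polar F) = (\<integral>\<^sup>+r\<in>{0<..}. (\<integral>\<^sup>+\<theta>\<in>{-pi..pi}. ennreal (density r \<theta>) \<partial>lborel) \<partial>lborel)"
  unfolding BL_energy_def density_def
  by (intro nn_integral_cong) (auto simp: indicator_def partials)

text \<open>Bessel's inequality for each of the three squares of the density at fixed r.\<close>

lemma mode_energy_sum_le:
  assumes r: "r > 0" and J: "finite J"
  shows "(\<Sum>k\<in>J. mode_energy ((of_int k)\<^sup>2) (md k) (md1 k) (md2 k) r) \<le> integral {-pi..pi} (density r)"
proof -
  have rA: "r \<in> {0<..}" using r by simp
  note c = slice[OF rA]
  define B where "B = (\<lambda>\<theta>. (1 / r\<^sup>2) * polar_t F r \<theta> + (- 1 / r) * polar_tr F r \<theta>)"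
  define D where "D = (\<lambda>\<theta>. (1 / r\<^sup>2) * polar_tt F r \<theta> + (1 / r) * polar_r F r \<theta>)"
  have cB: "continuous_on {-pi..pi} B" and cD: "continuous_on {-pi..pi} D"
    unfolding B_def D_def by (intro continuous_intros c)+
  have hB: "hcoeff (- k) B = of_int k * (md k r / r\<^sup>2 - md1 k r / r)" for k
    unfolding B_def using rA
    by (simp only: hcoeff_add hcoeff_cmult continuous_intros c hcoeff_polar_t hcoeff_polar_tr)
       (simp add: field_simps)
  have hD: "hcoeff k D = md1 k r / r - (of_int k)\<^sup>2 * md k r / r\<^sup>2" for k
    unfolding D_def using rA
    by (simp only: hcoeff_add hcoeff_cmult continuous_intros c hcoeff_polar_tt)
       (simp add: polar_mode_r_def)
  have "(\<Sum>k\<in>J. mode_energy ((of_int k)\<^sup>2) (md k) (md1 k) (md2 k) r) =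
      r * ((\<Sum>k\<in>J. (hcoeff k (polar_rr F r))\<^sup>2) + 2 * (\<Sum>k\<in>J. (hcoeff (- k) B)\<^sup>2) + (\<Sum>k\<in>J. (hcoeff k D)\<^sup>2))"
    unfolding hB hD mode_energy_def polar_mode_rr_def[symmetric]
    by (simp add: sum.distrib sum_distrib_left power_mult_distrib distrib_left mult.assoc mult.left_commute)
  also have "\<dots> \<le> r * (integral {-pi..pi} (\<lambda>\<theta>. (polar_rr F r \<theta>)\<^sup>2) + 2 * integral {-pi..pi} (\<lambda>\<theta>. (B \<theta>)\<^sup>2)
      + integral {-pi..pi} (\<lambda>\<theta>. (D \<theta>)\<^sup>2))"
  proof -
    \<comment> \<open>The mixed term involves one angular derivative, so the mode k of F sits at the
      index -k of \<open>B\<close>; the index set is reflected.\<close>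
    have "(\<Sum>k\<in>J. (hcoeff (- k) B)\<^sup>2) = (\<Sum>k\<in>uminus ` J. (hcoeff k B)\<^sup>2)"
      by (subst sum.reindex) (auto simp: inj_on_def)
    also have "\<dots> \<le> integral {-pi..pi} (\<lambda>\<theta>. (B \<theta>)\<^sup>2)" by (rule bessel_hartley[OF cB]) (use J in simp)
    finally show ?thesis
      using bessel_hartley[OF c(4) J] bessel_hartley[OF cD J] r
      by (intro mult_left_mono add_mono) auto
  qed
  also have "\<dots> = integral {-pi..pi} (\<lambda>\<theta>. r * ((polar_rr F r \<theta>)\<^sup>2 + 2 * (B \<theta>)\<^sup>2 + (D \<theta>)\<^sup>2))"
    by (subst integral_mult_right, subst integral_add, (intro integrable_continuous_real continuous_intros c cB cD)+,
        subst integral_add, (intro integrable_continuous_real continuous_intros c cB cD)+) simp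
  also have "\<dots> = integral {-pi..pi} (density r)"
    by (rule arg_cong[where f="integral _"]) (auto simp: density_def B_def D_def mult.commute)
  finally show ?thesis .
qed

lemma continuous_md_energy:
  "continuous_on {0<..} (mode_energy \<kappa> (md k) (md1 k) (md2 k))"
  by (intro continuous_on_mode_energy md_continuous order_refl)

lemma modal_energy_sum_le:
  assumes J: "finite J"
  shows "(\<Sum>k\<in>J. modal_energy F k) \<le> BL_energy (polar F)"
proof -
  let ?e = "\<lambda>k. mode_energy ((of_int k)\<^sup>2) (md k) (md1 k) (md2 k)"
  have meas: "(\<lambda>r. ennreal (?e k r) * indicator {0<..} r) \<in> borel_measurable lborel" for k
  proof -
    have "(\<lambda>r. indicator {0<..} r *\<^sub>R ?e k r) \<in> borel_measurable borel"
      by (intro borel_measurable_continuous_on_indicator continuous_md_energy) auto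
    then have "(\<lambda>r. ennreal (indicator {0<..} r *\<^sub>R ?e k r)) \<in> borel_measurable lborel" by measurable
    moreover have "ennreal (indicator {0<..} r *\<^sub>R ?e k r) = ennreal (?e k r) * indicator {0<..} r" for r
      by (simp add: indicator_def)
    ultimately show ?thesis by simp
  qed
  have "(\<Sum>k\<in>J. modal_energy F k) = (\<integral>\<^sup>+r. (\<Sum>k\<in>J. ennreal (?e k r) * indicator {0<..} r) \<partial>lborel)"
    unfolding modal_energy_def by (subst nn_integral_sum) (use meas in simp_all)
  also have "\<dots> \<le> BL_energy (polar F)"
    unfolding BL_energy_eq
  proof (intro nn_integral_mono)
    fix r :: real
    show "(\<Sum>k\<in>J. ennreal (?e k r) * indicator {0<..} r) \<le>
        (\<integral>\<^sup>+\<theta>\<in>{-pi..pi}. ennreal (density r \<theta>) \<partial>lborel) * indicator {0<..} r"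
    proof (cases "r > 0")
      case True
      have cd: "continuous_on {-pi..pi} (density r)"
        unfolding density_def using True by (intro continuous_intros slice) auto
      have "(\<Sum>k\<in>J. ennreal (?e k r)) = ennreal (\<Sum>k\<in>J. ?e k r)"
        using True by (intro sum_ennreal mode_energy_nonneg) auto
      also have "\<dots> \<le> ennreal (integral {-pi..pi} (density r))"
        by (rule ennreal_leI[OF mode_energy_sum_le[OF True J]])
      also have "\<dots> = (\<integral>\<^sup>+\<theta>\<in>{-pi..pi}. ennreal (density r \<theta>) \<partial>lborel)"
        using True by (intro nn_integral_continuous_Icc[symmetric] cd) (auto simp: density_def)
      finally show ?thesis using True by simp
    qed simp
  qed
  finally show ?thesis .
qed

lemma
  assumes fin: "BL_energy (polar F) < \<infinity>"
  shows mode_energy_integral_le: "0 < a \<Longrightarrow> a \<le> b \<Longrightarrow>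
      integral {a..b} (mode_energy ((of_int k)\<^sup>2) (md k) (md1 k) (md2 k)) \<le> enn2real (modal_energy F k)"
    and modal_energy_real_sum_le: "finite J \<Longrightarrow>
      (\<Sum>k\<in>J. enn2real (modal_energy F k)) \<le> enn2real (BL_energy (polar F))"
proof -
  have fk: "modal_energy F k < top" for k
    using modal_energy_sum_le[of "{k}"] fin by (simp add: order_le_less_trans)
  show "integral {a..b} (mode_energy ((of_int k)\<^sup>2) (md k) (md1 k) (md2 k)) \<le> enn2real (modal_energy F k)"
    if ab: "0 < a" "a \<le> b"
  proof -
    let ?e = "mode_energy ((of_int k)\<^sup>2) (md k) (md1 k) (md2 k)"
    have sub: "{a..b} \<subseteq> {0<..}" using ab by auto
    have c: "continuous_on {a..b} ?e" using continuous_md_energy sub continuous_on_subset by blast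
    have nn: "0 \<le> ?e r" if "r \<in> {a..b}" for r using that ab by (intro mode_energy_nonneg) auto
    have "ennreal (integral {a..b} ?e) = (\<integral>\<^sup>+r\<in>{a..b}. ennreal (?e r) \<partial>lborel)"
      by (rule nn_integral_continuous_Icc[OF c nn, symmetric])
    also have "\<dots> \<le> modal_energy F k"
      unfolding modal_energy_def using sub by (intro nn_integral_mono) (auto simp: indicator_def)
    also have "\<dots> = ennreal (enn2real (modal_energy F k))" using fk by simp
    finally show ?thesis by simp
  qed
  show "(\<Sum>k\<in>J. enn2real (modal_energy F k)) \<le> enn2real (BL_energy (polar F))" if J: "finite J"
  proof -
    have "ennreal (\<Sum>k\<in>J. enn2real (modal_energy F k)) = (\<Sum>k\<in>J. ennreal (enn2real (modal_energy F k)))"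
      by (rule sum_ennreal[symmetric]) simp
    also have "\<dots> = (\<Sum>k\<in>J. modal_energy F k)" using fk by simp
    also have "\<dots> \<le> BL_energy (polar F)" by (rule modal_energy_sum_le[OF J])
    also have "\<dots> = ennreal (enn2real (BL_energy (polar F)))" using fin by simp
    finally show ?thesis by simp
  qed
qed

end

section \<open>Biharmonicity off the circles and the limit at the origin\<close>

lemma in_some_gap:
  fixes r :: "nat \<Rightarrow> real"
  assumes "1 \<le> n" "x \<notin> r ` {1..n}"
  shows "x < r 1 \<or> (\<exists>j\<in>{1..n-1}. r j < x \<and> x < r (j + 1)) \<or> r n < x"
  using assms
proof (induction n rule: dec_induct)
  case base then show ?case by auto
next
  case (step n)
  have "x \<notin> r ` {1..n}" using step.prems by auto
  from step.IH[OF this] show ?case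
  proof (elim disjE)
    assume "r n < x"
    moreover have "x \<noteq> r (Suc n)" using step.prems by auto
    ultimately show ?thesis using step.hyps by (cases "x < r (Suc n)") auto
  qed force+
qed

lemma BL_polyspline_biharmonic:
  assumes S: "BL_polyspline n r S" and n: "1 \<le> n"
  shows "biharmonic_on {p. norm p \<in> {0<..} - r ` {1..n}} S"
proof -
  have local: "\<exists>V. open V \<and> p \<in> V \<and> biharmonic_on V S" if p: "norm p \<in> {0<..} - r ` {1..n}" for p
  proof -
    have op: "open {p :: real \<times> real. a < norm p}" "open {p :: real \<times> real. norm p < b}" for a b
      by (auto intro!: open_Collect_less continuous_intros)
    have op': "open {p :: real \<times> real. a < norm p \<and> norm p < b}" for a b
      using open_Int[OF op] by (simp add: Collect_conj_eq)
    from p have "norm p > 0" "norm p \<notin> r ` {1..n}" by auto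
    from in_some_gap[OF n this(2)] this(1) S op op' show ?thesis
      unfolding BL_polyspline_def by blast
  qed
  show ?thesis
    unfolding biharmonic_on_def
  proof
    show "Ck_on 4 {p. norm p \<in> {0<..} - r ` {1..n}} S"
    proof (rule Ck_on_local)
      fix p :: "real \<times> real" assume "p \<in> {p. norm p \<in> {0<..} - r ` {1..n}}"
      then obtain V where "open V" "p \<in> V" "biharmonic_on V S" using local[of p] by blast
      then show "\<exists>V. open V \<and> p \<in> V \<and> Ck_on 4 V S" unfolding biharmonic_on_def by blast
    qed
    show "\<forall>p\<in>{p. norm p \<in> {0<..} - r ` {1..n}}. laplacian (laplacian S) p = 0"
    proof
      fix p :: "real \<times> real" assume "p \<in> {p. norm p \<in> {0<..} - r ` {1..n}}"
      then obtain V where "p \<in> V" "biharmonic_on V S" using local[of p] by blast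
      then show "laplacian (laplacian S) p = 0" unfolding biharmonic_on_def by blast
    qed
  qed
qed

text \<open>At r = 0 the polar form is constant in the angle, so the limit vanishes for every k
  except 0.\<close>

lemma hcoeff_limit_at_zero:
  assumes "continuous_on UNIV F"
  shows "((\<lambda>r. polar_mode F k r) \<longlongrightarrow> hcoeff k (\<lambda>_. F 0)) (at_right 0)"
proof -
  have "continuous_on (UNIV \<times> UNIV) (\<lambda>(r, \<theta>). polar F r \<theta>)"
    unfolding polar_def split_beta
    by (rule continuous_on_compose2[OF assms]) (auto intro!: continuous_intros)
  then have "continuous_on UNIV (polar_mode F k)"
    unfolding polar_mode_def by (rule hcoeff_continuous)
  then have "isCont (polar_mode F k) 0" by (simp add: continuous_on_eq_continuous_at)
  moreover have "polar F 0 = (\<lambda>_. F 0)" by (auto simp: polar_def zero_prod_def)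
  then have "polar_mode F k 0 = hcoeff k (\<lambda>_. F 0)" by (simp add: polar_mode_def)
  ultimately show ?thesis
    by (metis filterlim_at_split isCont_def)
qed

section \<open>Modes of a polyspline\<close>

lemma Ck_on_subset: "Ck_on k U F \<Longrightarrow> V \<subseteq> U \<Longrightarrow> Ck_on k V F"
proof (induction k arbitrary: F)
  case 0 then show ?case by (simp add: continuous_on_subset)
next
  case (Suc k)
  note * = Suc.prems(1)[unfolded Ck_on.simps(2)[of k]]
  have "continuous_on V F" using * Suc.prems(2) continuous_on_subset by blast
  with * show ?case unfolding Ck_on.simps(2)[of k] using Suc.prems(2) Suc.IH by blast
qed

text \<open>The mean of a harmonic function over the circle of radius r has the form c1 + c2 ln r
  off the origin, and smoothness at the origin forces c2 = 0. This is applied to the Laplacian of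
  S.\<close>

lemma laplacian_mode_flux_zero:
  assumes S: "biharmonic_on {p. norm p < R} S" and r: "0 < r" "r < R"
  shows "polar_mode_r (laplacian S) 0 r = 0"
proof -
  let ?D = "{p :: real \<times> real. norm p < R}"
  let ?G = "laplacian S"
  have "open ?D" by (auto intro!: open_Collect_less continuous_intros)
  moreover have "Ck_on (Suc (Suc 2)) ?D S" using S unfolding biharmonic_on_def by (simp add: eval_nat_numeral)
  ultimately have G: "Ck_on 2 ?D ?G" by (rule Ck_on_laplacian)
  interpret G: C2_annular "{0<..<R}" ?G
    by standard (use G in \<open>auto intro: Ck_on_subset\<close>)
  have zero: "polar_mode_rr ?G 0 t + polar_mode_r ?G 0 t / t = 0" if t: "t \<in> {0<..<R}" for t
  proof -
    have "polar (laplacian ?G) t = (\<lambda>_. 0)"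
    proof
      fix \<theta>
      have "(t * cos \<theta>, t * sin \<theta>) \<in> ?D" using norm_polar_point[of t \<theta>] t by auto
      then show "polar (laplacian ?G) t \<theta> = 0" using S unfolding biharmonic_on_def polar_def by blast
    qed
    then have "hcoeff 0 (polar (laplacian ?G) t) = 0" by (simp add: hcoeff_const)
    with G.hcoeff_laplacian[OF t, of 0] show ?thesis by simp
  qed
  have "((\<lambda>t. t * polar_mode_r ?G 0 t) has_real_derivative 0) (at t within {0<..<R})" if t: "t \<in> {0<..<R}" for t
  proof -
    have "((\<lambda>t. t * polar_mode_r ?G 0 t) has_real_derivative 1 * polar_mode_r ?G 0 t + polar_mode_rr ?G 0 t * t) (at t)"
      by (rule DERIV_mult[OF DERIV_ident G.md_deriv(2)[OF t]])
    moreover have "1 * polar_mode_r ?G 0 t + polar_mode_rr ?G 0 t * t = 0"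
      using zero[OF t] t by (simp add: field_simps)
    ultimately show ?thesis by (simp add: has_field_derivative_at_within)
  qed
  then obtain c where c: "\<And>t. t \<in> {0<..<R} \<Longrightarrow> t * polar_mode_r ?G 0 t = c"
    using has_field_derivative_zero_constant[of "{0<..<R}" "\<lambda>t. t * polar_mode_r ?G 0 t"] by auto
  \<comment> \<open>The expression \<open>polar_r\<close> makes sense for negative radii too, so the
    mode is continuous in a full neighbourhood of 0. Hence its product with t tends to 0, which
    determines the constant c.\<close>
  have "continuous_on ({-R<..<R} \<times> UNIV) (\<lambda>(t, \<theta>). polar_r ?G t \<theta>)"
  proof -
    have cont: "continuous_on ({-R<..<R} \<times> UNIV) (\<lambda>z. polar H (fst z) (snd z))" if "continuous_on ?D H" for H
      unfolding polar_def
    proof (rule continuous_on_compose2[OF that])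
      have "norm (t * cos \<theta>, t * sin \<theta>) = \<bar>t\<bar>" for t \<theta> :: real
        using norm_polar_point[of "\<bar>t\<bar>" \<theta>] by (simp add: norm_Pair power_mult_distrib)
      then show "(\<lambda>z. (fst z * cos (snd z), fst z * sin (snd z))) ` ({-R<..<R} \<times> UNIV) \<subseteq> ?D" by auto
    qed (intro continuous_intros)
    have "continuous_on ?D (partial_x ?G)" "continuous_on ?D (partial_y ?G)"
      using G by (auto simp: numeral_2_eq_2)
    from this[THEN cont] show ?thesis
      unfolding split_beta polar_r_def by (intro continuous_intros)
  qed
  then have "continuous_on {-R<..<R} (polar_mode_r ?G 0)"
    unfolding polar_mode_r_def by (rule hcoeff_continuous)
  then have "isCont (polar_mode_r ?G 0) 0" using r by (simp add: continuous_on_eq_continuous_at)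
  then have "((\<lambda>t. t * polar_mode_r ?G 0 t) \<longlongrightarrow> 0 * polar_mode_r ?G 0 0) (at_right 0)"
    unfolding isCont_def by (intro tendsto_mult tendsto_ident_at) (simp add: filterlim_at_split)
  moreover have "((\<lambda>t. t * polar_mode_r ?G 0 t) \<longlongrightarrow> c) (at_right 0)"
  proof (rule tendsto_eventually)
    show "\<forall>\<^sub>F t in at_right 0. t * polar_mode_r ?G 0 t = c"
      using c r by (auto simp: eventually_at_right_field intro!: exI[of _ R])
  qed
  ultimately have "c = 0" using tendsto_unique[of "at_right (0::real)"] by fastforce
  with c[of r] r show ?thesis by simp
qed

text \<open>Realizes \<open>spline_mode\<close> with v the mode of S and u the mode of F - S; then u
  + v is the mode of F, whose energy is the bound.\<close>

lemma polyspline_mode_energy_le: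
  fixes F S :: "real \<times> real \<Rightarrow> real" and r :: "nat \<Rightarrow> real"
  assumes n: "1 \<le> n" and rpos: "\<And>j. j \<in> {1..n} \<Longrightarrow> 0 < r j"
    and F: "Ck_on 2 (UNIV - {0}) F" "continuous_on UNIV F" "BL_energy (polar F) < \<infinity>"
    and S: "BL_polyspline n r S"
    and eq: "\<forall>j\<in>{1..n}. \<forall>\<theta>\<in>{-pi..pi}. polar S (r j) \<theta> = polar F (r j) \<theta>"
    and zero: "S 0 = F 0 \<or> biharmonic_on {p. norm p < r 1} S"
    and xy: "0 < x" "x \<le> y"
  shows "integral {x..y} (mode_energy ((of_int k)\<^sup>2) (\<lambda>t. polar_mode F k t - polar_mode S k t)
      (\<lambda>t. polar_mode_r F k t - polar_mode_r S k t) (\<lambda>t. polar_mode_rr F k t - polar_mode_rr S k t))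
    \<le> enn2real (modal_energy F k)"
proof -
  have S': "Ck_on 2 (UNIV - {0}) S" "continuous_on UNIV S" "BL_energy (polar S) < \<infinity>"
    using S unfolding BL_polyspline_def by blast+
  interpret F: C2_punctured F by standard (rule F(1))
  interpret S: C2_punctured S by standard (rule S'(1))
  define C where "C = r ` {1..n}"
  define A where "A = {0<..} - C"
  define \<kappa> :: real where "\<kappa> = (of_int k)\<^sup>2"
  have finC: "finite C" and posC: "C \<subseteq> {0<..}" using rpos by (auto simp: C_def)
  have A: "open A" "A \<subseteq> {0<..}" unfolding A_def using finC by (auto intro!: open_Diff finite_imp_closed)
  have bi: "biharmonic_on {p. norm p \<in> A} S"
    using BL_polyspline_biharmonic[OF S n] by (simp add: A_def C_def)
  let ?V = "{p :: real \<times> real. norm p \<in> A}"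
  let ?G = "laplacian S"
  have S4: "Ck_on (Suc (Suc 2)) ?V S" using bi unfolding biharmonic_on_def by (simp add: eval_nat_numeral)
  interpret SA: C2_annular A S
    by standard (use A S4 Ck_on_mono[of "Suc (Suc 2)" ?V S 2] in auto)
  have G2: "Ck_on 2 ?V ?G" by (rule Ck_on_laplacian[OF SA.openU S4])
  interpret G: C2_annular A ?G by standard (use A G2 in auto)
  let ?v = "polar_mode S k" and ?v1 = "polar_mode_r S k" and ?v2 = "polar_mode_rr S k"
  let ?w = "polar_mode ?G k" and ?w1 = "polar_mode_r ?G k" and ?w2 = "polar_mode_rr ?G k"
  have w: "?w t = ?v2 t + ?v1 t / t - \<kappa> * ?v t / t\<^sup>2" if "t \<in> A" for t
    using SA.hcoeff_laplacian[OF that, of k] by (simp add: polar_mode_def \<kappa>_def)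
  have w2: "?w2 t + ?w1 t / t - \<kappa> * ?w t / t\<^sup>2 = 0" if t: "t \<in> A" for t
  proof -
    have "polar (laplacian ?G) t = (\<lambda>_. 0)"
      using SA.point[OF t] bi unfolding biharmonic_on_def polar_def by blast
    then have "hcoeff k (polar (laplacian ?G) t) = 0" by (simp add: hcoeff_const)
    with G.hcoeff_laplacian[OF t, of k] show ?thesis by (simp add: \<kappa>_def)
  qed
  \<comment> \<open>The momentum M expressed through the mode w of the Laplacian: the third
    derivative of v occurs only inside w', and w is twice differentiable off the circles.\<close>
  define M where "M = (\<lambda>t. - t * ?w1 t - \<kappa> * (?v t / t - ?v1 t) / t)"
  define l where "l = hcoeff k (\<lambda>_. F 0) - hcoeff k (\<lambda>_. S 0)"
  interpret spline_mode \<kappa> C ?v ?v1 ?v2 M "\<lambda>t. polar_mode F k t - ?v t" "\<lambda>t. polar_mode_r F k t - ?v1 t"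
    "\<lambda>t. polar_mode_rr F k t - ?v2 t" "enn2real (modal_energy S k)" "enn2real (modal_energy F k)" l
  proof
    show "0 \<le> \<kappa>" by (simp add: \<kappa>_def)
    show "finite C" "C \<subseteq> {0<..}" by fact+
    show "continuous_on {0<..} ?v2" by (rule S.md_continuous)
    show "continuous_on {0<..} (\<lambda>t. polar_mode_rr F k t - ?v2 t)"
      by (intro continuous_intros F.md_continuous S.md_continuous)
    show "(?v has_real_derivative ?v1 t) (at t)" "(?v1 has_real_derivative ?v2 t) (at t)" if "t > 0" for t
      using S.md_deriv that by auto
    show "((\<lambda>t. polar_mode F k t - ?v t) has_real_derivative polar_mode_r F k t - ?v1 t) (at t)"
      "((\<lambda>t. polar_mode_r F k t - ?v1 t) has_real_derivative polar_mode_rr F k t - ?v2 t) (at t)" if "t > 0" for t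
      using S.md_deriv F.md_deriv that by (auto intro!: DERIV_diff)
    fix t :: real assume t: "t > 0" "t \<notin> C"
    then have tA: "t \<in> A" by (simp add: A_def)
    note dv = SA.md_deriv[OF tA, of k] and dw = G.md_deriv[OF tA, of k]
    have "t \<noteq> 0" using t by simp
    note dq = DERIV_divide[OF dv(1) DERIV_ident this]
    show "((\<lambda>t. t * ?v2 t) has_real_derivative
        ?v1 t / t - \<kappa> * ?v t / t\<^sup>2 - 2 * \<kappa> * (?v t / t - ?v1 t) / t - M t) (at t)"
    proof (rule has_field_derivative_transform_within_open[OF _ A(1) tA])
      \<comment> \<open>Solving the formula for w for t v'' gives an expression in w, v' and v whose
        derivative is known.\<close>
      show "((\<lambda>t. t * ?w t - ?v1 t + \<kappa> * (?v t / t)) has_real_derivative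
        ?v1 t / t - \<kappa> * ?v t / t\<^sup>2 - 2 * \<kappa> * (?v t / t - ?v1 t) / t - M t) (at t)"
        by (rule DERIV_cong[OF DERIV_add[OF DERIV_diff[OF DERIV_mult[OF DERIV_ident dw(1)] dv(2)] DERIV_cmult[OF dq]]])
           (use t in \<open>auto simp: M_def w[OF tA] field_simps power2_eq_square\<close>)
      show "s * ?w s - ?v1 s + \<kappa> * (?v s / s) = s * ?v2 s" if "s \<in> A" for s
      proof -
        have "s \<noteq> 0" using that A by auto
        then show ?thesis by (simp add: w[OF that] field_simps power2_eq_square)
      qed
    qed
    \<comment> \<open>Here the biharmonic equation eliminates w'' from M', leaving only v and
      v'.\<close>
    have "?w2 t = \<kappa> * ?w t / t\<^sup>2 - ?w1 t / t" using w2[OF tA] by simp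
    then have w2': "t * ?w2 t = \<kappa> * ?w t / t - ?w1 t" using t by (simp add: field_simps power2_eq_square)
    show "(M has_real_derivative 2 * \<kappa> * (?v t / t - ?v1 t) / t\<^sup>2 - \<kappa> * (?v1 t / t - \<kappa> * ?v t / t\<^sup>2) / t) (at t)"
      unfolding M_def
      by (rule DERIV_cong[OF DERIV_diff[OF DERIV_mult[OF DERIV_minus[OF DERIV_ident] dw(2)]
            DERIV_divide[OF DERIV_cmult[OF DERIV_diff[OF dq dv(2)]] DERIV_ident \<open>t \<noteq> 0\<close>]]])
         (use t in \<open>simp add: w2' w[OF tA] field_simps power2_eq_square\<close>)
  next
    show "polar_mode F k c - ?v c = 0" if "c \<in> C" for c
    proof -
      have "hcoeff k (polar F c) = hcoeff k (polar S c)"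
        unfolding hcoeff_def using that eq by (intro integral_cong) (auto simp: C_def)
      then show ?thesis by (simp add: polar_mode_def)
    qed
    show "integral {a..b} (mode_energy \<kappa> ?v ?v1 ?v2) \<le> enn2real (modal_energy S k)" if "0 < a" "a \<le> b" for a b
      using S.mode_energy_integral_le[OF S'(3) that] by (simp add: \<kappa>_def)
    show "integral {a..b} (mode_energy \<kappa> (\<lambda>t. polar_mode F k t - ?v t + ?v t)
       (\<lambda>t. polar_mode_r F k t - ?v1 t + ?v1 t) (\<lambda>t. polar_mode_rr F k t - ?v2 t + ?v2 t)) \<le> enn2real (modal_energy F k)"
      if "0 < a" "a \<le> b" for a b
      using F.mode_energy_integral_le[OF F(3) that] by (simp add: \<kappa>_def)
    show "((\<lambda>t. polar_mode F k t - ?v t) \<longlongrightarrow> l) (at_right 0)"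
      unfolding l_def by (intro tendsto_diff hcoeff_limit_at_zero F(2) S'(2))
    show "l = 0 \<or> (\<exists>\<delta>>0. \<forall>t. 0 < t \<and> t < \<delta> \<longrightarrow> M t = 0)"
    \<comment> \<open>Outside this case l = 0. Inside it \<kappa> = 0, so M is -t w', the flux that
      vanishes near the origin.\<close>
    proof (cases "k = 0 \<and> S 0 \<noteq> F 0")
      case False then show ?thesis by (auto simp: l_def hcoeff_const)
    next
      case True
      then have "biharmonic_on {p. norm p < r 1} S" using zero by simp
      then have "M t = 0" if "0 < t" "t < r 1" for t
        using laplacian_mode_flux_zero[of "r 1" S t] that True by (simp add: M_def \<kappa>_def)
      then show ?thesis using rpos[of 1] n by auto
    qed
  qed
  show ?thesis using energy_le[OF xy] by (simp add: \<kappa>_def)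
qed

section \<open>From modes back to functions\<close>

text \<open>Symmetric partial sums increase to the Parseval value at each radius; monotone
  convergence carries the bound on finite sums to the radial integral.\<close>

lemma parseval_integral_le:
  fixes f :: "real \<Rightarrow> real \<Rightarrow> real"
  assumes x: "0 \<le> x" and c: "continuous_on ({x..y} \<times> UNIV) (\<lambda>(t, \<theta>). f t \<theta>)"
    and per: "\<And>t \<theta>. t \<in> {x..y} \<Longrightarrow> f t (\<theta> + 2 * pi) = f t \<theta>"
    and B: "\<And>J. finite J \<Longrightarrow> (\<Sum>k\<in>J. integral {x..y} (\<lambda>t. t * (hcoeff k (f t))\<^sup>2)) \<le> B"
  shows "integral {x..y} (\<lambda>t. t * integral {-pi..pi} (\<lambda>\<theta>. (f t \<theta>)\<^sup>2)) \<le> B"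
proof -
  define g where "g = (\<lambda>n t. \<Sum>k\<in>{- int n..int n}. t * (hcoeff k (f t))\<^sup>2)"
  have ch: "continuous_on {x..y} (\<lambda>t. hcoeff k (f t))" for k by (rule hcoeff_continuous[OF c])
  have ci: "(\<lambda>t. t * (hcoeff k (f t))\<^sup>2) integrable_on {x..y}" for k
    by (intro integrable_continuous_real continuous_intros ch)
  have gB: "integral {x..y} (g n) \<le> B" for n
    unfolding g_def by (subst integral_sum) (use ci B in auto)
  have gi: "g n integrable_on {x..y}" for n
    unfolding g_def by (intro integrable_sum ci) auto
  have g0: "0 \<le> integral {x..y} (g n)" for n
    using x by (intro integral_nonneg gi) (auto simp: g_def intro!: sum_nonneg)
  have "(\<lambda>t. t * integral {-pi..pi} (\<lambda>\<theta>. (f t \<theta>)\<^sup>2)) integrable_on {x..y} \<and>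
    (\<lambda>n. integral {x..y} (g n)) \<longlonglongrightarrow> integral {x..y} (\<lambda>t. t * integral {-pi..pi} (\<lambda>\<theta>. (f t \<theta>)\<^sup>2))"
  proof (rule monotone_convergence_increasing[OF gi])
    show "g n t \<le> g (Suc n) t" if "t \<in> {x..y}" for n t
      unfolding g_def using that x by (intro sum_mono2) auto
    show "(\<lambda>n. g n t) \<longlonglongrightarrow> t * integral {-pi..pi} (\<lambda>\<theta>. (f t \<theta>)\<^sup>2)" if t: "t \<in> {x..y}" for t
      unfolding g_def sum_distrib_left[symmetric]
      by (intro tendsto_intros parseval_hartley continuous_on_slice[OF c t] per[OF t])
    show "bounded (range (\<lambda>n. integral {x..y} (g n)))"
      unfolding bounded_iff using gB g0 by (intro exI[of _ B]) auto
  qed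
  then have "(\<lambda>n. integral {x..y} (g n)) \<longlonglongrightarrow> integral {x..y} (\<lambda>t. t * integral {-pi..pi} (\<lambda>\<theta>. (f t \<theta>)\<^sup>2))"
    by (rule conjunct2)
  then show ?thesis by (rule LIMSEQ_le_const2) (use gB in blast)
qed

lemma LBINT_Icc_eq_integral:
  fixes f :: "real \<Rightarrow> real"
  assumes "continuous_on {a..b} f"
  shows "(LBINT x:{a..b}. f x) = integral {a..b} f"
  by (rule set_borel_integral_eq_integral borel_integrable_atLeastAtMost' assms)+

section \<open>The error estimate\<close>

text \<open>The Poincare estimates are unweighted. On [r 1, r n] the weight t is at most r n in the
  error and at least r 1 in the energy, which produces the quotient
  \<open>r n / r 1\<close>.\<close>

lemma mode_integral_le:
  fixes r :: "nat \<Rightarrow> real" and u u1 u2 :: "real \<Rightarrow> real"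
  assumes r: "\<And>j. j \<in> {1..<n} \<Longrightarrow> r j < r (Suc j) \<and> r (Suc j) - r j \<le> h"
    and n: "1 \<le> n" and pos: "0 < r 1" "r 1 \<le> r n"
    and du: "\<And>t. t > 0 \<Longrightarrow> (u has_real_derivative u1 t) (at t)"
    and du1: "\<And>t. t > 0 \<Longrightarrow> (u1 has_real_derivative u2 t) (at t)"
    and cu2: "continuous_on {0<..} u2"
    and z: "\<And>j. j \<in> {1..n} \<Longrightarrow> u (r j) = 0"
    and \<kappa>: "0 \<le> \<kappa>" and B: "integral {r 1..r n} (mode_energy \<kappa> u u1 u2) \<le> B"
  shows "integral {r 1..r n} (\<lambda>t. t * (u1 t)\<^sup>2) \<le> r n / r 1 * h\<^sup>2 * B"
    and "integral {r 1..r n} (\<lambda>t. t * (u t)\<^sup>2) \<le> r n / r 1 * (h ^ 4 / 4) * B"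
proof -
  define x y where "x = r 1" and "y = r n"
  have xy: "0 < x" "x \<le> y" using pos by (simp_all add: x_def y_def)
  have tpos: "t > 0" if "t \<in> {x..y}" for t using that xy by simp
  have cu: "continuous_on {x..y} u" "continuous_on {x..y} u1"
    by (rule continuous_at_imp_continuous_on, rule ballI, rule DERIV_isCont, (rule du du1), erule tpos)+
  have cu2': "continuous_on {x..y} u2" by (rule continuous_on_subset[OF cu2]) (use xy in auto)
  have P: "integral {x..y} (\<lambda>t. (u1 t)\<^sup>2) \<le> h\<^sup>2 * integral {x..y} (\<lambda>t. (u2 t)\<^sup>2) \<and>
     4 * integral {x..y} (\<lambda>t. (u t)\<^sup>2) \<le> h ^ 4 * integral {x..y} (\<lambda>t. (u2 t)\<^sup>2)"
    unfolding x_def y_def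
    by (rule poincare_chain[OF r n du du1 cu2'[unfolded x_def y_def] z]) (use tpos in \<open>auto simp: x_def y_def\<close>)
  have "x * integral {x..y} (\<lambda>t. (u2 t)\<^sup>2) = integral {x..y} (\<lambda>t. x * (u2 t)\<^sup>2)" by simp
  also have "\<dots> \<le> integral {x..y} (mode_energy \<kappa> u u1 u2)"
  proof (intro integral_le integrable_continuous_real continuous_intros continuous_on_mode_energy cu cu2')
    fix t assume t: "t \<in> {x..y}"
    have "x * (u2 t)\<^sup>2 \<le> t * (u2 t)\<^sup>2" using t by (intro mult_right_mono) auto
    also have "\<dots> \<le> mode_energy \<kappa> u u1 u2 t"
      unfolding mode_energy_def using tpos[OF t] \<kappa> by (intro mult_left_mono) auto
    finally show "x * (u2 t)\<^sup>2 \<le> mode_energy \<kappa> u u1 u2 t" .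
  qed (use xy in auto)
  also have "\<dots> \<le> B" using B by (simp add: x_def y_def)
  finally have I2: "integral {x..y} (\<lambda>t. (u2 t)\<^sup>2) \<le> B / x" using xy by (simp add: field_simps)
  have weight: "integral {x..y} (\<lambda>t. t * (f t)\<^sup>2) \<le> y * integral {x..y} (\<lambda>t. (f t)\<^sup>2)"
    if "continuous_on {x..y} f" for f :: "real \<Rightarrow> real"
  proof -
    have "integral {x..y} (\<lambda>t. t * (f t)\<^sup>2) \<le> integral {x..y} (\<lambda>t. y * (f t)\<^sup>2)"
      by (intro integral_le integrable_continuous_real continuous_intros that mult_right_mono) auto
    then show ?thesis by simp
  qed
  have "integral {x..y} (\<lambda>t. t * (u1 t)\<^sup>2) \<le> y * (h\<^sup>2 * (B / x))"
  proof -
    have "h\<^sup>2 * integral {x..y} (\<lambda>t. (u2 t)\<^sup>2) \<le> h\<^sup>2 * (B / x)" using I2 by (intro mult_left_mono) auto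
    with conjunct1[OF P] have "integral {x..y} (\<lambda>t. (u1 t)\<^sup>2) \<le> h\<^sup>2 * (B / x)" by simp
    then show ?thesis by (intro order_trans[OF weight[OF cu(2)]] mult_left_mono) (use xy in auto)
  qed
  then show "integral {r 1..r n} (\<lambda>t. t * (u1 t)\<^sup>2) \<le> r n / r 1 * h\<^sup>2 * B"
    by (simp add: x_def y_def mult_ac)
  have "integral {x..y} (\<lambda>t. (u t)\<^sup>2) \<le> h ^ 4 * (B / x) / 4"
  proof -
    have "h ^ 4 * integral {x..y} (\<lambda>t. (u2 t)\<^sup>2) \<le> h ^ 4 * (B / x)" using I2 by (intro mult_left_mono) auto
    with conjunct2[OF P] have "4 * integral {x..y} (\<lambda>t. (u t)\<^sup>2) \<le> h ^ 4 * (B / x)"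
      by (rule order_trans)
    then show ?thesis by (simp only: le_divide_eq_numeral1 mult.commute[of _ 4])
  qed
  then have "integral {x..y} (\<lambda>t. t * (u t)\<^sup>2) \<le> y * (h ^ 4 * (B / x) / 4)"
    by (intro order_trans[OF weight[OF cu(1)]] mult_left_mono) (use xy in auto)
  then show "integral {r 1..r n} (\<lambda>t. t * (u t)\<^sup>2) \<le> r n / r 1 * (h ^ 4 / 4) * B"
    by (simp add: x_def y_def mult_ac)
qed

theorem theorem6:
  fixes n m :: nat and r :: "nat \<Rightarrow> real" and h :: real
    and F S :: "real \<times> real \<Rightarrow> real"
  assumes "n \<ge> 2"
    and "0 < r 1"
    and "\<forall>j\<in>{1..n-1}. r j < r (j + 1)"
    and "h = Max ((\<lambda>j. r (j + 1) - r j) ` {1..n-1})"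
    and "Ck_on 2 (UNIV - {0}) F"
    and "continuous_on UNIV F"
    and "BL_energy (polar F) < \<infinity>"
    and "\<forall>j\<in>{1..n}. polar F (r j) \<in> wiener2"
    and "BL_polyspline n r S"
    and "\<forall>j\<in>{1..n}. \<forall>\<theta>\<in>{-pi..pi}. polar S (r j) \<theta> = polar F (r j) \<theta>"
    and "S 0 = F 0 \<or> biharmonic_on {p. norm p < r 1} S"
    and "m \<in> {0, 1}"
  shows "sqrt (LBINT \<rho>:{r 1..r n}. LBINT \<theta>:{-pi..pi}.
             \<bar>(deriv ^^ m) (\<lambda>t. polar F t \<theta> - polar S t \<theta>) \<rho>\<bar>\<^sup>2 * \<rho>)
         \<le> 2 powi (int m - 1) * sqrt (r n / r 1) * h ^ (2 - m) * BL_norm (polar F)"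
proof -
  have n1: "1 \<le> n" using assms(1) by simp
  have incr: "r j < r (Suc j)" if "j \<in> {1..<n}" for j
  proof -
    have "j \<in> {1..n - 1}" using that by auto
    with assms(3) show ?thesis by force
  qed
  have gap: "r j < r (Suc j) \<and> r (Suc j) - r j \<le> h" if j: "j \<in> {1..<n}" for j
  proof -
    have "j \<in> {1..n - 1}" using j by auto
    then have "r (j + 1) - r j \<le> h" unfolding assms(4) by (intro Max_ge) auto
    with incr[OF j] show ?thesis by simp
  qed
  have ge1: "r 1 \<le> r j" if "1 \<le> j" "j \<le> n" for j
    using that
  proof (induction j rule: dec_induct)
    case (step j) then show ?case using incr[of j] by auto
  qed simp
  have rpos: "0 < r j" if "j \<in> {1..n}" for j using ge1[of j] that assms(2) by auto
  have h0: "0 \<le> h" using gap[of 1] assms(1) by auto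
  define x y where "x = r 1" and "y = r n"
  have xy: "0 < x" "x \<le> y" using assms(2) ge1[of n] n1 by (simp_all add: x_def y_def)
  have S: "Ck_on 2 (UNIV - {0}) S" using assms(9) unfolding BL_polyspline_def by blast
  interpret F: C2_punctured F by standard (rule assms(5))
  interpret S: C2_punctured S by standard (rule S)
  define D where "D = (\<lambda>t \<theta>. if m = 0 then polar F t \<theta> - polar S t \<theta> else polar_r F t \<theta> - polar_r S t \<theta>)"
  \<comment> \<open>The square of 2^(m-1) h^(2-m).\<close>
  define c where "c = (if m = 0 then h ^ 4 / 4 else h\<^sup>2)"
  define E where "E = enn2real (BL_energy (polar F))"
  have deriv: "(deriv ^^ m) (\<lambda>t. polar F t \<theta> - polar S t \<theta>) t = D t \<theta>" if t: "t > 0" for t \<theta>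
  proof (cases "m = 0")
    case False
    then have "m = 1" using assms(12) by simp
    moreover have "deriv (\<lambda>t. polar F t \<theta> - polar S t \<theta>) t = polar_r F t \<theta> - polar_r S t \<theta>"
      by (intro DERIV_imp_deriv DERIV_diff F.derivs S.derivs) (use t in auto)
    ultimately show ?thesis by (simp add: D_def)
  qed (simp add: D_def)
  have sub: "{x..y} \<times> UNIV \<subseteq> {0<..} \<times> (UNIV :: real set)" using xy by auto
  have cD: "continuous_on ({x..y} \<times> UNIV) (\<lambda>(t, \<theta>). D t \<theta>)"
  proof (cases "m = 0")
    case True
    show ?thesis unfolding D_def split_beta using True
      continuous_on_diff[OF F.cont_all(1)[THEN continuous_on_subset, OF sub] S.cont_all(1)[THEN continuous_on_subset, OF sub]]
      by (simp add: split_beta)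
  next
    case False
    then show ?thesis unfolding D_def split_beta using
      continuous_on_diff[OF F.cont_all(2)[THEN continuous_on_subset, OF sub] S.cont_all(2)[THEN continuous_on_subset, OF sub]]
      by (simp add: split_beta)
  qed
  have perD: "D t (\<theta> + 2 * pi) = D t \<theta>" for t \<theta>
    by (simp add: D_def polar_r_def polar_periodic)
  have mode: "integral {x..y} (\<lambda>t. t * (hcoeff k (D t))\<^sup>2) \<le> y / x * c * enn2real (modal_energy F k)" for k
  proof -
    let ?u = "\<lambda>t. polar_mode F k t - polar_mode S k t"
    let ?u1 = "\<lambda>t. polar_mode_r F k t - polar_mode_r S k t"
    let ?u2 = "\<lambda>t. polar_mode_rr F k t - polar_mode_rr S k t"
    have d: "(?u has_real_derivative ?u1 t) (at t)" "(?u1 has_real_derivative ?u2 t) (at t)" if "t > 0" for t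
      using F.md_deriv S.md_deriv that by (auto intro!: DERIV_diff)
    have z: "?u (r j) = 0" if "j \<in> {1..n}" for j
    proof -
      have "hcoeff k (polar F (r j)) = hcoeff k (polar S (r j))"
        unfolding hcoeff_def using that assms(10) by (intro integral_cong) auto
      then show ?thesis by (simp add: polar_mode_def)
    qed
    have B: "integral {r 1..r n} (mode_energy ((of_int k)\<^sup>2) ?u ?u1 ?u2) \<le> enn2real (modal_energy F k)"
      using polyspline_mode_energy_le[OF n1 rpos assms(5-7,9,10,11)] xy by (simp add: x_def y_def)
    have c2: "continuous_on {0<..} ?u2" by (intro continuous_intros F.md_continuous S.md_continuous)
    note bounds = mode_integral_le[OF gap n1 assms(2) xy(2)[unfolded x_def y_def] d c2 z _ B]
    show ?thesis
    proof (cases "m = 0")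
      case True
      have "hcoeff k (D t) = ?u t" if "t \<in> {x..y}" for t
        using that xy True by (simp add: D_def hcoeff_diff F.slice S.slice polar_mode_def)
      then have "integral {x..y} (\<lambda>t. t * (hcoeff k (D t))\<^sup>2) = integral {x..y} (\<lambda>t. t * (?u t)\<^sup>2)"
        by (intro integral_cong) simp
      also have "\<dots> \<le> y / x * c * enn2real (modal_energy F k)"
        unfolding x_def y_def c_def using bounds(2) True by simp
      finally show ?thesis .
    next
      case False
      have "hcoeff k (D t) = ?u1 t" if "t \<in> {x..y}" for t
        using that xy False by (simp add: D_def hcoeff_diff F.slice S.slice polar_mode_r_def)
      then have "integral {x..y} (\<lambda>t. t * (hcoeff k (D t))\<^sup>2) = integral {x..y} (\<lambda>t. t * (?u1 t)\<^sup>2)"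
        by (intro integral_cong) simp
      also have "\<dots> \<le> y / x * c * enn2real (modal_energy F k)"
        unfolding x_def y_def c_def using bounds(1) False by simp
      finally show ?thesis .
    qed
  qed
  have c0: "0 \<le> y / x * c" using xy h0 by (simp add: c_def)
  \<comment> \<open>The constant in \<open>mode\<close> is the same for every frequency, so summing
    only requires that the modal energies add up to at most the energy of F.\<close>
  have total: "integral {x..y} (\<lambda>t. t * integral {-pi..pi} (\<lambda>\<theta>. (D t \<theta>)\<^sup>2)) \<le> y / x * c * E"
  proof (rule parseval_integral_le[OF _ cD perD])
    fix J :: "int set" assume J: "finite J"
    have "(\<Sum>k\<in>J. integral {x..y} (\<lambda>t. t * (hcoeff k (D t))\<^sup>2)) \<le> (\<Sum>k\<in>J. y / x * c * enn2real (modal_energy F k))"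
      by (intro sum_mono mode)
    also have "\<dots> = y / x * c * (\<Sum>k\<in>J. enn2real (modal_energy F k))" by (rule sum_distrib_left[symmetric])
    also have "\<dots> \<le> y / x * c * E"
      unfolding E_def by (intro mult_left_mono F.modal_energy_real_sum_le assms(7) J c0)
    finally show "(\<Sum>k\<in>J. integral {x..y} (\<lambda>t. t * (hcoeff k (D t))\<^sup>2)) \<le> y / x * c * E" .
  qed (use xy in simp)
  \<comment> \<open>Radii in the range are positive, so the iterated \<open>deriv\<close> is the
    chain-rule expression \<open>D\<close>, and continuity turns the Lebesgue integral into the one
    used for the modes.\<close>
  have inner: "(LBINT \<theta>:{-pi..pi}. \<bar>(deriv ^^ m) (\<lambda>t. polar F t \<theta> - polar S t \<theta>) \<rho>\<bar>\<^sup>2 * \<rho>)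
      = \<rho> * integral {-pi..pi} (\<lambda>\<theta>. (D \<rho> \<theta>)\<^sup>2)" if \<rho>: "\<rho> \<in> {x..y}" for \<rho>
  proof -
    have "\<rho> > 0" using \<rho> xy by simp
    then have "(LBINT \<theta>:{-pi..pi}. \<bar>(deriv ^^ m) (\<lambda>t. polar F t \<theta> - polar S t \<theta>) \<rho>\<bar>\<^sup>2 * \<rho>)
        = (LBINT \<theta>:{-pi..pi}. (D \<rho> \<theta>)\<^sup>2 * \<rho>)" by (simp add: deriv)
    also have "\<dots> = integral {-pi..pi} (\<lambda>\<theta>. (D \<rho> \<theta>)\<^sup>2 * \<rho>)"
      by (intro LBINT_Icc_eq_integral continuous_intros continuous_on_slice[OF cD \<rho>])
    finally show ?thesis by (simp add: mult.commute)
  qed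
  have cont: "continuous_on {x..y} (\<lambda>\<rho>. \<rho> * integral {-pi..pi} (\<lambda>\<theta>. (D \<rho> \<theta>)\<^sup>2))"
  proof -
    have "continuous_on ({x..y} \<times> cbox (-pi) pi) (\<lambda>(t, \<theta>). (D t \<theta>)\<^sup>2)"
      using continuous_on_power[OF continuous_on_subset[OF cD], of "{x..y} \<times> cbox (-pi) pi" 2]
      by (auto simp: split_beta)
    from integral_continuous_on_param[OF this] show ?thesis
      by (intro continuous_intros) simp
  qed
  have "(LBINT \<rho>:{x..y}. LBINT \<theta>:{-pi..pi}. \<bar>(deriv ^^ m) (\<lambda>t. polar F t \<theta> - polar S t \<theta>) \<rho>\<bar>\<^sup>2 * \<rho>)
      = (LBINT \<rho>:{x..y}. \<rho> * integral {-pi..pi} (\<lambda>\<theta>. (D \<rho> \<theta>)\<^sup>2))"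
    by (rule set_lebesgue_integral_cong) (use inner in auto)
  also have "\<dots> = integral {x..y} (\<lambda>\<rho>. \<rho> * integral {-pi..pi} (\<lambda>\<theta>. (D \<rho> \<theta>)\<^sup>2))"
    by (rule LBINT_Icc_eq_integral[OF cont])
  also have "\<dots> \<le> y / x * c * E" by (rule total)
  finally have "sqrt (LBINT \<rho>:{x..y}. LBINT \<theta>:{-pi..pi}. \<bar>(deriv ^^ m) (\<lambda>t. polar F t \<theta> - polar S t \<theta>) \<rho>\<bar>\<^sup>2 * \<rho>)
      \<le> sqrt (y / x * c * E)" by (rule real_sqrt_le_mono)
  also have "\<dots> = sqrt c * sqrt (y / x) * BL_norm (polar F)"
    by (simp only: real_sqrt_mult BL_norm_def E_def mult_ac)
  also have "sqrt c = 2 powi (int m - 1) * h ^ (2 - m)"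
  proof (cases "m = 0")
    case True
    have "sqrt (h ^ 4) = h\<^sup>2" using real_sqrt_abs[of "h\<^sup>2"] by (simp flip: power_mult)
    with True show ?thesis by (simp add: c_def real_sqrt_divide power_int_minus)
  next
    case False
    then have "m = 1" using assms(12) by simp
    then show ?thesis using h0 by (simp add: c_def)
  qed
  finally show ?thesis by (simp only: x_def y_def mult_ac)
qed

end
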